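(* Let $K$ be a field containing an element of multiplicative order $12$, and let \[G=(\mathrm{C}_6\times \mathrm{C}_2)\rtimes \mathrm{C}_2=\langle a,b,c\mid a^6=b^2=c^2=1,\ ba=ab,\ cac=a^{-1},\ cbc=a^3b\rangle\] (a group of order $24$, isomorphic to $\mathrm{C}_3\rtimes \mathrm{D}_8$). Then $\beta_{\mathrm{sep}}^K(G)=9$.
   Context: Let $K$ be a field and $G$ a finite group with $\mathrm{char}(K)\nmid |G|$. For a finite dimensional $KG$-module $V$, $K[V]$ is the polynomial ring in the coordinate functions on $V$, on which $G$ acts by $(g\cdot f)(v)=f(g^{-1}v)$, and $K[V]^G$ is the subalgebra of $G$-invariants. A subset $S\subseteq K[V]^G$ is a separating set if whenever $v,w\in V$ have different $G$-orbits, there is $f\in S$ with $f(v)\ne f(w)$. The number $\beta_{\mathrm{sep}}(G,V)$ is the minimal positive integer $d$ such that the elements of $K[V]^G$ of degree at most $d$ form a separating set, and $\beta_{\mathrm{sep}}^K(G)$ is the supremum of $\beta_{\mathrm{sep}}(G,V)$ over all finite dimensional $KG$-modules $V$. *)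

theory Defs
  imports
    "Jordan_Normal_Form.Matrix"
    "HOL-Algebra.Group"
    "HOL-Algebra.Coset"
    "HOL-Library.Poly_Mapping"
    "HOL-Library.Extended_Nat"
begin

section \<open>Groups given by generators and relations\<close>

text \<open>A word is a list of letters; the letter \<open>(x, True)\<close> stands for the generator \<open>x\<close>
  and \<open>(x, False)\<close> for its formal inverse. A relation \<open>u = v\<close> is the pair \<open>(u, v)\<close>.\<close>

type_synonym 'x word = "('x \<times> bool) list"

inductive pres_eq :: "('x word \<times> 'x word) set \<Rightarrow> 'x word \<Rightarrow> 'x word \<Rightarrow> bool"
  for R :: "('x word \<times> 'x word) set" where
  rel: "(u, v) \<in> R \<Longrightarrow> pres_eq R u v"
| cancel: "pres_eq R [(x, e), (x, \<not> e)] []"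
| refl: "pres_eq R u u"
| sym: "pres_eq R u v \<Longrightarrow> pres_eq R v u"
| trans: "pres_eq R u v \<Longrightarrow> pres_eq R v w \<Longrightarrow> pres_eq R u w"
| app: "pres_eq R u u' \<Longrightarrow> pres_eq R v v' \<Longrightarrow> pres_eq R (u @ v) (u' @ v')"

definition pres_class :: "('x word \<times> 'x word) set \<Rightarrow> 'x word \<Rightarrow> 'x word set" where
  "pres_class R u = {v. pres_eq R u v}"

definition presented_group :: "('x word \<times> 'x word) set \<Rightarrow> 'x word set monoid" where
  "presented_group R =
    \<lparr>carrier = UNIV // {(u, v). pres_eq R u v},
     mult = (\<lambda>U V. \<Union>u\<in>U. \<Union>v\<in>V. pres_class R (u @ v)),
     one = pres_class R []\<rparr>"

datatype gen = GenA | GenB | GenC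

abbreviation "wa \<equiv> [(GenA, True)]"
abbreviation "wa_inv \<equiv> [(GenA, False)]"
abbreviation "wb \<equiv> [(GenB, True)]"
abbreviation "wc \<equiv> [(GenC, True)]"

definition rels24 :: "(gen word \<times> gen word) set" where
  "rels24 =
    {(wa @ wa @ wa @ wa @ wa @ wa, []), (wb @ wb, []), (wc @ wc, []),
     (wb @ wa, wa @ wb), (wc @ wa @ wc, wa_inv), (wc @ wb @ wc, wa @ wa @ wa @ wb)}"

definition G24 :: "gen word set monoid" where
  "G24 = presented_group rels24"


section \<open>Modules and polynomial invariants\<close>

text \<open>A \<open>KG\<close>-module of dimension \<open>n\<close> is taken in coordinates, i.e. as a homomorphism from \<open>G\<close>
  to the group of units of the ring of \<open>n \<times> n\<close> matrices, acting on column vectors.\<close>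

definition GL :: "nat \<Rightarrow> 'k::field mat monoid" where
  "GL n = units_of (ring_mat TYPE('k) n ())"

definition is_rep :: "('g, 'm) monoid_scheme \<Rightarrow> nat \<Rightarrow> ('g \<Rightarrow> 'k::field mat) \<Rightarrow> bool" where
  "is_rep G n \<rho> \<longleftrightarrow> \<rho> \<in> hom G (GL n)"

definition orbit ::
  "('g, 'm) monoid_scheme \<Rightarrow> ('g \<Rightarrow> 'k::field mat) \<Rightarrow> 'k vec \<Rightarrow> 'k vec set" where
  "orbit G \<rho> v = (\<lambda>g. \<rho> g *\<^sub>v v) ` carrier G"

text \<open>Polynomials are formal: a finitely supported map from exponent vectors to coefficients.
  The distinction from polynomial functions matters since \<open>K\<close> may be finite.\<close>

type_synonym 'k mpol = "(nat \<Rightarrow>\<^sub>0 nat) \<Rightarrow>\<^sub>0 'k"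

definition const_pol :: "'k::field \<Rightarrow> 'k mpol" where
  "const_pol c = Poly_Mapping.single 0 c"

definition var_pol :: "nat \<Rightarrow> 'k::field mpol" where
  "var_pol i = Poly_Mapping.single (Poly_Mapping.single i 1) 1"

definition pol_ring :: "nat \<Rightarrow> 'k::field mpol set" where
  "pol_ring n = {f. \<forall>m\<in>Poly_Mapping.keys f. Poly_Mapping.keys m \<subseteq> {..<n}}"

definition degree_le :: "'k::field mpol \<Rightarrow> nat \<Rightarrow> bool" where
  "degree_le f d \<longleftrightarrow>
    (\<forall>m\<in>Poly_Mapping.keys f. (\<Sum>i\<in>Poly_Mapping.keys m. Poly_Mapping.lookup m i) \<le> d)"

text \<open>Coefficients are mapped by \<open>c\<close> and the variable \<open>i\<close> is replaced by \<open>x i\<close>.\<close>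

definition pol_subst :: "('k::field \<Rightarrow> 'r::comm_ring_1) \<Rightarrow> (nat \<Rightarrow> 'r) \<Rightarrow> 'k mpol \<Rightarrow> 'r" where
  "pol_subst c x f =
    (\<Sum>m\<in>Poly_Mapping.keys f. c (Poly_Mapping.lookup f m) *
       (\<Prod>i\<in>Poly_Mapping.keys m. x i ^ Poly_Mapping.lookup m i))"

definition pol_eval :: "'k::field mpol \<Rightarrow> 'k vec \<Rightarrow> 'k" where
  "pol_eval f v = pol_subst (\<lambda>c. c) (\<lambda>i. v $ i) f"

text \<open>The polynomial \<open>f(A x)\<close>, where \<open>x\<close> is the vector of the \<open>n\<close> variables.\<close>

definition lin_subst :: "nat \<Rightarrow> 'k::field mat \<Rightarrow> 'k mpol \<Rightarrow> 'k mpol" where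
  "lin_subst n A f =
    pol_subst const_pol (\<lambda>i. \<Sum>j<n. const_pol (A $$ (i, j)) * var_pol j) f"

definition pol_act ::
  "('g, 'm) monoid_scheme \<Rightarrow> nat \<Rightarrow> ('g \<Rightarrow> 'k::field mat) \<Rightarrow> 'g \<Rightarrow> 'k mpol \<Rightarrow> 'k mpol" where
  "pol_act G n \<rho> g f = lin_subst n (\<rho> (inv\<^bsub>G\<^esub> g)) f"

definition invariants ::
  "('g, 'm) monoid_scheme \<Rightarrow> nat \<Rightarrow> ('g \<Rightarrow> 'k::field mat) \<Rightarrow> 'k mpol set" where
  "invariants G n \<rho> = {f \<in> pol_ring n. \<forall>g\<in>carrier G. pol_act G n \<rho> g f = f}"

definition separating_set ::
  "('g, 'm) monoid_scheme \<Rightarrow> nat \<Rightarrow> ('g \<Rightarrow> 'k::field mat) \<Rightarrow> 'k mpol set \<Rightarrow> bool" where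
  "separating_set G n \<rho> S \<longleftrightarrow>
    S \<subseteq> invariants G n \<rho> \<and>
    (\<forall>v\<in>carrier_vec n. \<forall>w\<in>carrier_vec n.
       orbit G \<rho> v \<noteq> orbit G \<rho> w \<longrightarrow> (\<exists>f\<in>S. pol_eval f v \<noteq> pol_eval f w))"

text \<open>Both values live in \<open>enat\<close>; the infimum would be infinite if no degree sufficed.\<close>

definition beta_sep_rep ::
  "('g, 'm) monoid_scheme \<Rightarrow> nat \<Rightarrow> ('g \<Rightarrow> 'k::field mat) \<Rightarrow> enat" where
  "beta_sep_rep G n \<rho> =
    Inf {enat d | d. 0 < d \<and> separating_set G n \<rho> {f \<in> invariants G n \<rho>. degree_le f d}}"

definition beta_sep :: "'k::field itself \<Rightarrow> ('g, 'm) monoid_scheme \<Rightarrow> enat" where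
  "beta_sep K G = Sup {beta_sep_rep G n \<rho> | n (\<rho> :: 'g \<Rightarrow> 'k mat). is_rep G n \<rho>}"


section \<open>The presented group of order 24\<close>

lemma equiv_pres_eq: "equiv UNIV {(u, v). pres_eq R u v}"
proof (rule equivI)
  show "refl {(u, v). pres_eq R u v}"
    by (rule refl_onI) (simp_all add: pres_eq.refl)
  show "sym {(u, v). pres_eq R u v}"
    by (rule symI) (simp add: pres_eq.sym)
  show "trans {(u, v). pres_eq R u v}"
    by (rule transI) (use pres_eq.trans in blast)
qed simp

lemma pres_class_eq_iff: "pres_class R u = pres_class R v \<longleftrightarrow> pres_eq R u v"
proof
  assume "pres_class R u = pres_class R v"
  moreover have "v \<in> pres_class R v"
    by (simp add: pres_class_def pres_eq.refl)
  ultimately show "pres_eq R u v"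
    by (auto simp: pres_class_def)
next
  assume uv: "pres_eq R u v"
  then have "pres_eq R u w \<longleftrightarrow> pres_eq R v w" for w
    using pres_eq.trans[OF uv, of w] pres_eq.trans[OF pres_eq.sym[OF uv], of w] by blast
  then show "pres_class R u = pres_class R v"
    by (simp add: pres_class_def)
qed

lemma carrier_presented_group: "carrier (presented_group R) = range (pres_class R)"
  by (auto simp: presented_group_def quotient_def pres_class_def)

lemma one_presented_group: "\<one>\<^bsub>presented_group R\<^esub> = pres_class R []"
  by (simp add: presented_group_def)

lemma mult_presented_group:
  "pres_class R u \<otimes>\<^bsub>presented_group R\<^esub> pres_class R v = pres_class R (u @ v)"
proof -
  have "pres_class R (u' @ v') = pres_class R (u @ v)"
    if "u' \<in> pres_class R u" "v' \<in> pres_class R v" for u' v'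
    unfolding pres_class_eq_iff
    by (rule pres_eq.sym, rule pres_eq.app) (use that in \<open>simp_all add: pres_class_def\<close>)
  then have "(\<Union>u'\<in>pres_class R u. \<Union>v'\<in>pres_class R v. pres_class R (u' @ v')) =
      (\<Union>u'\<in>pres_class R u. \<Union>v'\<in>pres_class R v. pres_class R (u @ v))"
    by (intro SUP_cong HOL.refl)
  also have "\<dots> = pres_class R (u @ v)"
  proof -
    have "u \<in> pres_class R u" "v \<in> pres_class R v"
      by (simp_all add: pres_class_def pres_eq.refl)
    then show ?thesis by blast
  qed
  finally show ?thesis
    by (simp add: presented_group_def)
qed

lemma pres_eq_left_inverse: "\<exists>v. pres_eq R (v @ u) []"
proof (induction u)
  case Nil
  show ?case by (rule exI[of _ "[]"]) (simp add: pres_eq.refl)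
next
  case (Cons l u)
  then obtain v where v: "pres_eq R (v @ u) []" by blast
  obtain x e where l: "l = (x, e)" by (cases l)
  have "pres_eq R ([(x, \<not> e)] @ [(x, e)]) []"
    using pres_eq.cancel[of R x "\<not> e"] by simp
  then have "pres_eq R (v @ ([(x, \<not> e)] @ [(x, e)]) @ u) (v @ [] @ u)"
    by (intro pres_eq.app pres_eq.refl)
  then have "pres_eq R ((v @ [(x, \<not> e)]) @ l # u) (v @ u)"
    by (simp add: l)
  then have "pres_eq R ((v @ [(x, \<not> e)]) @ l # u) []"
    using v by (rule pres_eq.trans)
  then show ?case by blast
qed

lemma group_presented_group: "group (presented_group R)"
proof (rule groupI)
  show "\<exists>y\<in>carrier (presented_group R). y \<otimes>\<^bsub>presented_group R\<^esub> x = \<one>\<^bsub>presented_group R\<^esub>"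
    if x: "x \<in> carrier (presented_group R)" for x
  proof -
    obtain u where "x = pres_class R u"
      using x by (auto simp: carrier_presented_group)
    moreover obtain v where "pres_eq R (v @ u) []"
      using pres_eq_left_inverse by blast
    ultimately show ?thesis
      by (intro bexI[of _ "pres_class R v"])
        (auto simp: carrier_presented_group mult_presented_group one_presented_group
          pres_class_eq_iff)
  qed
qed (auto simp: carrier_presented_group mult_presented_group one_presented_group)

lemma group_G24: "group G24"
  by (simp add: G24_def group_presented_group)

text \<open>Left multiplication of a letter on the normal forms \<open>a^i b^j c^k\<close>, each encoded as
  \<open>(i, j, k)\<close>.\<close>

fun letter_act :: "gen \<times> bool \<Rightarrow> nat \<times> nat \<times> nat \<Rightarrow> nat \<times> nat \<times> nat" where
  "letter_act (GenA, e) (i, j, k) = ((i + (if e then 1 else 5)) mod 6, j, k)"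
| "letter_act (GenB, e) (i, j, k) = (i, (j + 1) mod 2, k)"
| "letter_act (GenC, e) (i, j, k) = ((5 * i + 3 * j) mod 6, j, (k + 1) mod 2)"

abbreviation word_act :: "gen word \<Rightarrow> nat \<times> nat \<times> nat \<Rightarrow> nat \<times> nat \<times> nat" where
  "word_act u p \<equiv> foldr letter_act u p"

definition normal_forms :: "(nat \<times> nat \<times> nat) set" where
  "normal_forms = {..<6} \<times> {..<2} \<times> {..<2}"

lemma normal_forms_cases:
  assumes "p \<in> normal_forms"
  obtains i j k where "p = (i, j, k)" "i \<in> {0, 1, 2, 3, 4, 5}" "j \<in> {0, 1}" "k \<in> {0, 1}"
proof -
  obtain i j k where "p = (i, j, k)" by (cases p)
  moreover from this assms have "i < 6" "j < 2" "k < 2"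
    by (auto simp: normal_forms_def)
  then have "i \<in> {0, 1, 2, 3, 4, 5}" "j \<in> {0, 1}" "k \<in> {0, 1}" by auto
  ultimately show thesis using that by blast
qed

lemma letter_act_normal_forms: "p \<in> normal_forms \<Longrightarrow> letter_act l p \<in> normal_forms"
  by (cases "(l, p)" rule: letter_act.cases) (auto simp: normal_forms_def)

lemma word_act_normal_forms: "p \<in> normal_forms \<Longrightarrow> word_act u p \<in> normal_forms"
  by (induction u) (auto intro: letter_act_normal_forms)

lemma word_act_cong:
  "pres_eq rels24 u v \<Longrightarrow> p \<in> normal_forms \<Longrightarrow> word_act u p = word_act v p"
proof (induction arbitrary: p rule: pres_eq.induct)
  case (rel u v)
  then show ?case
    by (elim normal_forms_cases) (auto simp: rels24_def)
next
  case (cancel x e)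
  then show ?case
    by (elim normal_forms_cases) (cases x; cases e; auto)
next
  case (app u u' v v')
  then show ?case by (simp add: word_act_normal_forms)
qed simp_all

lemma letter_mult_normal_form:
  fixes G (structure) and h :: "gen \<Rightarrow> 'g"
  assumes "group G" and h: "\<And>x. h x \<in> carrier G"
    and a6: "h GenA [^] (6::nat) = \<one>" and bb: "h GenB \<otimes> h GenB = \<one>"
    and cc: "h GenC \<otimes> h GenC = \<one>" and ba: "h GenB \<otimes> h GenA = h GenA \<otimes> h GenB"
    and ca: "h GenC \<otimes> h GenA = h GenA [^] (5::nat) \<otimes> h GenC"
    and cb: "h GenC \<otimes> h GenB = h GenA [^] (3::nat) \<otimes> h GenB \<otimes> h GenC"
    and p: "(i, j, k) \<in> normal_forms" and p': "letter_act (x, e) (i, j, k) = (i', j', k')"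
  shows "(if e then h x else inv (h x)) \<otimes> (h GenA [^] i \<otimes> h GenB [^] j \<otimes> h GenC [^] k) =
    h GenA [^] i' \<otimes> h GenB [^] j' \<otimes> h GenC [^] k'"
proof -
  interpret group G by fact
  note [simp] = h
  have pow_a: "h GenA [^] (m mod 6) = h GenA [^] (m::nat)" for m
  proof -
    have "h GenA [^] m = h GenA [^] (6 * (m div 6) + m mod 6)" by simp
    also have "\<dots> = (h GenA [^] (6::nat)) [^] (m div 6) \<otimes> h GenA [^] (m mod 6)"
      by (simp only: nat_pow_mult[symmetric] nat_pow_pow h)
    finally show ?thesis by (simp add: a6)
  qed
  have pow_b: "h GenB \<otimes> h GenB [^] j = h GenB [^] ((j + 1) mod 2)"
  proof -
    have "j = 0 \<or> j = 1" using p by (auto simp: normal_forms_def)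
    then show ?thesis by (auto simp: bb)
  qed
  have pow_c: "h GenC \<otimes> h GenC [^] k = h GenC [^] ((k + 1) mod 2)"
  proof -
    have "k = 0 \<or> k = 1" using p by (auto simp: normal_forms_def)
    then show ?thesis by (auto simp: cc)
  qed
  have b_a: "h GenB \<otimes> h GenA [^] m = h GenA [^] m \<otimes> h GenB" for m :: nat
  proof (induction m)
    case (Suc m)
    have "h GenB \<otimes> h GenA [^] Suc m = (h GenB \<otimes> h GenA [^] m) \<otimes> h GenA"
      by (simp add: m_assoc)
    also have "\<dots> = h GenA [^] m \<otimes> (h GenB \<otimes> h GenA)"
      by (simp add: Suc m_assoc)
    also have "\<dots> = h GenA [^] Suc m \<otimes> h GenB"
      by (simp add: ba m_assoc)
    finally show ?case .
  qed simp
  have c_a: "h GenC \<otimes> h GenA [^] m = h GenA [^] (5 * m) \<otimes> h GenC" for m :: nat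
  proof (induction m)
    case (Suc m)
    have "h GenC \<otimes> h GenA [^] Suc m = (h GenC \<otimes> h GenA [^] m) \<otimes> h GenA"
      by (simp add: m_assoc)
    also have "\<dots> = h GenA [^] (5 * m) \<otimes> (h GenC \<otimes> h GenA)"
      by (simp add: Suc m_assoc)
    also have "\<dots> = (h GenA [^] (5 * m) \<otimes> h GenA [^] (5::nat)) \<otimes> h GenC"
      by (simp only: ca m_assoc h nat_pow_closed)
    also have "\<dots> = h GenA [^] (5 * Suc m) \<otimes> h GenC"
      by (simp add: nat_pow_mult add.commute)
    finally show ?case .
  qed simp
  have c_b: "h GenC \<otimes> h GenB [^] j = h GenA [^] (3 * j) \<otimes> h GenB [^] j \<otimes> h GenC"
  proof -
    have "j = 0 \<or> j = 1" using p by (auto simp: normal_forms_def)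
    then show ?thesis by (auto simp: cb)
  qed
  show ?thesis
  proof (cases x)
    case GenA
    have "inv (h GenA) = h GenA [^] (5::nat)"
    proof (rule inv_equality)
      show "h GenA [^] (5::nat) \<otimes> h GenA = \<one>"
        using a6 by (simp add: numeral_eq_Suc)
    qed simp_all
    then have "(if e then h x else inv (h x)) = h GenA [^] (if e then 1 else 5 :: nat)"
      using GenA by simp
    then show ?thesis
      using p' GenA by (auto simp: pow_a m_assoc[symmetric] nat_pow_mult add.commute
          simp del: nat_pow_Suc)
  next
    case GenB
    have "(if e then h x else inv (h x)) = h GenB"
      using GenB inv_equality[OF bb] by simp
    moreover have "h GenB \<otimes> (h GenA [^] i \<otimes> h GenB [^] j \<otimes> h GenC [^] k) =
        (h GenB \<otimes> h GenA [^] i) \<otimes> h GenB [^] j \<otimes> h GenC [^] k"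
      by (simp add: m_assoc)
    moreover have "\<dots> = h GenA [^] i \<otimes> (h GenB \<otimes> h GenB [^] j) \<otimes> h GenC [^] k"
      by (simp add: b_a m_assoc)
    ultimately show ?thesis
      using p' GenB by (auto simp: pow_b)
  next
    case GenC
    have "(if e then h x else inv (h x)) = h GenC"
      using GenC inv_equality[OF cc] by simp
    moreover have "h GenC \<otimes> (h GenA [^] i \<otimes> h GenB [^] j \<otimes> h GenC [^] k) =
        (h GenC \<otimes> h GenA [^] i) \<otimes> h GenB [^] j \<otimes> h GenC [^] k"
      by (simp add: m_assoc)
    moreover have "\<dots> = h GenA [^] (5 * i) \<otimes> (h GenC \<otimes> h GenB [^] j) \<otimes> h GenC [^] k"
      by (simp add: c_a m_assoc)
    moreover have "\<dots> = (h GenA [^] (5 * i) \<otimes> h GenA [^] (3 * j)) \<otimes> h GenB [^] j \<otimes>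
        (h GenC \<otimes> h GenC [^] k)"
      by (simp add: c_b m_assoc)
    ultimately show ?thesis
      using p' GenC by (auto simp: pow_c pow_a nat_pow_mult)
  qed
qed

abbreviation gen24 :: "gen \<Rightarrow> gen word set" where
  "gen24 x \<equiv> pres_class rels24 [(x, True)]"

lemma pres_class_mult24: "pres_class rels24 u \<otimes>\<^bsub>G24\<^esub> pres_class rels24 v = pres_class rels24 (u @ v)"
  by (simp add: G24_def mult_presented_group)

lemma pres_class_carrier24 [simp]: "pres_class rels24 u \<in> carrier G24"
  by (simp add: G24_def carrier_presented_group)

lemma pres_class_Nil24: "pres_class rels24 [] = \<one>\<^bsub>G24\<^esub>"
  by (simp add: G24_def one_presented_group)

lemma inv_gen24: "inv\<^bsub>G24\<^esub> gen24 x = pres_class rels24 [(x, False)]"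
proof (rule group.inv_equality[OF group_G24])
  show "pres_class rels24 [(x, False)] \<otimes>\<^bsub>G24\<^esub> gen24 x = \<one>\<^bsub>G24\<^esub>"
    using pres_eq.cancel[of rels24 x False]
    by (simp add: pres_class_mult24 pres_class_eq_iff flip: pres_class_Nil24)
qed simp_all

lemma pres_class_letter24:
  "pres_class rels24 [(x, e)] = (if e then gen24 x else inv\<^bsub>G24\<^esub> gen24 x)"
  by (simp add: inv_gen24)

lemma rels24_class: "(u, v) \<in> rels24 \<Longrightarrow> pres_class rels24 u = pres_class rels24 v"
  by (simp add: pres_class_eq_iff pres_eq.rel)

lemma pow24: "gen24 x [^]\<^bsub>G24\<^esub> (m::nat) = pres_class rels24 (replicate m (x, True))"
proof (induction m)
  case (Suc m)
  have "gen24 x [^]\<^bsub>G24\<^esub> Suc m = pres_class rels24 (replicate m (x, True) @ [(x, True)])"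
    by (simp add: nat_pow_def Suc[unfolded nat_pow_def] pres_class_mult24)
  then show ?case by (simp add: replicate_append_same)
qed (simp add: nat_pow_def pres_class_Nil24)

lemma relations24:
  "gen24 GenA [^]\<^bsub>G24\<^esub> (6::nat) = \<one>\<^bsub>G24\<^esub>"
  "gen24 GenB \<otimes>\<^bsub>G24\<^esub> gen24 GenB = \<one>\<^bsub>G24\<^esub>"
  "gen24 GenC \<otimes>\<^bsub>G24\<^esub> gen24 GenC = \<one>\<^bsub>G24\<^esub>"
  "gen24 GenB \<otimes>\<^bsub>G24\<^esub> gen24 GenA = gen24 GenA \<otimes>\<^bsub>G24\<^esub> gen24 GenB"
  "gen24 GenC \<otimes>\<^bsub>G24\<^esub> gen24 GenA \<otimes>\<^bsub>G24\<^esub> gen24 GenC = inv\<^bsub>G24\<^esub> gen24 GenA"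
  "gen24 GenC \<otimes>\<^bsub>G24\<^esub> gen24 GenB \<otimes>\<^bsub>G24\<^esub> gen24 GenC =
    gen24 GenA [^]\<^bsub>G24\<^esub> (3::nat) \<otimes>\<^bsub>G24\<^esub> gen24 GenB"
  unfolding pow24 pres_class_mult24 inv_gen24 pres_class_Nil24[symmetric]
  by (rule rels24_class, simp add: rels24_def numeral_eq_Suc)+

lemma pres_class_normal_form:
  assumes "word_act u (0, 0, 0) = (i, j, k)"
  shows "pres_class rels24 u =
    gen24 GenA [^]\<^bsub>G24\<^esub> i \<otimes>\<^bsub>G24\<^esub> gen24 GenB [^]\<^bsub>G24\<^esub> j \<otimes>\<^bsub>G24\<^esub> gen24 GenC [^]\<^bsub>G24\<^esub> k"
  using assms
proof (induction u arbitrary: i j k)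
  interpret group G24 by (rule group_G24)
  case Nil
  then show ?case by (simp add: pres_class_Nil24)
next
  interpret group G24 by (rule group_G24)
  case (Cons l u)
  obtain x e where l: "l = (x, e)" by (cases l)
  obtain i0 j0 k0 where p: "word_act u (0, 0, 0) = (i0, j0, k0)"
    by (cases "word_act u (0, 0, 0)")
  have "(0, 0, 0) \<in> normal_forms" by (simp add: normal_forms_def)
  then have nf: "(i0, j0, k0) \<in> normal_forms"
    using word_act_normal_forms[of "(0, 0, 0)" u] p by simp
  have move: "gen24 GenC \<otimes>\<^bsub>G24\<^esub> y = z \<otimes>\<^bsub>G24\<^esub> gen24 GenC"
    if yz: "gen24 GenC \<otimes>\<^bsub>G24\<^esub> y \<otimes>\<^bsub>G24\<^esub> gen24 GenC = z"
      and y: "y \<in> carrier G24" for y z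
  proof -
    have "z \<otimes>\<^bsub>G24\<^esub> gen24 GenC =
        gen24 GenC \<otimes>\<^bsub>G24\<^esub> y \<otimes>\<^bsub>G24\<^esub> (gen24 GenC \<otimes>\<^bsub>G24\<^esub> gen24 GenC)"
      unfolding yz[symmetric] by (intro m_assoc m_closed y pres_class_carrier24)
    then show ?thesis using y by (simp add: relations24(3))
  qed
  have inv_a: "inv\<^bsub>G24\<^esub> gen24 GenA = gen24 GenA [^]\<^bsub>G24\<^esub> (5::nat)"
  proof (rule inv_equality)
    show "gen24 GenA [^]\<^bsub>G24\<^esub> (5::nat) \<otimes>\<^bsub>G24\<^esub> gen24 GenA = \<one>\<^bsub>G24\<^esub>"
      using relations24(1) by (simp add: numeral_eq_Suc)
  qed simp_all
  have "pres_class rels24 (l # u) = pres_class rels24 [(x, e)] \<otimes>\<^bsub>G24\<^esub> pres_class rels24 u"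
    by (simp add: pres_class_mult24 l)
  also have "\<dots> = (if e then gen24 x else inv\<^bsub>G24\<^esub> gen24 x) \<otimes>\<^bsub>G24\<^esub>
      (gen24 GenA [^]\<^bsub>G24\<^esub> i0 \<otimes>\<^bsub>G24\<^esub> gen24 GenB [^]\<^bsub>G24\<^esub> j0 \<otimes>\<^bsub>G24\<^esub> gen24 GenC [^]\<^bsub>G24\<^esub> k0)"
    unfolding Cons.IH[OF p] pres_class_letter24[of x e] by (rule HOL.refl)
  also have "\<dots> = gen24 GenA [^]\<^bsub>G24\<^esub> i \<otimes>\<^bsub>G24\<^esub> gen24 GenB [^]\<^bsub>G24\<^esub> j \<otimes>\<^bsub>G24\<^esub> gen24 GenC [^]\<^bsub>G24\<^esub> k"
  proof (rule letter_mult_normal_form[OF group_G24 _ relations24(1-4)])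
    show "gen24 GenC \<otimes>\<^bsub>G24\<^esub> gen24 GenA = gen24 GenA [^]\<^bsub>G24\<^esub> (5::nat) \<otimes>\<^bsub>G24\<^esub> gen24 GenC"
      using relations24(5) by (intro move) (simp_all add: inv_a)
    show "gen24 GenC \<otimes>\<^bsub>G24\<^esub> gen24 GenB =
        gen24 GenA [^]\<^bsub>G24\<^esub> (3::nat) \<otimes>\<^bsub>G24\<^esub> gen24 GenB \<otimes>\<^bsub>G24\<^esub> gen24 GenC"
      using relations24(6) by (intro move) simp_all
    show "letter_act (x, e) (i0, j0, k0) = (i, j, k)"
      using Cons.prems p by (simp add: l)
  qed (use nf in simp_all)
  finally show ?case .
qed

lemma order_G24: "order G24 = 24"
proof -
  let ?o = "(0, 0, 0) :: nat \<times> nat \<times> nat"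
  have o: "?o \<in> normal_forms" by (simp add: normal_forms_def)
  have same: "pres_class rels24 u = pres_class rels24 v \<longleftrightarrow> word_act u ?o = word_act v ?o" for u v
  proof
    show "word_act u ?o = word_act v ?o" if "pres_class rels24 u = pres_class rels24 v"
      using that word_act_cong[OF _ o] by (simp add: pres_class_eq_iff)
    show "pres_class rels24 u = pres_class rels24 v" if "word_act u ?o = word_act v ?o"
      using that pres_class_normal_form[of u] pres_class_normal_form[of v]
      by (cases "word_act v ?o") simp
  qed
  have "range (\<lambda>u. word_act u ?o) = normal_forms"
  proof
    show "range (\<lambda>u. word_act u ?o) \<subseteq> normal_forms"
      using word_act_normal_forms[OF o] by blast
    show "normal_forms \<subseteq> range (\<lambda>u. word_act u ?o)"
    proof
      fix p assume "p \<in> normal_forms"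
      then obtain i j k where p: "p = (i, j, k)" "i < 6" "j < 2" "k < 2"
        by (auto simp: normal_forms_def)
      have a: "word_act (replicate m (GenA, True)) (0, j', k') = (m mod 6, j', k')" for m j' k'
        by (induction m) (auto simp: mod_Suc_eq)
      have b: "word_act (replicate m (GenB, True)) (0, 0, k') = (0, m mod 2, k')" for m k'
        by (induction m) (auto simp: mod_Suc_eq)
      have c: "word_act (replicate m (GenC, True)) ?o = (0, 0, m mod 2)" for m
        by (induction m) (auto simp: mod_Suc_eq)
      have "word_act (replicate i (GenA, True) @ replicate j (GenB, True) @
          replicate k (GenC, True)) ?o = p"
        using p by (simp only: foldr_append comp_def a b c) simp
      then show "p \<in> range (\<lambda>u. word_act u ?o)" by (metis rangeI)
    qed
  qed
  moreover have "carrier G24 = range (pres_class rels24)"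
    by (simp add: G24_def carrier_presented_group)
  moreover have "bij_betw (\<lambda>U. word_act (SOME u. pres_class rels24 u = U) ?o)
      (range (pres_class rels24)) (range (\<lambda>u. word_act u ?o))"
  proof -
    have "word_act (SOME u'. pres_class rels24 u' = pres_class rels24 u) ?o = word_act u ?o" for u
      using someI[of "\<lambda>u'. pres_class rels24 u' = pres_class rels24 u" u] same by blast
    then show ?thesis
      by (auto simp: bij_betw_def inj_on_def image_image same)
  qed
  ultimately have "card (carrier G24) = card normal_forms"
    using bij_betw_same_card by metis
  then show ?thesis
    by (simp add: order_def normal_forms_def)
qed

end

theory Submission
  imports Defs
begin

text \<open>Split a module under \<open>A = \<langle>a, b\<rangle>\<close> into weight spaces. For a product \<open>m\<close> of weight functionals with total
  weight zero, \<open>m + m \<circ> c\<close> is \<open>G\<close>-invariant, and all invariants come from such sums. Suppose \<open>v\<close>, \<open>w\<close> agree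
  on the invariants of degree at most \<open>9\<close>. If some \<open>m\<close> of degree \<open>d \<le> 4\<close> takes different values at \<open>v\<close> and
  \<open>c v\<close>, then after possibly replacing \<open>w\<close> by \<open>c w\<close> all \<open>A\<close>-invariant monomials of degree at most \<open>9 - d\<close>
  agree at \<open>v\<close> and \<open>w\<close>. If none does, the position of \<open>c v\<close> relative to \<open>v\<close> is so restricted that few
  monomials decide whether \<open>w\<close> lies in \<open>A v\<close> or \<open>A c v\<close>. To find the element of \<open>A\<close>, one aligns \<open>w\<close> with \<open>v\<close> on one
  functional and uses it to neutralise the weights of the others.

  For the lower bound, let \<open>a\<close>, \<open>b\<close> act on the coordinates \<open>x\<close>, \<open>y\<close>, \<open>u\<close> by \<open>diag(\<zeta>, \<zeta>\<^sup>-\<^sup>1, 1)\<close> and \<open>diag(1, -1, -1)\<close>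
  with \<open>\<zeta> = z\<^sup>2\<close>, and let \<open>c\<close> swap \<open>x\<close>, \<open>y\<close> and negate \<open>u\<close>. Invariants of odd degree in \<open>u\<close> are multiples of
  \<open>(x\<^sup>6 - y\<^sup>6) x y u\<close>, so those of degree at most \<open>8\<close> do not separate \<open>(1, z, 1)\<close> from \<open>(1, z, -1)\<close>.\<close>

text \<open>The bound decomposes as 9 = 3 + 6. Products of three functionals are unavoidable because
  the three nontrivial characters of the Klein four-group generated by \<open>a^3\<close> and
  \<open>b\<close> multiply to one, a relation that pairs do not see; neutralising the remaining
  weight modulo 3 by an even power of one functional costs up to 6. The limit \<open>d <= 4\<close>
  comes from the square \<open>m^2\<close>, of degree \<open>2 d\<close>: the sums for
  \<open>m\<close> and \<open>m^2\<close> fix the pair \<open>m v\<close>, \<open>m (c v)\<close> up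
  to order, and that order is the choice between \<open>w\<close> and \<open>c w\<close>. The
  obstacle is a point that low degree does not tell from its image under \<open>c\<close>. Linearity
  of the weight spaces helps there: either some functional of a weight of order 6 vanishes at
  exactly one of \<open>v\<close>, \<open>c v\<close>, which is settled directly, or
  \<open>v\<close> and \<open>c v\<close> have proportional components in every such weight space.
  Since \<open>K\<close> may be finite, an invariant function need not come with an invariant formal
  polynomial; summing over the group supplies one, and 24 is nonzero in \<open>K\<close>. In the
  example, order 12 matters for the point rather than for the module: \<open>z^6 = -1\<close> keeps
  \<open>x^6 - y^6\<close> away from zero.\<close>

text \<open>Weights are added as natural numbers and never reduced, so that having weight zero
  becomes a divisibility condition on sums. Closing under binary products, instead of fixing a list
  of factors, lets monomials be multiplied together.\<close>

inductive wt_prod :: "(nat \<Rightarrow> nat \<Rightarrow> nat \<Rightarrow> ('x \<Rightarrow> 'k) set) \<Rightarrow> nat \<Rightarrow> nat \<Rightarrow> nat \<Rightarrow> nat \<Rightarrow>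
    ('x \<Rightarrow> 'k::comm_monoid_mult) \<Rightarrow> bool" for W where
  wt_prod_single: "f \<in> W i j k \<Longrightarrow> wt_prod W 1 i j k f"
| wt_prod_mult: "wt_prod W d i j k f \<Longrightarrow> wt_prod W d' i' j' k' g \<Longrightarrow>
    wt_prod W (d + d') (i + i') (j + j') (k + k') (\<lambda>x. f x * g x)"

definition zero_sum where
  "zero_sum W D m \<longleftrightarrow>
    (\<exists>d i j k. wt_prod W d i j k m \<and> d \<le> D \<and> 3 dvd i \<and> 2 dvd j \<and> 2 dvd k)"

lemma wt_prod_list:
  assumes "fs \<noteq> []" "\<forall>(f, i, j, k) \<in> set fs. f \<in> W i j k"
  shows "wt_prod W (length fs) (\<Sum>(f, i, j, k)\<leftarrow>fs. i) (\<Sum>(f, i, j, k)\<leftarrow>fs. j) (\<Sum>(f, i, j, k)\<leftarrow>fs. k)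
    (\<lambda>x. \<Prod>(f, i, j, k)\<leftarrow>fs. f x)"
  using assms
proof (induction fs rule: list_nonempty_induct)
  case (single p)
  then show ?case by (cases p) (auto dest: wt_prod_single)
next
  case (cons p fs)
  obtain f i j k where p: "p = (f, i, j, k)" by (cases p)
  have "f \<in> W i j k" using cons.prems p by simp
  from wt_prod_mult[OF wt_prod_single[of f W, OF this] cons.IH] cons.prems p
  show ?case by simp
qed

lemma zero_sum_prod_list:
  assumes "fs \<noteq> []" "\<forall>(f, i, j, k) \<in> set fs. f \<in> W i j k" "length fs \<le> D"
    "3 dvd (\<Sum>(f, i, j, k)\<leftarrow>fs. i)" "2 dvd (\<Sum>(f, i, j, k)\<leftarrow>fs. j)" "2 dvd (\<Sum>(f, i, j, k)\<leftarrow>fs. k)"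
  shows "zero_sum W D (\<lambda>x. \<Prod>(f, i, j, k)\<leftarrow>fs. f x)"
  unfolding zero_sum_def using wt_prod_list[OF assms(1,2)] assms(3-) by blast

lemma zero_sum_mono: "zero_sum W D m \<Longrightarrow> D \<le> D' \<Longrightarrow> zero_sum W D' m"
  unfolding zero_sum_def using le_trans by blast

lemma zero_sum_mult:
  assumes "zero_sum W D m" "zero_sum W D' m'"
  shows "zero_sum W (D + D') (\<lambda>x. m x * m' x)"
proof -
  obtain d i j k d' i' j' k' where
    1: "wt_prod W d i j k m" "d \<le> D" "3 dvd i" "2 dvd j" "2 dvd k" and
    2: "wt_prod W d' i' j' k' m'" "d' \<le> D'" "3 dvd i'" "2 dvd j'" "2 dvd k'"
    using assms unfolding zero_sum_def by blast
  show ?thesis unfolding zero_sum_def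
    by (intro exI[of _ "d + d'"] exI[of _ "i + i'"] exI[of _ "j + j'"] exI[of _ "k + k'"] conjI
      wt_prod_mult 1 2 add_mono dvd_add)
qed

section \<open>Elementary identities in a field\<close>

text \<open>Since \<open>\<omega>\<close> is a root of \<open>t^2 + t + 1\<close>, the form
  \<open>x^3 - y^3\<close> splits into three linear factors.\<close>

lemma cube_eq_cases:
  fixes x y \<omega> :: "'k::field"
  assumes "\<omega> ^ 3 = 1" "\<omega> \<noteq> 1" "x ^ 3 = y ^ 3"
  shows "x = y \<or> x = \<omega> * y \<or> x = \<omega> ^ 2 * y"
proof -
  have "(\<omega> - 1) * (\<omega> ^ 2 + \<omega> + 1) = 0"
    using assms(1) by (simp add: power2_eq_square power3_eq_cube algebra_simps)
  then have *: "\<omega> ^ 2 + \<omega> + 1 = 0" using assms(2) by simp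
  have "(x - y) * (x - \<omega> * y) * (x - \<omega> ^ 2 * y) = 
     x^3 - \<omega>^3*y^3 - (\<omega> ^ 2 + \<omega> + 1) * (x^2*y - \<omega>*x*y^2)"
    by (simp add: power2_eq_square power3_eq_cube algebra_simps)
  also have "\<dots> = 0" using * assms by simp
  finally show ?thesis by auto
qed

text \<open>A nonzero value is its cube divided by its square. Squaring kills sign weights and
  cubing kills weights of order 3, so the two powers can be compared through different
  monomials.\<close>

lemma square_cube_eq:
  fixes x y :: "'k::field"
  assumes "x * x = y * y" "x * x * x = y * y * y"
  shows "x = y"
  using assms by (metis mult_cancel_left mult_eq_0_iff)

text \<open>Away from characteristic 2 the first two power sums determine the sum and the product,
  hence the quadratic with these roots.\<close>

lemma same_pair:
  fixes a b :: "'k::field"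
  assumes "(2::'k) \<noteq> 0" "a + b = a' + b'" "a * a + b * b = a' * a' + b' * b'"
  shows "a = a' \<and> b = b' \<or> a = b' \<and> b = a'"
proof -
  have sq: "2 * (x * y) = (x + y) * (x + y) - (x * x + y * y)" for x y :: 'k
    by (simp add: algebra_simps)
  have "2 * (a * b) = 2 * (a' * b')" unfolding sq assms(2,3) ..
  then have ab: "a * b = a' * b'" using assms(1) by simp
  have "(a - a') * (a - b') = a * a - a * (a' + b') + a' * b'" by (simp add: algebra_simps)
  also have "\<dots> = 0" unfolding assms(2)[symmetric] ab[symmetric] by (simp add: algebra_simps)
  finally have "a = a' \<or> a = b'" by auto
  then show ?thesis using assms(2) by (auto simp: add.commute)
qed

lemma same_pair_prod:
  fixes a b :: "'k::field"
  assumes "a + b = a' + b'" "a * b = a' * b'"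
  shows "a = a' \<or> a = b'"
proof -
  have "(a - a') * (a - b') = a * a - a * (a' + b') + a' * b'" by (simp add: algebra_simps)
  also have "\<dots> = 0" unfolding assms[symmetric] by (simp add: algebra_simps)
  finally show ?thesis by auto
qed

lemma wt_prod_power:
  assumes "f \<in> W i j k" "0 < n"
  shows "wt_prod W n (n * i) (n * j) (n * k) (\<lambda>x. f x ^ n)"
  using assms(2)
proof (induction n rule: nat_induct_non_zero)
  case 1
  then show ?case using wt_prod_single[of f W, OF assms(1)] by simp
next
  case (Suc n)
  then show ?case using wt_prod_mult[OF wt_prod_single[of f W, OF assms(1)] Suc(2)] by simp
qed

lemma cancel_eq:
  fixes a b :: "'k::field"
  assumes "a * c = b * d" "c = d" "c \<noteq> 0" shows "a = b"
  using assms by simp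

section \<open>Separating orbits by weight monomials\<close>

text \<open>\<open>T\<close>, \<open>S\<close>, \<open>B\<close>, \<open>C\<close> are the actions of \<open>a\<^sup>2\<close>, \<open>a\<^sup>3\<close>, \<open>b\<close>, \<open>c\<close>, and \<open>W i j k\<close> consists of the
  functionals on which \<open>T\<close>, \<open>S\<close>, \<open>B\<close> act by \<open>\<omega>\<^sup>i\<close>, \<open>(-1)\<^sup>j\<close>, \<open>(-1)\<^sup>k\<close>. The index \<open>i\<close> matters modulo
  \<open>3\<close> only, and \<open>j\<close>, \<open>k\<close> modulo \<open>2\<close>. The relation \<open>E\<close> is to be read as lying in the same orbit.\<close>

locale weight_system =
  fixes X :: "'x set" and T S B C :: "'x \<Rightarrow> 'x"
    and W :: "nat \<Rightarrow> nat \<Rightarrow> nat \<Rightarrow> ('x \<Rightarrow> 'k::field) set"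
    and \<omega> :: 'k and E :: "'x \<Rightarrow> 'x \<Rightarrow> bool"
  assumes omega: "\<omega> ^ 3 = 1" "\<omega> \<noteq> 1" and two: "(2::'k) \<noteq> 0"
    and closed: "x \<in> X \<Longrightarrow> T x \<in> X" "x \<in> X \<Longrightarrow> S x \<in> X" "x \<in> X \<Longrightarrow> B x \<in> X" "x \<in> X \<Longrightarrow> C x \<in> X"
    and CC: "x \<in> X \<Longrightarrow> C (C x) = x"
    and W_T: "f \<in> W i j k \<Longrightarrow> x \<in> X \<Longrightarrow> f (T x) = \<omega> ^ i * f x"
    and W_S: "f \<in> W i j k \<Longrightarrow> x \<in> X \<Longrightarrow> f (S x) = (- 1) ^ j * f x"
    and W_B: "f \<in> W i j k \<Longrightarrow> x \<in> X \<Longrightarrow> f (B x) = (- 1) ^ k * f x"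
    and W_C: "f \<in> W i j k \<Longrightarrow> (\<lambda>x. f (C x)) \<in> W (2 * i) j (j + k)"
    and W_mod: "f \<in> W i j k \<Longrightarrow> i mod 3 = i' mod 3 \<Longrightarrow> j mod 2 = j' mod 2 \<Longrightarrow>
      k mod 2 = k' mod 2 \<Longrightarrow> f \<in> W i' j' k'"
    and W_lin: "f \<in> W i j k \<Longrightarrow> g \<in> W i j k \<Longrightarrow> (\<lambda>x. c * f x - d * g x) \<in> W i j k"
    and W_sep: "x \<in> X \<Longrightarrow> y \<in> X \<Longrightarrow>
      (\<And>i j k f. i < 3 \<Longrightarrow> j < 2 \<Longrightarrow> k < 2 \<Longrightarrow> f \<in> W i j k \<Longrightarrow> f x = f y) \<Longrightarrow> x = y"
    and E_gen: "x \<in> X \<Longrightarrow> E x (T x)" "x \<in> X \<Longrightarrow> E x (S x)" "x \<in> X \<Longrightarrow> E x (B x)" "x \<in> X \<Longrightarrow> E x (C x)"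
    and E_refl: "E x x" and E_sym: "E x y \<Longrightarrow> E y x" and E_trans: "E x y \<Longrightarrow> E y z \<Longrightarrow> E x z"
begin

abbreviation Z where "Z \<equiv> zero_sum W"

definition agree where "agree D v w \<longleftrightarrow> (\<forall>m. Z D m \<longrightarrow> m v = m w)"
definition C_symmetric where "C_symmetric D v \<longleftrightarrow> (\<forall>m. Z D m \<longrightarrow> m v = m (C v))"
definition sums_agree where "sums_agree v w \<longleftrightarrow> (\<forall>m. Z 9 m \<longrightarrow> m v + m (C v) = m w + m (C w))"
text \<open>Keeps only the needed consequences of lying in one orbit under \<open>T\<close>,
  \<open>S\<close>, \<open>B\<close>. Vanishing is recorded separately because a single functional
  is not invariant.\<close>

definition A_equiv where "A_equiv w w1 \<longleftrightarrow> w1 \<in> X \<and> E w w1 \<and> (\<forall>D m. Z D m \<longrightarrow> m w1 = m w) \<and>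
  (\<forall>i j k. \<forall>f \<in> W i j k. f w = 0 \<longrightarrow> f w1 = 0)"

section \<open>Moving a point under \<open>T\<close>, \<open>S\<close>, \<open>B\<close>\<close>

lemma wt_prod_T: "wt_prod W d i j k m \<Longrightarrow> x \<in> X \<Longrightarrow> m (T x) = \<omega> ^ i * m x"
  by (induction rule: wt_prod.induct) (auto simp: W_T power_add)
lemma wt_prod_S: "wt_prod W d i j k m \<Longrightarrow> x \<in> X \<Longrightarrow> m (S x) = (- 1) ^ j * m x"
  by (induction rule: wt_prod.induct) (auto simp: W_S power_add)
lemma wt_prod_B: "wt_prod W d i j k m \<Longrightarrow> x \<in> X \<Longrightarrow> m (B x) = (- 1) ^ k * m x"
  by (induction rule: wt_prod.induct) (auto simp: W_B power_add)

lemma wt_prod_C: "wt_prod W d i j k m \<Longrightarrow> wt_prod W d (2 * i) j (j + k) (\<lambda>x. m (C x))"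
proof (induction rule: wt_prod.induct)
  case (wt_prod_single f i j k)
  then show ?case by (intro wt_prod.wt_prod_single W_C)
next
  case (wt_prod_mult d i j k f d' i' j' k' g)
  then show ?case
    using wt_prod.wt_prod_mult[OF wt_prod_mult.IH] by (simp add: algebra_simps)
qed

lemma omega_dvd: "3 dvd i \<Longrightarrow> \<omega> ^ i = 1"
  by (auto elim!: dvdE simp: power_mult omega)

lemma zero_sum_T: "Z D m \<Longrightarrow> x \<in> X \<Longrightarrow> m (T x) = m x"
  unfolding zero_sum_def by (auto simp: omega_dvd dest: wt_prod_T)
lemma zero_sum_S: "Z D m \<Longrightarrow> x \<in> X \<Longrightarrow> m (S x) = m x"
  unfolding zero_sum_def by (auto dest: wt_prod_S)
lemma zero_sum_B: "Z D m \<Longrightarrow> x \<in> X \<Longrightarrow> m (B x) = m x"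
  unfolding zero_sum_def by (auto dest: wt_prod_B)
lemma zero_sum_C: "Z D m \<Longrightarrow> Z D (\<lambda>x. m (C x))"
  unfolding zero_sum_def by (elim exE conjE, intro exI conjI, erule wt_prod_C) auto

lemma A_equiv_refl: "w \<in> X \<Longrightarrow> A_equiv w w"
  by (simp add: A_equiv_def E_refl)
lemma A_equiv_trans: "A_equiv w w1 \<Longrightarrow> A_equiv w1 w2 \<Longrightarrow> A_equiv w w2"
  unfolding A_equiv_def by (intro conjI; metis E_trans)
lemma A_equiv_T: "w \<in> X \<Longrightarrow> A_equiv w (T w)"
  by (auto simp: A_equiv_def closed E_gen zero_sum_T W_T)
lemma A_equiv_S: "w \<in> X \<Longrightarrow> A_equiv w (S w)"
  by (auto simp: A_equiv_def closed E_gen zero_sum_S W_S)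
lemma A_equiv_B: "w \<in> X \<Longrightarrow> A_equiv w (B w)"
  by (auto simp: A_equiv_def closed E_gen zero_sum_B W_B)
lemma A_equiv_X: "A_equiv w w1 \<Longrightarrow> w1 \<in> X" by (simp add: A_equiv_def)
lemma A_equiv_agree: "A_equiv w w1 \<Longrightarrow> agree D v w \<Longrightarrow> agree D v w1"
  unfolding A_equiv_def agree_def by metis
lemma A_equiv_E: "A_equiv w w1 \<Longrightarrow> E v w1 \<Longrightarrow> E v w"
  unfolding A_equiv_def using E_trans E_sym by blast
lemma A_equiv_Z: "A_equiv w w1 \<Longrightarrow> Z D m \<Longrightarrow> m w1 = m w"
  by (auto simp: A_equiv_def)
lemma A_equiv_zero: "A_equiv w w1 \<Longrightarrow> f \<in> W i j k \<Longrightarrow> f w = 0 \<Longrightarrow> f w1 = 0"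
  by (auto simp: A_equiv_def)

text \<open>The values of \<open>m\<close> at \<open>w\<close>, \<open>T w\<close>,
  \<open>T (T w)\<close> are \<open>m w\<close> times the three cube roots of unity, and
  \<open>m v\<close> is one of these.\<close>

lemma align3:
  assumes w: "w \<in> X" and m: "wt_prod W d i j k m" "\<not> 3 dvd i" and eq: "m v ^ 3 = m w ^ 3"
  obtains w1 where "A_equiv w w1" "m w1 = m v"
proof -
  have TT: "A_equiv w (T (T w))" by (rule A_equiv_trans[OF A_equiv_T[OF w] A_equiv_T[OF closed(1)[OF w]]])
  have i: "i mod 3 = 1 \<or> i mod 3 = 2" using m(2) by presburger
  have "\<omega> ^ i = \<omega> ^ (3 * (i div 3) + i mod 3)" by simp
  also have "\<dots> = \<omega> ^ (i mod 3)" unfolding power_add by (simp add: omega_dvd)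
  finally have pw: "\<omega> ^ i = \<omega> ^ (i mod 3)" .
  have T1: "m (T w) = \<omega> ^ i * m w" by (rule wt_prod_T[OF m(1) w])
  have T2: "m (T (T w)) = (\<omega> ^ i * \<omega> ^ i) * m w"
    using wt_prod_T[OF m(1) closed(1)[OF w]] T1 by (simp add: mult.assoc)
  have "\<omega>\<^sup>2 * \<omega>\<^sup>2 = \<omega> ^ 3 * \<omega>" by (simp add: power2_eq_square power3_eq_cube mult_ac)
  then have o4: "\<omega>\<^sup>2 * \<omega>\<^sup>2 = \<omega>" using omega(1) by simp
  have "m w = m v \<or> m (T w) = m v \<or> m (T (T w)) = m v"
    using i
  proof
    assume "i mod 3 = 1"
    then have e: "\<omega> ^ i = \<omega>" using pw by simp
    then show ?thesis
      using cube_eq_cases[OF omega eq] unfolding T1 T2 e power2_eq_square by metis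
  next
    assume "i mod 3 = 2"
    then have e: "\<omega> ^ i = \<omega>\<^sup>2" using pw by simp
    then show ?thesis
      using cube_eq_cases[OF omega eq] unfolding T1 T2 e o4 by metis
  qed
  then show ?thesis
    by (elim disjE) (fact that[OF A_equiv_refl[OF w]] that[OF A_equiv_T[OF w]] that[OF TT])+
qed

text \<open>The square of \<open>f\<close> has a weight of order 3 and is aligned by a power of
  \<open>T\<close>. The sign left over is corrected by \<open>S\<close> or \<open>B\<close>, one of
  which negates \<open>f\<close>.\<close>

lemma align6:
  assumes w: "w \<in> X" and f: "f \<in> W i j k" "\<not> 3 dvd i" "\<not> (2 dvd j \<and> 2 dvd k)" and eq: "f v ^ 6 = f w ^ 6"
  obtains w1 where "A_equiv w w1" "f w1 = f v"
proof -
  have m: "wt_prod W (1+1) (i+i) (j+j) (k+k) (\<lambda>x. f x * f x)"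
    by (intro wt_prod_mult wt_prod_single f)
  have "\<not> 3 dvd (i + i)" using f(2) by presburger
  moreover have "(f v * f v) ^ 3 = (f w * f w) ^ 3"
    using eq by (simp add: numeral_eq_Suc mult_ac)
  ultimately obtain w1 where w1: "A_equiv w w1" "f w1 * f w1 = f v * f v"
    using align3[OF w m] by blast
  have X1: "w1 \<in> X" using w1 A_equiv_X by blast
  have "f v = f w1 \<or> f v = - f w1" using w1 square_eq_iff by metis
  then consider "f v = f w1" | "f v = - f w1" by blast
  then show ?thesis
  proof cases
    case 1 then show ?thesis using that w1 by metis
  next
    case 2
    have "f (S w1) = - f w1 \<or> f (B w1) = - f w1"
      using W_S[OF f(1) X1] W_B[OF f(1) X1] f(3) by auto
    then show ?thesis using that w1 2 A_equiv_S[OF X1] A_equiv_B[OF X1] A_equiv_trans by metis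
  qed
qed

section \<open>Reading off the signs of the Klein four-group\<close>

text \<open>The square of one functional nonzero at \<open>v\<close> fixes a sign, and its products
  with the others spread that sign to all of \<open>F\<close>.\<close>

lemma sign_exists:
  fixes v w :: 'x and F :: "('x \<Rightarrow> 'k) set"
  assumes "\<And>f g. f \<in> F \<Longrightarrow> g \<in> F \<Longrightarrow> f v * g v = f w * g w"
  obtains s :: 'k where "s = 1 \<or> s = - 1" "\<And>f. f \<in> F \<Longrightarrow> f w = s * f v"
proof (cases "\<exists>f\<in>F. f v \<noteq> 0")
  case False
  then have "f w = 1 * f v" if "f \<in> F" for f
    using assms[OF that that] that by auto
  then show ?thesis using that by blast
next
  case True
  then obtain f0 where f0: "f0 \<in> F" "f0 v \<noteq> 0" by blast
  have "f0 w = f0 v \<or> f0 w = - f0 v" using assms[OF f0(1) f0(1)] square_eq_iff by metis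
  then obtain s where s: "s = 1 \<or> s = -1" "f0 w = s * f0 v" by force
  have ss: "s * s = 1" using s by auto
  have "f w = s * f v" if f: "f \<in> F" for f
  proof -
    have "f v * f0 v = (s * f w) * f0 v" using assms[OF f f0(1)] s by (simp add: mult_ac)
    then have "f v = s * f w" using f0 by simp
    then show ?thesis using ss by (metis mult.assoc mult_1)
  qed
  then show ?thesis using that s by blast
qed

text \<open>Pairs give one sign for each of the characters \<open>(1,0)\<close>,
  \<open>(1,1)\<close>, \<open>(0,1)\<close>. The elements 1, \<open>S\<close>, \<open>B\<close>,
  \<open>S B\<close> realise exactly the sign triples with product 1, which is what the hypothesis
  on triples enforces when all three characters are visible at \<open>v\<close>.\<close>

lemma same_orbit_pairs_triples:
  assumes X: "v \<in> X" "w \<in> X"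
    and s0: "\<And>i f. f \<in> W i 0 0 \<Longrightarrow> f v = f w"
    and sp: "\<And>i i' j k f g. f \<in> W i j k \<Longrightarrow> g \<in> W i' j k \<Longrightarrow>
        j < 2 \<Longrightarrow> k < 2 \<Longrightarrow> j \<noteq> 0 \<or> k \<noteq> 0 \<Longrightarrow> f v * g v = f w * g w"
    and sT: "\<And>i i' i'' f g h. f \<in> W i 1 0 \<Longrightarrow> g \<in> W i' 1 1 \<Longrightarrow> h \<in> W i'' 0 1 \<Longrightarrow>
        f v * g v * h v = f w * g w * h w"
  shows "E v w"
proof -
  obtain sp' where p: "sp' = 1 \<or> sp' = -1" "\<And>f. f \<in> (\<Union>i. W i 1 0) \<Longrightarrow> f w = sp' * f v"
    by (rule sign_exists[of "\<Union>i. W i 1 0" v w], elim UN_E, rule sp, assumption+, simp, simp, simp, blast)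
  then have p2: "f w = sp' * f v" if "f \<in> W i 1 0" for f i using that by blast
  obtain sq' where q: "sq' = 1 \<or> sq' = -1" "\<And>f. f \<in> (\<Union>i. W i 1 1) \<Longrightarrow> f w = sq' * f v"
    by (rule sign_exists[of "\<Union>i. W i 1 1" v w], elim UN_E, rule sp, assumption+, simp, simp, simp, blast)
  then have q2: "f w = sq' * f v" if "f \<in> W i 1 1" for f i using that by blast
  obtain sr' where r: "sr' = 1 \<or> sr' = -1" "\<And>f. f \<in> (\<Union>i. W i 0 1) \<Longrightarrow> f w = sr' * f v"
    by (rule sign_exists[of "\<Union>i. W i 0 1" v w], elim UN_E, rule sp, assumption+, simp, simp, simp, blast)
  then have r2: "f w = sr' * f v" if "f \<in> W i 0 1" for f i using that by blast
  let ?V = "\<lambda>j k. \<forall>i. \<forall>f \<in> W i j k. f v = 0"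
  have *: "?V 1 0 \<or> ?V 1 1 \<or> ?V 0 1 \<or> sq' = sp' * sr'"
  proof (rule ccontr)
    assume "\<not> ?thesis"
    then obtain i i' i'' f g h where N: "f \<in> W i 1 0" "g \<in> W i' 1 1" "h \<in> W i'' 0 1"
      "f v \<noteq> 0" "g v \<noteq> 0" "h v \<noteq> 0" and ne: "sq' \<noteq> sp' * sr'" by blast
    have "f v * g v * h v = (sp' * f v) * (sq' * g v) * (sr' * h v)"
      unfolding sT[OF N(1-3)] p2[OF N(1)] q2[OF N(2)] r2[OF N(3)] ..
    then have "1 * (f v * g v * h v) = (sp' * sq' * sr') * (f v * g v * h v)"
      by (simp only: mult_1 mult_ac)
    then have "sp' * sq' * sr' = 1" using N(4-) by (metis mult_cancel_right no_zero_divisors)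
    then show False using p(1) q(1) r(1) ne by (elim disjE) simp_all
  qed
  obtain s t where s: "s = 1 \<or> s = -1" and t: "t = 1 \<or> t = -1" and
    alt: "?V 1 0 \<or> s = sp'" "?V 1 1 \<or> s * t = sq'" "?V 0 1 \<or> t = sr'"
  proof -
    consider "?V 1 0" | "?V 1 1" | "?V 0 1" | "sq' = sp' * sr'" using * by blast
    then show ?thesis
    proof cases
      \<comment> \<open>An invisible character has a free sign, so \<open>s\<close> and
        \<open>t\<close> are solved for from the other two; here \<open>s * t = sq'\<close> and
        \<open>t = sr'\<close>.\<close>
      case 1
      show ?thesis by (rule that[of "sq' * sr'" sr']) (use 1 q(1) r(1) in \<open>elim disjE; simp\<close>)+
    next
      case 2
      show ?thesis by (rule that[of "sp'" sr']) (use 2 p(1) r(1) in \<open>elim disjE; simp\<close>)+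
    next
      case 3
      show ?thesis by (rule that[of "sp'" "sp' * sq'"]) (use 3 p(1) q(1) in \<open>elim disjE; simp\<close>)+
    next
      case 4
      show ?thesis by (rule that[of "sp'" "sr'"]) (use 4 p(1) r(1) in \<open>elim disjE; simp\<close>)+
    qed
  qed
  have st: "f \<in> W i 1 0 \<Longrightarrow> f w = s * f v" "f \<in> W i 1 1 \<Longrightarrow> f w = s * t * f v"
      "f \<in> W i 0 1 \<Longrightarrow> f w = t * f v" for f i
  proof -
    show "f \<in> W i 1 0 \<Longrightarrow> f w = s * f v" using alt(1) p2[of f i] by (metis mult_zero_right)
    show "f \<in> W i 1 1 \<Longrightarrow> f w = s * t * f v" using alt(2) q2[of f i] by (metis mult_zero_right)
    show "f \<in> W i 0 1 \<Longrightarrow> f w = t * f v" using alt(3) r2[of f i] by (metis mult_zero_right)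
  qed
  define x where "x = (if s = 1 then v else S v)"
  define y where "y = (if t = 1 then x else B x)"
  have x: "x \<in> X" "E v x" using X by (auto simp: x_def closed E_gen E_refl)
  have y: "y \<in> X" "E x y" using x by (auto simp: y_def closed E_gen E_refl)
  have fx: "f x = s ^ j * f v" if "f \<in> W i j k" for f i j k
    using s W_S[OF that X(1)] by (cases "s = 1") (simp_all add: x_def)
  have fy: "f y = t ^ k * (s ^ j * f v)" if "f \<in> W i j k" for f i j k
    using t W_B[OF that x(1)] fx[OF that] by (cases "t = 1") (simp_all add: y_def)
  have "y = w"
  proof (rule W_sep[OF y(1) X(2)])
    fix i j k f assume *: "i < 3" "j < (2::nat)" "k < (2::nat)" "f \<in> W i j k"
    then consider "j = 0" "k = 0" | "j = 1" "k = 0" | "j = 1" "k = 1" | "j = 0" "k = 1" by linarith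
    then show "f y = f w"
      using *(4) fy[OF *(4)] st(1)[of f i] st(2)[of f i] st(3)[of f i] s0[of f i]
      by cases (simp_all add: mult_ac)
  qed
  then show ?thesis using x y E_trans by blast
qed

lemma zero_sum_prod1: "1 \<le> D \<Longrightarrow> f1 \<in> W a1 b1 c1 \<Longrightarrow> 3 dvd a1 \<Longrightarrow> 2 dvd b1 \<Longrightarrow> 2 dvd c1 \<Longrightarrow> Z D f1"
  using zero_sum_prod_list[of "[(f1, a1, b1, c1)]" W D] by simp
lemma zero_sum_prod2: "2 \<le> D \<Longrightarrow> f1 \<in> W a1 b1 c1 \<Longrightarrow> f2 \<in> W a2 b2 c2 \<Longrightarrow>
  3 dvd a1 + a2 \<Longrightarrow> 2 dvd b1 + b2 \<Longrightarrow> 2 dvd c1 + c2 \<Longrightarrow> Z D (\<lambda>x. f1 x * f2 x)"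
  using zero_sum_prod_list[of "[(f1, a1, b1, c1), (f2, a2, b2, c2)]" W D] by simp
lemma zero_sum_prod3: "3 \<le> D \<Longrightarrow> f1 \<in> W a1 b1 c1 \<Longrightarrow> f2 \<in> W a2 b2 c2 \<Longrightarrow> f3 \<in> W a3 b3 c3 \<Longrightarrow>
  3 dvd a1 + a2 + a3 \<Longrightarrow> 2 dvd b1 + b2 + b3 \<Longrightarrow> 2 dvd c1 + c2 + c3 \<Longrightarrow> Z D (\<lambda>x. f1 x * f2 x * f3 x)"
  using zero_sum_prod_list[of "[(f1, a1, b1, c1), (f2, a2, b2, c2), (f3, a3, b3, c3)]" W D]
  by (simp add: add.assoc mult.assoc)
lemma zero_sum_prod4: "4 \<le> D \<Longrightarrow> f1 \<in> W a1 b1 c1 \<Longrightarrow> f2 \<in> W a2 b2 c2 \<Longrightarrow> f3 \<in> W a3 b3 c3 \<Longrightarrow> f4 \<in> W a4 b4 c4 \<Longrightarrow>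
  3 dvd a1 + a2 + a3 + a4 \<Longrightarrow> 2 dvd b1 + b2 + b3 + b4 \<Longrightarrow> 2 dvd c1 + c2 + c3 + c4 \<Longrightarrow>
  Z D (\<lambda>x. f1 x * f2 x * f3 x * f4 x)"
  using zero_sum_prod_list[of "[(f1, a1, b1, c1), (f2, a2, b2, c2), (f3, a3, b3, c3), (f4, a4, b4, c4)]" W D]
  by (simp add: add.assoc mult.assoc)
lemma zero_sum_prod5: "5 \<le> D \<Longrightarrow> f1 \<in> W a1 b1 c1 \<Longrightarrow> f2 \<in> W a2 b2 c2 \<Longrightarrow> f3 \<in> W a3 b3 c3 \<Longrightarrow> f4 \<in> W a4 b4 c4 \<Longrightarrow>
  f5 \<in> W a5 b5 c5 \<Longrightarrow> 3 dvd a1 + a2 + a3 + a4 + a5 \<Longrightarrow> 2 dvd b1 + b2 + b3 + b4 + b5 \<Longrightarrow>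
  2 dvd c1 + c2 + c3 + c4 + c5 \<Longrightarrow> Z D (\<lambda>x. f1 x * f2 x * f3 x * f4 x * f5 x)"
  using zero_sum_prod_list[of "[(f1, a1, b1, c1), (f2, a2, b2, c2), (f3, a3, b3, c3), (f4, a4, b4, c4),
    (f5, a5, b5, c5)]" W D] by (simp add: add.assoc mult.assoc)
lemma zero_sum_I: "wt_prod W d i j k m \<Longrightarrow> d \<le> D \<Longrightarrow> 3 dvd i \<Longrightarrow> 2 dvd j \<Longrightarrow> 2 dvd k \<Longrightarrow> Z D m"
  unfolding zero_sum_def by blast
text \<open>The third powers make the weight modulo 3 vanish, so only the signs have to
  match.\<close>

lemma zero_sum_cubes:
  assumes "6 \<le> D" "f \<in> W a b c" "g \<in> W a' b' c'" "2 dvd b + b'" "2 dvd c + c'"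
  shows "Z D (\<lambda>x. f x ^ 3 * g x ^ 3)"
  by (rule zero_sum_I[OF wt_prod_mult[OF wt_prod_power[of f W, OF assms(2), of 3] wt_prod_power[of g W, OF assms(3), of 3]]])
    (use assms in presburger)+
lemma zero_sum_sixth: "6 \<le> D \<Longrightarrow> f \<in> W a b c \<Longrightarrow> Z D (\<lambda>x. f x ^ 6)"
  by (rule zero_sum_I[OF wt_prod_power[of f W]]) simp_all

lemma agreeD: "agree D v w \<Longrightarrow> Z D m \<Longrightarrow> m v = m w"
  by (simp add: agree_def)
lemma C_symmetricD: "C_symmetric D v \<Longrightarrow> Z D m \<Longrightarrow> m v = m (C v)"
  by (simp add: C_symmetric_def)
lemma sums_agreeD: "sums_agree v w \<Longrightarrow> Z D m \<Longrightarrow> D \<le> 9 \<Longrightarrow> m v + m (C v) = m w + m (C w)"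
  unfolding sums_agree_def using zero_sum_mono by metis
lemma agree_mono: "agree D v w \<Longrightarrow> D' \<le> D \<Longrightarrow> agree D' v w"
  unfolding agree_def using zero_sum_mono by metis
lemmas agree_prod1 = agreeD[OF _ zero_sum_prod1] and agree_prod2 = agreeD[OF _ zero_sum_prod2] and agree_prod3 = agreeD[OF _ zero_sum_prod3] and agree_prod4 = agreeD[OF _ zero_sum_prod4]
  and agree_prod5 = agreeD[OF _ zero_sum_prod5] and agree_cubes = agreeD[OF _ zero_sum_cubes] and agree_sixth = agreeD[OF _ zero_sum_sixth]

text \<open>The index \<open>i\<close> is unrestricted: this is the form to use after alignment,
  once the weight modulo 3 has been compensated by an aligned functional.\<close>

lemma same_orbit_products:
  assumes "v \<in> X" "w \<in> X"
    and *: "\<And>d i j k m. wt_prod W d i j k m \<Longrightarrow> d \<le> 3 \<Longrightarrow> 2 dvd j \<Longrightarrow> 2 dvd k \<Longrightarrow> m v = m w"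
  shows "E v w"
proof (rule same_orbit_pairs_triples[OF assms(1,2)])
  show "f v = f w" if "f \<in> W i 0 0" for i f
    by (rule *[OF wt_prod_single[of f W, OF that]]) simp_all
  show "f v * g v = f w * g w" if "f \<in> W i j k" "g \<in> W i' j k" for i i' j k f g
    by (rule *[OF wt_prod_mult[OF wt_prod_single[of f W, OF that(1)] wt_prod_single[of g W, OF that(2)]]]) simp_all
  show "f v * g v * h v = f w * g w * h w" if "f \<in> W i 1 0" "g \<in> W i' 1 1" "h \<in> W i'' 0 1"
    for i i' i'' f g h
    by (rule *[OF wt_prod_mult[OF wt_prod_mult[OF wt_prod_single[of f W, OF that(1)] wt_prod_single[of g W, OF that(2)]]
      wt_prod_single[of h W, OF that(3)]]]) simp_all
qed

section \<open>From sums over \<open>{1, C}\<close> to monomials\<close>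

lemma sums_agree_sym: "sums_agree v w \<Longrightarrow> sums_agree w v" by (simp add: sums_agree_def)
lemma sums_agree_C: "w \<in> X \<Longrightarrow> sums_agree v w \<Longrightarrow> sums_agree v (C w)"
  by (simp add: sums_agree_def CC add.commute)
lemma E_C: "w \<in> X \<Longrightarrow> E v (C w) \<Longrightarrow> E v w"
  using E_gen(4) E_sym E_trans by blast
lemma agree_C: "agree D v w \<Longrightarrow> agree D (C v) (C w)"
  using zero_sum_C unfolding agree_def by blast
lemma agree_sym: "agree D v w \<Longrightarrow> agree D w v"
  unfolding agree_def by metis
lemma C_symmetric_C: "v \<in> X \<Longrightarrow> C_symmetric D v \<Longrightarrow> C_symmetric D (C v)"
  unfolding C_symmetric_def by (metis CC)

lemma C_symmetric_agree:
  assumes "sums_agree v w" "C_symmetric D v" "C_symmetric D w" "D \<le> 9"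
  shows "agree D v w"
  unfolding agree_def
proof (intro allI impI)
  fix m assume m: "Z D m"
  have "2 * m v = 2 * m w"
    using sums_agreeD[OF assms(1) m assms(4)] C_symmetricD[OF assms(2) m] C_symmetricD[OF assms(3) m] by simp
  then show "m v = m w" using two by simp
qed

text \<open>If \<open>m\<close> tells \<open>v\<close> from \<open>C v\<close>, the sums for \<open>n\<close> and for \<open>n * m\<close> form a regular linear system
  for \<open>n v\<close> and \<open>n (C v)\<close>.\<close>

lemma agree_of_split:
  assumes "sums_agree v w" "Z d m" "D + d \<le> 9" "m v \<noteq> m (C v)" "m v = m w" "m (C v) = m (C w)"
  shows "agree D v w"
  unfolding agree_def
proof (intro allI impI)
  fix n assume n: "Z D n"
  have 1: "n v + n (C v) = n w + n (C w)" using sums_agreeD[OF assms(1) n] assms(3) by simp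
  have 2: "n v * m v + n (C v) * m (C v) = n w * m v + n (C w) * m (C v)"
    using sums_agreeD[OF assms(1) zero_sum_mult[OF n assms(2)]] assms by simp
  have "n v * (m v - m (C v)) = (n v * m v + n (C v) * m (C v)) - (n v + n (C v)) * m (C v)"
    by (simp add: algebra_simps)
  also have "\<dots> = n w * (m v - m (C v))"
    unfolding 1 2 by (simp add: algebra_simps)
  finally show "n v = n w" using assms(4) by simp
qed

text \<open>The bound on \<open>d\<close> brings \<open>m * m\<close> into degree at most 9. Its sum
  and that of \<open>m\<close> determine the pair \<open>m v\<close>, \<open>m (C v)\<close> up to
  order, and replacing \<open>w\<close> by \<open>C w\<close> exchanges the two orders.\<close>

lemma agree_of_asymmetry:
  assumes "w \<in> X" "sums_agree v w" "\<not> C_symmetric d v" "d \<le> 4" "D + d \<le> 9"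
  shows "agree D v w \<or> agree D v (C w)"
proof -
  obtain m where m: "Z d m" "m v \<noteq> m (C v)" using assms(3) by (auto simp: C_symmetric_def)
  have "m v + m (C v) = m w + m (C w)" by (rule sums_agreeD[OF assms(2) m(1)]) (use assms(4) in simp)
  moreover have "m v * m v + m (C v) * m (C v) = m w * m w + m (C w) * m (C w)"
    by (rule sums_agreeD[OF assms(2) zero_sum_mult[OF m(1) m(1)]]) (use assms(4) in simp)
  ultimately consider "m v = m w" "m (C v) = m (C w)" | "m v = m (C w)" "m (C v) = m w"
    using same_pair[OF two] by blast
  then show ?thesis
  proof cases
    case 1
    then show ?thesis using agree_of_split[OF assms(2) m(1) assms(5) m(2)] by blast
  next
    case 2
    then show ?thesis
      using agree_of_split[OF sums_agree_C[OF assms(1,2)] m(1) assms(5) m(2)] by (simp add: CC assms(1))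
  qed
qed

text \<open>If only \<open>w\<close> is asymmetric, the roles of \<open>v\<close> and
  \<open>w\<close> are exchanged, and \<open>C\<close> is applied to both sides to move it back onto
  \<open>w\<close>.\<close>

lemma agree_of_asymmetry':
  assumes "v \<in> X" "w \<in> X" "sums_agree v w" "\<not> (C_symmetric d v \<and> C_symmetric d w)" "d \<le> 4" "D + d \<le> 9"
  shows "agree D v w \<or> agree D v (C w)"
proof (cases "C_symmetric d v")
  case False
  then show ?thesis using agree_of_asymmetry assms by blast
next
  case True
  then have "\<not> C_symmetric d w" using assms(4) by blast
  then consider "agree D w v" | "agree D w (C v)" using agree_of_asymmetry[OF assms(1) sums_agree_sym[OF assms(3)]] assms by blast
  then show ?thesis
  proof cases
    case 1 then show ?thesis using agree_sym by blast
  next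
    case 2 then show ?thesis using agree_C[OF 2] agree_sym CC[OF assms(1)] by metis
  qed
qed

section \<open>Weights of order 6 vanishing at one of \<open>v\<close>, \<open>C v\<close>\<close>

text \<open>The weight has order exactly 6 as a character of the subgroup generated by
  \<open>a\<close> and \<open>b\<close>.\<close>

definition order6 :: "nat \<Rightarrow> nat \<Rightarrow> nat \<Rightarrow> bool" where
  "order6 i j k \<longleftrightarrow> \<not> 3 dvd i \<and> \<not> (2 dvd j \<and> 2 dvd k)"
text \<open>The quantifier ranges over all functionals of a weight space, linear combinations
  included. This makes the condition much stronger than one on a basis; see
  \<open>C_nonvanishing_proportional\<close>.\<close>

definition C_nonvanishing where
  "C_nonvanishing v \<longleftrightarrow> (\<forall>i j k f. order6 i j k \<longrightarrow> f \<in> W i j k \<longrightarrow> f v \<noteq> 0 \<longrightarrow> f (C v) \<noteq> 0)"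

lemma C_nonvanishing_C: "v \<in> X \<Longrightarrow> C_nonvanishing v \<Longrightarrow> C_nonvanishing (C v)"
  unfolding C_nonvanishing_def
proof (intro allI impI)
  fix i j k f assume v: "v \<in> X" and *: "\<forall>i j k f. order6 i j k \<longrightarrow> f \<in> W i j k \<longrightarrow> f v \<noteq> 0 \<longrightarrow> f (C v) \<noteq> 0"
    and f: "order6 i j k" "f \<in> W i j k" "f (C v) \<noteq> 0"
  have "order6 (2 * i) j (j + k)" using f(1) unfolding order6_def by presburger
  from *[rule_format, OF this W_C[OF f(2)]] f(3) show "f (C (C v)) \<noteq> 0" by blast
qed

text \<open>Even exponents leave the signs alone. The exponent 6 stands in for 0 so that a factor
  \<open>f\<close> is always present, which makes the monomial vanish wherever \<open>f\<close>
  does.\<close>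

lemma mod3_cancel: "\<not> 3 dvd (i::nat) \<Longrightarrow> \<exists>e. (e = 2 \<or> e = 4 \<or> e = 6) \<and> 3 dvd i' + e * i"
proof -
  assume "\<not> 3 dvd i"
  then have "3 dvd i' + 2 * i \<or> 3 dvd i' + 4 * i \<or> 3 dvd i' + 6 * i" by presburger
  then show ?thesis by blast
qed

text \<open>Every monomial containing \<open>f\<close> vanishes at \<open>C v\<close> and \<open>C w\<close>, so \<open>sums_agree\<close> becomes agreement
  for it; multiplying by an even power of \<open>f\<close> neutralises the weight of any product of length three.\<close>

lemma same_orbit_aligned_vanishing:
  assumes X: "v \<in> X" "w \<in> X" and H: "sums_agree v w" and f: "f \<in> W i j k" "order6 i j k"
    and nz: "f v \<noteq> 0" "f (C v) = 0" "f (C w) = 0"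
  shows "E v w"
proof -
  have "f v ^ 6 = f w ^ 6" using sums_agreeD[OF H zero_sum_sixth[of 6, OF _ f(1)]] nz by simp
  moreover have "\<not> 3 dvd i" "\<not> (2 dvd j \<and> 2 dvd k)" using f(2) by (auto simp: order6_def)
  ultimately obtain w1 where w1: "A_equiv w w1" "f w1 = f v"
    using align6[OF X(2) f(1)] by blast
  have "E v w1"
  proof (rule same_orbit_products[OF X(1) A_equiv_X[OF w1(1)]])
    fix d i' j' k' m assume m: "wt_prod W d i' j' k' m" "d \<le> 3" "2 dvd j'" "2 dvd k'"
    obtain e where e: "e = 2 \<or> e = 4 \<or> e = 6" "3 dvd i' + e * i"
      using mod3_cancel f(2) by (auto simp: order6_def)
    \<comment> \<open>The extreme case 3 + 6 uses up the whole degree bound.\<close>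
    have Z: "Z 9 (\<lambda>x. m x * f x ^ e)"
      by (rule zero_sum_I[OF wt_prod_mult[OF m(1) wt_prod_power[of f W, OF f(1), of e]]]) (use m e in auto)
    have "m v * f v ^ e = m w * f w ^ e" using sums_agreeD[OF H Z] nz e by auto
    also have "\<dots> = m w1 * f w1 ^ e" using A_equiv_Z[OF w1(1) Z] by simp
    finally show "m v = m w1" using w1(2) nz by simp
  qed
  then show ?thesis using w1(1) A_equiv_E by blast
qed

text \<open>The monomial \<open>f\<^sup>2 (f \<circ> C)\<^sup>2\<close> has weight zero and forces \<open>f\<close> to vanish at \<open>w\<close> or at \<open>C w\<close>.\<close>

lemma same_orbit_vanishing:
  assumes X: "v \<in> X" "w \<in> X" and H: "sums_agree v w" and f: "f \<in> W i j k" "order6 i j k"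
    and nz: "f v \<noteq> 0" "f (C v) = 0"
  shows "E v w"
proof -
  have Z: "Z 4 (\<lambda>x. f x * f x * f (C x) * f (C x))"
    by (rule zero_sum_prod4[OF _ f(1) f(1) W_C[OF f(1)] W_C[OF f(1)]]) presburger+
  have "2 * (f w * f w * f (C w) * f (C w)) = 0"
    using sums_agreeD[OF H Z] nz by (simp add: CC X mult_ac)
  then have "f w = 0 \<or> f (C w) = 0" using two by auto
  then show ?thesis
  proof
    assume "f (C w) = 0"
    then show ?thesis using same_orbit_aligned_vanishing[OF X H f nz] by blast
  next
    assume "f w = 0"
    then have "E v (C w)" using same_orbit_aligned_vanishing[OF X(1) closed(4)[OF X(2)] sums_agree_C[OF X(2) H] f nz] by (simp add: CC X)
    then show ?thesis by (rule E_C[OF X(2)])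
  qed
qed

lemma W_C': "f \<in> W i j k \<Longrightarrow> (\<lambda>x. f (C x)) \<in> W (2 * i) (j mod 2) ((j + k) mod 2)"
  by (rule W_mod[OF W_C]) auto

section \<open>Agreement up to degree 6\<close>

text \<open>The product of cubes has degree 9, beyond the agreement. It is a quotient of accessible
  monomials: the quintic \<open>f (f o C) h^3\<close> has weight zero because \<open>f o C\<close>
  has the sign of \<open>g\<close>, its cube supplies \<open>f^3 h^9\<close>, and
  \<open>g^3 (f o C)^3\<close> supplies \<open>g^3\<close>; sixth powers are divided out.\<close>

lemma triple:
  assumes Fc: "C_nonvanishing v" and ag: "agree 6 v w"
    and f: "f \<in> W i 1 0" and g: "g \<in> W i' 1 1" and h: "h \<in> W i'' 0 1"
  shows "f v ^ 3 * g v ^ 3 * h v ^ 3 = f w ^ 3 * g w ^ 3 * h w ^ 3"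
proof (cases "f v = 0 \<or> g v = 0 \<or> h v = 0")
  case True
  then have "f w = 0 \<or> g w = 0 \<or> h w = 0"
    using agree_sixth[OF ag _ f] agree_sixth[OF ag _ g] agree_sixth[OF ag _ h] by auto
  then show ?thesis using True by auto
next
  case False
  have ag5: "agree 5 v w" by (rule agree_mono[OF ag]) simp
  have fC: "(\<lambda>x. f (C x)) \<in> W (2 * i) 1 1" using W_C'[OF f] by simp
  have gC: "(\<lambda>x. g (C x)) \<in> W (2 * i') 1 0" using W_C'[OF g] by simp
  have h6: "h v ^ 6 = h w ^ 6" by (rule agree_sixth[OF ag _ h]) simp
  consider "f (C v) \<noteq> 0" | "g (C v) \<noteq> 0" | "f (C v) = 0" "g (C v) = 0" by blast
  then show ?thesis
  proof cases
    case 1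
    have 2: "f v * f (C v) * h v * h v * h v = f w * f (C w) * h w * h w * h w"
      by (rule agree_prod5[OF ag5 _ f fC h h h]) presburger+
    have 3: "g v ^ 3 * f (C v) ^ 3 = g w ^ 3 * f (C w) ^ 3"
      by (rule agree_cubes[OF ag _ g fC]) simp_all
    have 4: "f (C v) ^ 6 = f (C w) ^ 6" by (rule agree_sixth[OF ag _ fC]) simp
    have id: "f x ^ 3 * g x ^ 3 * h x ^ 3 * (f (C x) ^ 6 * h x ^ 6) =
      (f x * f (C x) * h x * h x * h x) ^ 3 * (g x ^ 3 * f (C x) ^ 3)" for x
      by (simp add: numeral_eq_Suc mult_ac)
    show ?thesis
      by (rule cancel_eq[OF id[of v, unfolded 2 3, folded id]]) (use 1 False in \<open>simp_all add: h6[symmetric] 4[symmetric]\<close>)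
  next
    case c2: 2
    have 2: "g v * g (C v) * h v * h v * h v = g w * g (C w) * h w * h w * h w"
      by (rule agree_prod5[OF ag5 _ g gC h h h]) presburger+
    have 3: "f v ^ 3 * g (C v) ^ 3 = f w ^ 3 * g (C w) ^ 3"
      by (rule agree_cubes[OF ag _ f gC]) simp_all
    have 4: "g (C v) ^ 6 = g (C w) ^ 6" by (rule agree_sixth[OF ag _ gC]) simp
    have id: "f x ^ 3 * g x ^ 3 * h x ^ 3 * (g (C x) ^ 6 * h x ^ 6) =
      (g x * g (C x) * h x * h x * h x) ^ 3 * (f x ^ 3 * g (C x) ^ 3)" for x
      by (simp add: numeral_eq_Suc mult_ac)
    show ?thesis
      by (rule cancel_eq[OF id[of v, unfolded 2 3, folded id]]) (use c2 False in \<open>simp_all add: h6[symmetric] 4[symmetric]\<close>)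
  next
    \<comment> \<open>A functional nonzero at \<open>v\<close> but zero at \<open>C v\<close> cannot
      have a weight of order 6, so \<open>f\<close> and \<open>g\<close> are pure signs and
      \<open>f g h^3\<close> already has weight zero.\<close>
    case 3
    have "\<not> order6 i 1 0" "\<not> order6 i' 1 1" using Fc f g 3 False unfolding C_nonvanishing_def by blast+
    then have i: "3 dvd i" "3 dvd i'" by (auto simp: order6_def)
    have 2: "f v * g v * h v * h v * h v = f w * g w * h w * h w * h w"
      by (rule agree_prod5[OF ag5 _ f g h h h]) (use i in presburger)+
    have 4: "f v * f v = f w * f w"
      by (rule agree_prod2[OF ag _ f f]) (use i in presburger)+
    have id: "f x ^ 3 * g x ^ 3 * h x ^ 3 * h x ^ 6 = (f x * g x * h x * h x * h x) ^ 3" for x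
      by (simp add: numeral_eq_Suc mult_ac)
    show ?thesis
      by (rule cancel_eq[OF id[of v, unfolded 2, folded id]]) (use False h6 in auto)
  qed
qed

text \<open>Cubes of pairs and triples agree without any alignment, so by
  \<open>square_cube_eq\<close> only the squares of single functionals remain. A square has a weight
  of order 1 or 3, which one aligned square \<open>f0^2\<close> or its square neutralises.\<close>

lemma same_orbit_agree6:
  assumes X: "v \<in> X" "w \<in> X" and Fc: "C_nonvanishing v" and ag: "agree 6 v w"
  shows "E v w"
proof -
  have core: "E v w1" if w1: "w1 \<in> X" and ag: "agree 6 v w1"
    and sq: "\<And>i j k f. \<not> 3 dvd i \<Longrightarrow> f \<in> W i j k \<Longrightarrow> f v * f v = f w1 * f w1" for w1
  proof -
    have sq': "f v * f v = f w1 * f w1" if f: "f \<in> W i j k" for i j k f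
    proof (cases "3 dvd i")
      case True
      show ?thesis by (rule agree_prod2[OF ag _ f f]) (use True in presburger)+
    qed (use sq f in blast)
    show ?thesis
    proof (rule same_orbit_pairs_triples[OF X(1) w1])
      fix i f assume f: "f \<in> W i 0 0"
      show "f v = f w1"
        by (rule square_cube_eq[OF sq'[OF f] agree_prod3[OF ag _ f f f]]) presburger+
    next
      fix i i' j k f g assume f: "f \<in> W i j k" and g: "g \<in> W i' j k"
      have *: "(f x * g x) * (f x * g x) * (f x * g x) = f x ^ 3 * g x ^ 3"
        "(f x * g x) * (f x * g x) = (f x * f x) * (g x * g x)" for x
        by (simp_all add: power3_eq_cube mult_ac)
      show "f v * g v = f w1 * g w1"
      proof (rule square_cube_eq)
        show "f v * g v * (f v * g v) = f w1 * g w1 * (f w1 * g w1)"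
          unfolding *(2) sq'[OF f] sq'[OF g] ..
        show "f v * g v * (f v * g v) * (f v * g v) = f w1 * g w1 * (f w1 * g w1) * (f w1 * g w1)"
          unfolding *(1) by (rule agree_cubes[OF ag _ f g]) simp_all
      qed
    next
      fix i i' i'' f g h assume f: "f \<in> W i 1 0" and g: "g \<in> W i' 1 1" and h: "h \<in> W i'' 0 1"
      have *: "(f x * g x * h x) * (f x * g x * h x) * (f x * g x * h x) = f x ^ 3 * g x ^ 3 * h x ^ 3"
        "(f x * g x * h x) * (f x * g x * h x) = (f x * f x) * (g x * g x) * (h x * h x)" for x
        by (simp_all add: power3_eq_cube mult_ac)
      show "f v * g v * h v = f w1 * g w1 * h w1"
      proof (rule square_cube_eq)
        show "f v * g v * h v * (f v * g v * h v) = f w1 * g w1 * h w1 * (f w1 * g w1 * h w1)"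
          unfolding *(2) sq'[OF f] sq'[OF g] sq'[OF h] ..
        show "f v * g v * h v * (f v * g v * h v) * (f v * g v * h v) =
            f w1 * g w1 * h w1 * (f w1 * g w1 * h w1) * (f w1 * g w1 * h w1)"
          unfolding *(1) by (rule triple[OF Fc ag f g h])
      qed
    qed
  qed
  show ?thesis
  proof (cases "\<exists>i j k f. \<not> 3 dvd i \<and> f \<in> W i j k \<and> f v \<noteq> 0")
    case False
    show ?thesis
    proof (rule core[OF X(2) ag])
      fix i j k f assume *: "\<not> 3 dvd i" "f \<in> W i j k"
      then have "f v = 0" using False by blast
      then show "f v * f v = f w * f w" using agree_sixth[OF ag _ *(2)] by simp
    qed
  next
    case True
    then obtain i j k f0 where f0: "\<not> 3 dvd i" "f0 \<in> W i j k" "f0 v \<noteq> 0" by blast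
    \<comment> \<open>Only \<open>f0^2\<close> is aligned, so it does not matter whether
      \<open>f0\<close> carries a sign.\<close>
    have m: "wt_prod W (1+1) (i+i) (j+j) (k+k) (\<lambda>x. f0 x * f0 x)"
      by (intro wt_prod_mult wt_prod_single f0)
    have i2: "\<not> 3 dvd i + i" using f0 by presburger
    have "(f0 v * f0 v) ^ 3 = (f0 w * f0 w) ^ 3"
      using agree_sixth[OF ag _ f0(2)] by (simp add: numeral_eq_Suc mult_ac)
    then obtain w1 where w1: "A_equiv w w1" "f0 w1 * f0 w1 = f0 v * f0 v"
      using align3[OF X(2) m i2] by blast
    have ag1: "agree 6 v w1" by (rule A_equiv_agree[OF w1(1) ag])
    have "E v w1"
    proof (rule core[OF A_equiv_X[OF w1(1)] ag1])
      fix i' j' k' f assume *: "\<not> 3 dvd i'" "f \<in> W i' j' k'"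
      have "3 dvd i' + i \<or> 3 dvd i' + 2 * i" using * f0(1) by presburger
      then show "f v * f v = f w1 * f w1"
      proof
        assume i: "3 dvd i' + i"
        have "f v * f v * f0 v * f0 v = f w1 * f w1 * f0 w1 * f0 w1"
          by (rule agree_prod4[OF ag1 _ *(2) *(2) f0(2) f0(2)]) (use i in presburger)+
        then show ?thesis using w1(2) f0(3) by (simp add: mult.assoc)
      next
        assume i: "3 dvd i' + 2 * i"
        have "Z 6 (\<lambda>x. f x * f x * f0 x ^ 4)"
          by (rule zero_sum_I[OF wt_prod_mult[OF wt_prod_mult[OF wt_prod_single[of f W, OF *(2)] wt_prod_single[of f W, OF *(2)]]
              wt_prod_power[of f0 W, OF f0(2), of 4]]]) (use i in presburger)+
        from agreeD[OF ag1 this] have "f v * f v * f0 v ^ 4 = f w1 * f w1 * f0 w1 ^ 4" .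
        moreover have p4: "f0 x ^ 4 = (f0 x * f0 x) ^ 2" for x by (simp add: numeral_eq_Suc mult_ac)
        ultimately show ?thesis using w1(2) f0(3) by simp
      qed
    qed
    then show ?thesis by (rule A_equiv_E[OF w1(1)])
  qed
qed

section \<open>Configurations of nonvanishing weights\<close>

text \<open>The last two cases correspond to compensation by a functional of weight \<open>i\<close>
  and by its composition with \<open>C\<close>, of weight \<open>2 * i\<close>.\<close>

lemma mod3_cases:
  assumes "\<not> 3 dvd (i::nat)"
  obtains "3 dvd s" | "3 dvd s + i" | "3 dvd s + 2 * i"
proof -
  have "3 dvd s \<or> 3 dvd s + i \<or> 3 dvd s + 2 * i" using assms by presburger
  then show ?thesis using that by blast
qed

text \<open>All functionals that do not vanish at \<open>v\<close> have weights of order at most 2,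
  so the required pairs and triples are themselves of weight zero and nothing has to be
  aligned.\<close>

lemma same_orbit_trivial_cube_part:
  assumes X: "v \<in> X" "w \<in> X" and ag: "agree 3 v w"
    and zs: "\<forall>i j k f. f \<in> W i j k \<longrightarrow> f v = 0 \<longrightarrow> f w = 0"
    and ab: "\<forall>i j k f. \<not> 3 dvd i \<longrightarrow> f \<in> W i j k \<longrightarrow> f v = 0"
  shows "E v w"
proof -
  note zs = zs[rule_format] and ab = ab[rule_format]
  have nz: "3 dvd i \<or> f v = 0 \<and> f w = 0" if "f \<in> W i j k" for f i j k
    using zs[OF that] ab[OF _ that] by blast
  show ?thesis
  proof (rule same_orbit_pairs_triples[OF X])
    fix i f assume f: "f \<in> W i 0 0"
    show "f v = f w"
      using nz[OF f] by (elim disjE, intro agree_prod1[OF ag _ f]) simp_all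
  next
    fix i i' j k f g assume f: "f \<in> W i j k" and g: "g \<in> W i' j k"
    consider "f v = 0 \<and> f w = 0 \<or> g v = 0 \<and> g w = 0" | "3 dvd i" "3 dvd i'"
      using nz[OF f] nz[OF g] by blast
    then show "f v * g v = f w * g w"
    proof cases
      case 2
      then show ?thesis by (intro agree_prod2[OF ag _ f g]) simp_all
    qed auto
  next
    fix i i' i'' f g h assume f: "f \<in> W i 1 0" and g: "g \<in> W i' 1 1" and h: "h \<in> W i'' 0 1"
    consider "f v = 0 \<and> f w = 0 \<or> g v = 0 \<and> g w = 0 \<or> h v = 0 \<and> h w = 0"
      | "3 dvd i" "3 dvd i'" "3 dvd i''"
      using nz[OF f] nz[OF g] nz[OF h] by blast
    then show "f v * g v * h v = f w * g w * h w"
    proof cases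
      case 2
      then show ?thesis by (intro agree_prod3[OF ag _ f g h]) simp_all
    qed auto
  qed
qed

text \<open>Here \<open>f\<close> and \<open>f o C\<close> have opposite weights of order 3.
  Aligning \<open>f\<close> also aligns \<open>f o C\<close>, through their product, and one extra
  factor then neutralises any weight modulo 3: degree 3 + 1.\<close>

lemma same_orbit_cubic_weight:
  assumes X: "v \<in> X" "w \<in> X" and ag: "agree 4 v w"
    and k: "\<not> 3 dvd i" "f \<in> W i 0 0" "f v \<noteq> 0" "f (C v) \<noteq> 0"
  shows "E v w"
proof -
  have fC: "(\<lambda>x. f (C x)) \<in> W (2 * i) 0 0" using W_C'[OF k(2)] by simp
  have "f v * f v * f v = f w * f w * f w"
    by (rule agree_prod3[OF ag _ k(2) k(2) k(2)]) presburger+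
  then have "f v ^ 3 = f w ^ 3" by (simp add: power3_eq_cube)
  then obtain w1 where w1: "A_equiv w w1" "f w1 = f v"
    using align3[OF X(2) wt_prod_single[of f W, OF k(2)] k(1)] by blast
  have ag1: "agree 4 v w1" by (rule A_equiv_agree[OF w1(1) ag])
  have "f v * f (C v) = f w1 * f (C w1)"
    by (rule agree_prod2[OF ag1 _ k(2) fC]) presburger+
  then have C: "f (C w1) = f (C v)" using w1 k by simp
  have "E v w1"
  proof (rule same_orbit_products[OF X(1) A_equiv_X[OF w1(1)]])
    fix d i' j' k' m assume m: "wt_prod W d i' j' k' m" "d \<le> 3" "2 dvd j'" "2 dvd k'"
    show "m v = m w1"
    proof (cases rule: mod3_cases[OF k(1), of i'])
      case 1
      show ?thesis by (rule agreeD[OF ag1 zero_sum_I[OF m(1)]]) (use 1 m in simp_all)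
    next
      case 2
      have "m v * f v = m w1 * f w1"
        by (rule agreeD[OF ag1 zero_sum_I[OF wt_prod_mult[OF m(1) wt_prod_single[of f W, OF k(2)]]]]) (use 2 m in simp_all)
      then show ?thesis using w1 k by simp
    next
      case 3
      have "m v * f (C v) = m w1 * f (C w1)"
        by (rule agreeD[OF ag1 zero_sum_I[OF wt_prod_mult[OF m(1) wt_prod_single[of "\<lambda>x. f (C x)" W, OF fC]]]]) (use 3 m in simp_all)
      then show ?thesis using C k by simp
    qed
  qed
  then show ?thesis by (rule A_equiv_E[OF w1(1)])
qed

text \<open>The sign \<open>(0,1)\<close> of \<open>k\<close> is fixed by \<open>C\<close>, while
  \<open>f\<close> and \<open>f o C\<close> carry the two signs that \<open>C\<close> exchanges. The
  quintic in \<open>m0\<close> ties the cube of \<open>k\<close> to \<open>f (f o C)\<close>; once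
  \<open>k\<close> and \<open>k o C\<close> are aligned, their squares neutralise pairs within
  degree 4.\<close>

lemma same_orbit_mixed_weights:
  assumes X: "v \<in> X" "w \<in> X" and ag: "agree 4 v w"
    and zs: "\<forall>i j k f. f \<in> W i j k \<longrightarrow> f v = 0 \<longrightarrow> f w = 0"
    and abA: "\<forall>i f. \<not> 3 dvd i \<longrightarrow> f \<in> W i 0 0 \<longrightarrow> f v = 0"
    and k: "\<not> 3 dvd i" "k \<in> W i 0 1" "k v \<noteq> 0" "k (C v) \<noteq> 0"
    and f: "f \<in> W i1 1 0" "f v \<noteq> 0" "f (C v) \<noteq> 0"
    and m0: "f v * f (C v) * k v * k v * k v = f w * f (C w) * k w * k w * k w"
  shows "E v w"
proof -
  note zs = zs[rule_format] and abA = abA[rule_format]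
  have fC: "(\<lambda>x. f (C x)) \<in> W (2 * i1) 1 1" using W_C'[OF f(1)] by simp
  have kC: "(\<lambda>x. k (C x)) \<in> W (2 * i) 0 1" using W_C'[OF k(2)] by simp
  have ff: "f v * f v * f (C v) * f (C v) = f w * f w * f (C w) * f (C w)"
    by (rule agree_prod4[OF ag _ f(1) f(1) fC fC]) presburger+
  \<comment> \<open>The sixth power exceeds degree 4, so it is recovered by dividing the square of
    \<open>m0\<close> by a quartic.\<close>
  have id: "k x ^ 6 * (f x * f x * f (C x) * f (C x)) = (f x * f (C x) * k x * k x * k x) ^ 2" for x
    by (simp add: numeral_eq_Suc mult_ac)
  have "k v ^ 6 = k w ^ 6"
    by (rule cancel_eq[OF id[of v, unfolded m0, folded id] ff]) (use f in simp)
  then obtain w1 where w1: "A_equiv w w1" "k w1 = k v"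
    using align6[OF X(2) k(2,1)] by auto
  have ag1: "agree 4 v w1" by (rule A_equiv_agree[OF w1(1) ag])
  \<comment> \<open>The agreement \<open>ag1\<close> stops at degree 4; the quintic reaches
    \<open>w1\<close> because it is invariant under \<open>T\<close>, \<open>S\<close>,
    \<open>B\<close>.\<close>
  have "Z 5 (\<lambda>x. f x * f (C x) * k x * k x * k x)"
    by (rule zero_sum_prod5[OF _ f(1) fC k(2) k(2) k(2)]) presburger+
  from A_equiv_Z[OF w1(1) this]
  have f2: "f v * f (C v) = f w1 * f (C w1)" unfolding m0[symmetric] using w1(2) k(3) by simp
  have "k v * k (C v) = k w1 * k (C w1)"
    by (rule agree_prod2[OF ag1 _ k(2) kC]) presburger+
  then have C: "k (C w1) = k (C v)" using w1 k by simp
  have zs1: "g w1 = 0" if "g \<in> W i j k" "g v = 0" for g i j k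
    using A_equiv_zero[OF w1(1) that(1) zs[OF that]] .
  have sp: "g v * h v = g w1 * h w1" if g: "g \<in> W a b c" and h: "h \<in> W a' b c" for g h a a' b c
  proof (cases rule: mod3_cases[OF k(1), of "a + a'"])
    case 1
    show ?thesis by (rule agree_prod2[OF ag1 _ g h]) (use 1 in presburger)+
  next
    case 2
    have "g v * h v * k (C v) * k (C v) = g w1 * h w1 * k (C w1) * k (C w1)"
      by (rule agree_prod4[OF ag1 _ g h kC kC]) (use 2 in presburger)+
    then show ?thesis using C k by simp
  next
    case 3
    have "g v * h v * k v * k v = g w1 * h w1 * k w1 * k w1"
      by (rule agree_prod4[OF ag1 _ g h k(2) k(2)]) (use 3 in presburger)+
    then show ?thesis using w1 k by simp
  qed
  have r: "g v = g w1" if g: "g \<in> W a 0 1" for g a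
  proof (cases rule: mod3_cases[OF k(1), of a])
    case 1
    have "g v * k v * k v * k v = g w1 * k w1 * k w1 * k w1"
      by (rule agree_prod4[OF ag1 _ g k(2) k(2) k(2)]) (use 1 in presburger)+
    then show ?thesis using w1 k by simp
  next
    case 2
    have "g v * k v = g w1 * k w1"
      by (rule agree_prod2[OF ag1 _ g k(2)]) (use 2 in presburger)+
    then show ?thesis using w1 k by simp
  next
    case 3
    have "g v * k (C v) = g w1 * k (C w1)"
      by (rule agree_prod2[OF ag1 _ g kC]) (use 3 in presburger)+
    then show ?thesis using C k by simp
  qed
  have "E v w1"
  proof (rule same_orbit_pairs_triples[OF X(1) A_equiv_X[OF w1(1)]])
    fix i f assume f: "f \<in> W i 0 0"
    show "f v = f w1"
    proof (cases "3 dvd i")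
      case True
      then show ?thesis by (intro agree_prod1[OF ag1 _ f]) simp_all
    next
      case False
      then show ?thesis using abA f zs1 by metis
    qed
  next
    fix g1 g2 g3 a1 a2 a3 assume g: "g1 \<in> W a1 1 0" "g2 \<in> W a2 1 1" "g3 \<in> W a3 0 1"
    \<comment> \<open>Signs are matched by inserting \<open>f\<close> and \<open>f o C\<close>,
      which reduces the product of two different signs to two pairs of equal sign.\<close>
    have "g1 v * g2 v * (f v * f (C v)) = (g1 v * f v) * (g2 v * f (C v))" by (simp add: mult_ac)
    also have "\<dots> = (g1 w1 * f w1) * (g2 w1 * f (C w1))"
      unfolding sp[OF g(1) f(1)] sp[OF g(2) fC] ..
    also have "\<dots> = g1 w1 * g2 w1 * (f w1 * f (C w1))" by (simp add: mult_ac)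
    finally have "g1 v * g2 v = g1 w1 * g2 w1"
      by (rule cancel_eq[OF _ f2]) (use f in simp)
    then show "g1 v * g2 v * g3 v = g1 w1 * g2 w1 * g3 w1" using r[OF g(3)] by simp
  qed (use sp in blast)
  then show ?thesis by (rule A_equiv_E[OF w1(1)])
qed

text \<open>The only visible sign is \<open>(0,1)\<close>, represented by the pure sign
  \<open>u\<close>. Aligning \<open>k * u\<close>, of order 3, needs only \<open>k^3 u\<close> and
  \<open>u^2\<close>, which avoids the degree 6 of aligning \<open>k\<close> itself. Pairs are then
  compared as \<open>(f u) (g u)\<close> divided by \<open>u^2\<close>.\<close>

lemma same_orbit_C_fixed_sign:
  assumes X: "v \<in> X" "w \<in> X" and ag: "agree 4 v w"
    and zs: "\<forall>i j k f. f \<in> W i j k \<longrightarrow> f v = 0 \<longrightarrow> f w = 0"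
    and abA: "\<forall>i f. \<not> 3 dvd i \<longrightarrow> f \<in> W i 0 0 \<longrightarrow> f v = 0"
    and abP: "\<forall>i k f. f \<in> W i 1 k \<longrightarrow> f v = 0"
    and k: "\<not> 3 dvd i" "k \<in> W i 0 1" "k v \<noteq> 0" "k (C v) \<noteq> 0"
    and u: "3 dvd iu" "u \<in> W iu 0 1" "u v \<noteq> 0"
  shows "E v w"
proof -
  note zs = zs[rule_format] and abA = abA[rule_format] and abP = abP[rule_format]
  have kC: "(\<lambda>x. k (C x)) \<in> W (2 * i) 0 1" using W_C'[OF k(2)] by simp
  have m: "wt_prod W (1+1) (i+iu) (0+0) (1+1) (\<lambda>x. k x * u x)"
    by (intro wt_prod_mult wt_prod_single k u)
  have i: "\<not> 3 dvd i + iu" using k(1) u(1) by presburger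
  have 1: "k v * k v * k v * u v = k w * k w * k w * u w"
    by (rule agree_prod4[OF ag _ k(2) k(2) k(2) u(2)]) (use u(1) in presburger)+
  have 2: "u v * u v = u w * u w"
    by (rule agree_prod2[OF ag _ u(2) u(2)]) (use u(1) in presburger)+
  have id: "(k x * u x) ^ 3 = (k x * k x * k x * u x) * (u x * u x)" for x
    by (simp add: power3_eq_cube mult_ac)
  have "(k v * u v) ^ 3 = (k w * u w) ^ 3" unfolding id 1 2 ..
  then obtain w1 where w1: "A_equiv w w1" "k w1 * u w1 = k v * u v"
    using align3[OF X(2) m i] by blast
  have ag1: "agree 4 v w1" by (rule A_equiv_agree[OF w1(1) ag])
  have zs1: "g w1 = 0" if "g \<in> W i j k" "g v = 0" for g i j k
    using A_equiv_zero[OF w1(1) that(1) zs[OF that]] .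
  have uu: "u v * u v = u w1 * u w1"
    by (rule agree_prod2[OF ag1 _ u(2) u(2)]) (use u(1) in presburger)+
  have gu: "g v * u v = g w1 * u w1" if g: "g \<in> W a 0 1" for g a
  proof -
    have kk: "k v * k (C v) = k w1 * k (C w1)"
      by (rule agree_prod2[OF ag1 _ k(2) kC]) presburger+
    have "k (C v) * u v * (k v * u v) = (k v * k (C v)) * (u v * u v)" by (simp add: mult_ac)
    also have "\<dots> = k (C w1) * u w1 * (k w1 * u w1)" unfolding kk uu by (simp add: mult_ac)
    finally have Cu: "k (C v) * u v = k (C w1) * u w1"
      by (rule cancel_eq) (use w1 k u in simp_all)
    show ?thesis
    proof (cases rule: mod3_cases[OF k(1), of a])
      case 1
      show ?thesis by (rule agree_prod2[OF ag1 _ g u(2)]) (use 1 u(1) in presburger)+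
    next
      case 2
      have e: "g v * k v = g w1 * k w1"
        by (rule agree_prod2[OF ag1 _ g k(2)]) (use 2 in presburger)+
      have "g v * u v * (k v * u v) = (g v * k v) * (u v * u v)" by (simp add: mult_ac)
      also have "\<dots> = g w1 * u w1 * (k w1 * u w1)" unfolding e uu by (simp add: mult_ac)
      finally show ?thesis by (rule cancel_eq) (use w1 k u in simp_all)
    next
      case 3
      have e: "g v * k (C v) = g w1 * k (C w1)"
        by (rule agree_prod2[OF ag1 _ g kC]) (use 3 in presburger)+
      have "g v * u v * (k (C v) * u v) = (g v * k (C v)) * (u v * u v)" by (simp add: mult_ac)
      also have "\<dots> = g w1 * u w1 * (k (C w1) * u w1)" unfolding e uu by (simp add: mult_ac)
      finally show ?thesis by (rule cancel_eq[OF _ Cu]) (use k u in simp)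
    qed
  qed
  have "E v w1"
  proof (rule same_orbit_pairs_triples[OF X(1) A_equiv_X[OF w1(1)]])
    fix i f assume f: "f \<in> W i 0 0"
    show "f v = f w1"
    proof (cases "3 dvd i")
      case True
      then show ?thesis by (intro agree_prod1[OF ag1 _ f]) simp_all
    next
      case False
      then show ?thesis using abA f zs1 by metis
    qed
  next
    fix i i' j k f g assume f: "f \<in> W i j k" and g: "g \<in> W i' j k" and jk: "j < 2" "k < 2" "j \<noteq> 0 \<or> k \<noteq> 0"
    show "f v * g v = f w1 * g w1"
    proof (cases "j = 1")
      case True
      then have "f v = 0" using abP f by blast
      then show ?thesis using zs1[OF f] by simp
    next
      case False
      then have jk: "j = 0" "k = 1" using jk by auto
      have "(f v * g v) * (u v * u v) = (f v * u v) * (g v * u v)" by (simp add: mult_ac)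
      also have "\<dots> = (f w1 * g w1) * (u w1 * u w1)"
        using gu f g unfolding jk by (simp add: mult_ac)
      finally show ?thesis by (rule cancel_eq[OF _ uu]) (use u in simp)
    qed
  next
    fix g1 g2 g3 a1 a2 a3 assume g: "g1 \<in> W a1 1 0" "g2 \<in> W a2 1 1" "g3 \<in> W a3 0 1"
    show "g1 v * g2 v * g3 v = g1 w1 * g2 w1 * g3 w1"
      using abP[OF g(1)] zs1[OF g(1)] by simp
  qed
  then show ?thesis by (rule A_equiv_E[OF w1(1)])
qed

text \<open>Every visible weight of sign \<open>(0,1)\<close> has order 6 and is opposite to
  \<open>k\<close> or to \<open>k o C\<close>. Once \<open>k\<close> is aligned, products of two
  functionals therefore fix each functional individually.\<close>

lemma same_orbit_C_fixed:
  assumes X: "v \<in> X" "w \<in> X" and ag: "agree 2 v w"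
    and zs: "\<forall>i j k f. f \<in> W i j k \<longrightarrow> f v = 0 \<longrightarrow> f w = 0"
    and abA: "\<forall>i f. \<not> 3 dvd i \<longrightarrow> f \<in> W i 0 0 \<longrightarrow> f v = 0"
    and abP: "\<forall>i k f. f \<in> W i 1 k \<longrightarrow> f v = 0"
    and abU: "\<forall>i f. 3 dvd i \<longrightarrow> f \<in> W i 0 1 \<longrightarrow> f v = 0"
    and k: "\<not> 3 dvd i" "k \<in> W i 0 1" "k v \<noteq> 0" "k (C v) \<noteq> 0"
    and m0: "k v ^ 6 = k w ^ 6"
  shows "E v w"
proof -
  note zs = zs[rule_format] and abA = abA[rule_format] and abP = abP[rule_format]
    and abU = abU[rule_format]
  have kC: "(\<lambda>x. k (C x)) \<in> W (2 * i) 0 1" using W_C'[OF k(2)] by simp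
  obtain w1 where w1: "A_equiv w w1" "k w1 = k v"
    using align6[OF X(2) k(2,1) _ m0] by auto
  have ag1: "agree 2 v w1" by (rule A_equiv_agree[OF w1(1) ag])
  have zs1: "g w1 = 0" if "g \<in> W i j k" "g v = 0" for g i j k
    using A_equiv_zero[OF w1(1) that(1) zs[OF that]] .
  have "k v * k (C v) = k w1 * k (C w1)"
    by (rule agree_prod2[OF ag1 _ k(2) kC]) presburger+
  then have C: "k (C w1) = k (C v)" using w1 k by simp
  have r: "g v = g w1" if g: "g \<in> W a 0 1" for g a
  proof (cases rule: mod3_cases[OF k(1), of a])
    case 1
    then show ?thesis using abU[OF 1 g] zs1[OF g] by simp
  next
    case 2
    have "g v * k v = g w1 * k w1"
      by (rule agree_prod2[OF ag1 _ g k(2)]) (use 2 in presburger)+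
    then show ?thesis using w1 k by simp
  next
    case 3
    have "g v * k (C v) = g w1 * k (C w1)"
      by (rule agree_prod2[OF ag1 _ g kC]) (use 3 in presburger)+
    then show ?thesis using C k by simp
  qed
  have "E v w1"
  proof (rule same_orbit_pairs_triples[OF X(1) A_equiv_X[OF w1(1)]])
    fix i f assume f: "f \<in> W i 0 0"
    show "f v = f w1"
    proof (cases "3 dvd i")
      case True
      then show ?thesis by (intro agree_prod1[OF ag1 _ f]) simp_all
    next
      case False
      then show ?thesis using abA f zs1 by metis
    qed
  next
    fix i i' j k f g assume f: "f \<in> W i j k" and g: "g \<in> W i' j k" and jk: "j < 2" "k < 2" "j \<noteq> 0 \<or> k \<noteq> 0"
    show "f v * g v = f w1 * g w1"
    proof (cases "j = 1")
      case True
      then have "f v = 0" using abP f by blast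
      then show ?thesis using zs1[OF f] by simp
    next
      case False
      then have jk: "j = 0" "k = 1" using jk by auto
      show ?thesis using r[of f i] r[of g i'] f g jk by simp
    qed
  next
    fix g1 g2 g3 a1 a2 a3 assume g: "g1 \<in> W a1 1 0" "g2 \<in> W a2 1 1" "g3 \<in> W a3 0 1"
    show "g1 v * g2 v * g3 v = g1 w1 * g2 w1 * g3 w1"
      using abP[OF g(1)] zs1[OF g(1)] by simp
  qed
  then show ?thesis by (rule A_equiv_E[OF w1(1)])
qed

text \<open>With a pure sign \<open>h\<close> beside \<open>f\<close>, it suffices to align
  \<open>f * h\<close>, of order 3. The quartics \<open>f^3 h\<close> and its image under
  \<open>C\<close> then fix \<open>f^2\<close> and \<open>(f o C)^2\<close>, which neutralise pairs.
  For triples the signs are matched by inserting \<open>h\<close> and \<open>h o C\<close>.\<close>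

lemma same_orbit_swapped_sign:
  assumes X: "v \<in> X" "w \<in> X" and ag: "agree 4 v w"
    and zs: "\<forall>i j k f. f \<in> W i j k \<longrightarrow> f v = 0 \<longrightarrow> f w = 0"
    and abA: "\<forall>i f. \<not> 3 dvd i \<longrightarrow> f \<in> W i 0 0 \<longrightarrow> f v = 0"
    and f: "\<not> 3 dvd i" "f \<in> W i 1 0" "f v \<noteq> 0" "f (C v) \<noteq> 0"
    and h: "3 dvd ih" "h \<in> W ih 1 0" "h v \<noteq> 0" "h (C v) \<noteq> 0"
  shows "E v w"
proof -
  note zs = zs[rule_format] and abA = abA[rule_format]
  have fC: "(\<lambda>x. f (C x)) \<in> W (2 * i) 1 1" using W_C'[OF f(2)] by simp
  have hC: "(\<lambda>x. h (C x)) \<in> W (2 * ih) 1 1" using W_C'[OF h(2)] by simp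
  have m: "wt_prod W (1+1) (i+ih) (1+1) (0+0) (\<lambda>x. f x * h x)"
    by (intro wt_prod_mult wt_prod_single f h)
  have i: "\<not> 3 dvd i + ih" using f(1) h(1) by presburger
  have 1: "f v * f v * f v * h v = f w * f w * f w * h w"
    by (rule agree_prod4[OF ag _ f(2) f(2) f(2) h(2)]) (use h(1) in presburger)+
  have 2: "h v * h v = h w * h w"
    by (rule agree_prod2[OF ag _ h(2) h(2)]) (use h(1) in presburger)+
  have id: "(f x * h x) ^ 3 = (f x * f x * f x * h x) * (h x * h x)" for x
    by (simp add: power3_eq_cube mult_ac)
  have "(f v * h v) ^ 3 = (f w * h w) ^ 3" unfolding id 1 2 ..
  then obtain w1 where w1: "A_equiv w w1" "f w1 * h w1 = f v * h v"
    using align3[OF X(2) m i] by blast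
  have ag1: "agree 4 v w1" by (rule A_equiv_agree[OF w1(1) ag])
  have zs1: "g w1 = 0" if "g \<in> W i j k" "g v = 0" for g i j k
    using A_equiv_zero[OF w1(1) that(1) zs[OF that]] .
  have hh: "h v * h v = h w1 * h w1"
    by (rule agree_prod2[OF ag1 _ h(2) h(2)]) (use h(1) in presburger)+
  have hhC: "h (C v) * h (C v) = h (C w1) * h (C w1)"
    by (rule agree_prod2[OF ag1 _ hC hC]) (use h(1) in presburger)+
  have "f v * h v * f (C v) * h (C v) = f w1 * h w1 * f (C w1) * h (C w1)"
    by (rule agree_prod4[OF ag1 _ f(2) h(2) fC hC]) (use h(1) in presburger)+
  then have fhC: "f (C v) * h (C v) = f (C w1) * h (C w1)"
    using w1(2) f h by (simp add: mult.assoc)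
  have "f v * f v * f v * h v = f w1 * f w1 * f w1 * h w1"
    by (rule agree_prod4[OF ag1 _ f(2) f(2) f(2) h(2)]) (use h(1) in presburger)+
  then have ff: "f v * f v = f w1 * f w1" using w1(2) f h by (simp add: mult.assoc)
  have "f (C v) * f (C v) * f (C v) * h (C v) = f (C w1) * f (C w1) * f (C w1) * h (C w1)"
    by (rule agree_prod4[OF ag1 _ fC fC fC hC]) (use h(1) in presburger)+
  then have ffC: "f (C v) * f (C v) = f (C w1) * f (C w1)"
    unfolding mult.assoc fhC[unfolded mult.assoc] using fhC f h
    by (metis mult.assoc mult_right_cancel no_zero_divisors)
  have sp: "g v * h v = g w1 * h w1" if g: "g \<in> W a b c" and h: "h \<in> W a' b c" for g h a a' b c
  proof (cases rule: mod3_cases[OF f(1), of "a + a'"])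
    case 1
    show ?thesis by (rule agree_prod2[OF ag1 _ g h]) (use 1 in presburger)+
  next
    case 2
    have "g v * h v * f (C v) * f (C v) = g w1 * h w1 * f (C w1) * f (C w1)"
      by (rule agree_prod4[OF ag1 _ g h fC fC]) (use 2 in presburger)+
    then show ?thesis unfolding mult.assoc[of _ "f (C _)"] by (rule cancel_eq[OF _ ffC]) (use f in simp)
  next
    case 3
    have "g v * h v * f v * f v = g w1 * h w1 * f w1 * f w1"
      by (rule agree_prod4[OF ag1 _ g h f(2) f(2)]) (use 3 in presburger)+
    then show ?thesis unfolding mult.assoc[of _ "f _"] by (rule cancel_eq[OF _ ff]) (use f in simp)
  qed
  have r: "g v * h v * h (C v) = g w1 * h w1 * h (C w1)" if g: "g \<in> W a 0 1" for g a
  proof (cases rule: mod3_cases[OF f(1), of a])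
    case 1
    show ?thesis by (rule agree_prod3[OF ag1 _ g h(2) hC]) (use 1 h(1) in presburger)+
  next
    case 2
    have e: "g v * f v * h (C v) = g w1 * f w1 * h (C w1)"
      by (rule agree_prod3[OF ag1 _ g f(2) hC]) (use 2 h(1) in presburger)+
    have "(g v * h v * h (C v)) * (f v * h v) = (g v * f v * h (C v)) * (h v * h v)" by (simp add: mult_ac)
    also have "\<dots> = (g w1 * h w1 * h (C w1)) * (f w1 * h w1)" unfolding e hh by (simp add: mult_ac)
    finally show ?thesis by (rule cancel_eq[OF _ w1(2)[symmetric]]) (use f h in simp)
  next
    case 3
    have e: "g v * f (C v) * h v = g w1 * f (C w1) * h w1"
      by (rule agree_prod3[OF ag1 _ g fC h(2)]) (use 3 h(1) in presburger)+
    have "(g v * h v * h (C v)) * (f (C v) * h (C v)) = (g v * f (C v) * h v) * (h (C v) * h (C v))"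
      by (simp add: mult_ac)
    also have "\<dots> = (g w1 * h w1 * h (C w1)) * (f (C w1) * h (C w1))" unfolding e hhC by (simp add: mult_ac)
    finally show ?thesis by (rule cancel_eq[OF _ fhC]) (use f h in simp)
  qed
  have "E v w1"
  proof (rule same_orbit_pairs_triples[OF X(1) A_equiv_X[OF w1(1)]])
    fix i f assume f: "f \<in> W i 0 0"
    show "f v = f w1"
    proof (cases "3 dvd i")
      case True
      then show ?thesis by (intro agree_prod1[OF ag1 _ f]) simp_all
    next
      case False
      then show ?thesis using abA f zs1 by metis
    qed
  next
    fix g1 g2 g3 a1 a2 a3 assume g: "g1 \<in> W a1 1 0" "g2 \<in> W a2 1 1" "g3 \<in> W a3 0 1"
    have "g1 v * g2 v * g3 v * ((h v * h v) * (h (C v) * h (C v))) =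
        (g1 v * h v) * (g2 v * h (C v)) * (g3 v * h v * h (C v))" by (simp add: mult_ac)
    also have "\<dots> = (g1 w1 * h w1) * (g2 w1 * h (C w1)) * (g3 w1 * h w1 * h (C w1))"
      unfolding sp[OF g(1) h(2)] sp[OF g(2) hC] r[OF g(3)] ..
    also have "\<dots> = g1 w1 * g2 w1 * g3 w1 * ((h w1 * h w1) * (h (C w1) * h (C w1)))" by (simp add: mult_ac)
    finally show "g1 v * g2 v * g3 v = g1 w1 * g2 w1 * g3 w1"
      by (rule cancel_eq) (use h in \<open>simp_all add: hh[symmetric] hhC[symmetric]\<close>)
  qed (use sp in blast)
  then show ?thesis by (rule A_equiv_E[OF w1(1)])
qed

text \<open>Without a pure sign beside \<open>f\<close>, its full sixth power has to be aligned.
  General agreement stops at degree 3 here; \<open>P1\<close> and \<open>P2\<close> isolate the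
  quartics needed, in a form that can be supplied for \<open>w\<close> and for \<open>C w\<close>
  alike.\<close>

lemma same_orbit_swapped:
  assumes X: "v \<in> X" "w \<in> X" and ag: "agree 3 v w"
    and zs: "\<forall>i j k f. f \<in> W i j k \<longrightarrow> f v = 0 \<longrightarrow> f w = 0"
    and abA: "\<forall>i f. \<not> 3 dvd i \<longrightarrow> f \<in> W i 0 0 \<longrightarrow> f v = 0"
    and abP: "\<forall>i k f. 3 dvd i \<longrightarrow> f \<in> W i 1 k \<longrightarrow> f v = 0"
    and abR: "\<forall>i f. \<not> 3 dvd i \<longrightarrow> f \<in> W i 0 1 \<longrightarrow> f v = 0"
    and f: "\<not> 3 dvd i" "f \<in> W i 1 0" "f v \<noteq> 0" "f (C v) \<noteq> 0"
    and m0: "f v ^ 6 = f w ^ 6"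
    and P1: "\<forall>g a. g \<in> W a 1 0 \<longrightarrow> 3 dvd a + 2 * i \<longrightarrow>
      g v * f v * f (C v) * f (C v) = g w * f w * f (C w) * f (C w)"
    and P2: "\<forall>g h a b. g \<in> W a 1 1 \<longrightarrow> h \<in> W b 1 1 \<longrightarrow> 3 dvd a + i \<longrightarrow> 3 dvd b + i \<longrightarrow>
      g v * h v * f v * f v = g w * h w * f w * f w"
  shows "E v w"
proof -
  note zs = zs[rule_format] and abA = abA[rule_format] and abP = abP[rule_format]
    and abR = abR[rule_format] and P1 = P1[rule_format] and P2 = P2[rule_format]
  have fC: "(\<lambda>x. f (C x)) \<in> W (2 * i) 1 1" using W_C'[OF f(2)] by simp
  obtain w1 where w1: "A_equiv w w1" "f w1 = f v"
    using align6[OF X(2) f(2,1) _ m0] by auto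
  have ag1: "agree 3 v w1" by (rule A_equiv_agree[OF w1(1) ag])
  have zs1: "g w1 = 0" if "g \<in> W i j k" "g v = 0" for g i j k
    using A_equiv_zero[OF w1(1) that(1) zs[OF that]] .
  have P1': "g v * (f (C v) * f (C v)) = g w1 * (f (C w1) * f (C w1))"
    if g: "g \<in> W a 1 0" "3 dvd a + 2 * i" for g a
  proof -
    have Z: "Z 4 (\<lambda>x. g x * f x * f (C x) * f (C x))"
      by (rule zero_sum_prod4[OF _ g(1) f(2) fC fC]) (use g(2) in presburger)+
    have "f v * (g v * (f (C v) * f (C v))) = f w1 * (g w1 * (f (C w1) * f (C w1)))"
      using A_equiv_Z[OF w1(1) Z] P1[OF g] by (simp only: mult_ac)
    then show ?thesis using w1(2) f(3) by simp
  qed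
  have P2': "g v * h v = g w1 * h w1"
    if g: "g \<in> W a 1 1" "h \<in> W b 1 1" "3 dvd a + i" "3 dvd b + i" for g h a b
  proof -
    have Z: "Z 4 (\<lambda>x. g x * h x * f x * f x)"
      by (rule zero_sum_prod4[OF _ g(1,2) f(2) f(2)]) (use g(3,4) in presburger)+
    have "g v * h v * f v * f v = g w1 * h w1 * f w1 * f w1"
      using A_equiv_Z[OF w1(1) Z] P2[OF g] by (simp only:)
    then show ?thesis using w1(2) f(3) by simp
  qed
  \<comment> \<open>Taking \<open>g = f\<close> in \<open>P1'\<close> aligns the square of
    \<open>f o C\<close>, although \<open>f o C\<close> itself is known only up to sign.\<close>
  have "3 dvd i + 2 * i" by presburger
  from P1'[OF f(2) this] have ffC: "f (C v) * f (C v) = f (C w1) * f (C w1)" using w1(2) f(3) by simp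
  have p: "g v = g w1" if g: "g \<in> W a 1 0" for g a
  proof (cases rule: mod3_cases[OF f(1), of a])
    case 1
    then show ?thesis using abP[OF 1 g] zs1[OF g] by simp
  next
    case 2
    have "g v * f v = g w1 * f w1"
      by (rule agree_prod2[OF ag1 _ g f(2)]) (use 2 in presburger)+
    then show ?thesis using w1 f by simp
  next
    case 3
    show ?thesis by (rule cancel_eq[OF P1'[OF g 3] ffC]) (use f in simp)
  qed
  have q: "g v * h v = g w1 * h w1" if g: "g \<in> W a 1 1" and h: "h \<in> W b 1 1" for g h a b
  proof -
    have C: "g v * f (C v) = g w1 * f (C w1)" if "3 dvd a + 2 * i" "g \<in> W a 1 1" for g a
      by (rule agree_prod2[OF ag1 _ that(2) fC]) (use that in presburger)+
    \<comment> \<open>If neither weight is trivial modulo 3 and they do not cancel, they coincide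
      modulo 3, being both opposite to \<open>f\<close> or both opposite to
      \<open>f o C\<close>.\<close>
    have "3 dvd a \<or> 3 dvd b \<or> 3 dvd a + b \<or> (3 dvd a + i \<and> 3 dvd b + i) \<or> (3 dvd a + 2 * i \<and> 3 dvd b + 2 * i)"
      using f(1) by presburger
    moreover have "3 dvd a \<Longrightarrow> g v = 0" "3 dvd b \<Longrightarrow> h v = 0" using abP g h by blast+
    ultimately consider "g v = 0" | "h v = 0" | "3 dvd a + b" | "3 dvd a + i" "3 dvd b + i"
      | "3 dvd a + 2 * i" "3 dvd b + 2 * i" by blast
    then show ?thesis
    proof cases
      case 1 then show ?thesis using zs1[OF g] by simp
    next
      case 2 then show ?thesis using zs1[OF h] by simp
    next
      case 3 then show ?thesis by (intro agree_prod2[OF ag1 _ g h]) simp_all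
    next
      case 4 then show ?thesis using P2' g h by blast
    next
      case 5
      have "g v * h v * (f (C v) * f (C v)) = (g v * f (C v)) * (h v * f (C v))" by (simp add: mult_ac)
      also have "\<dots> = (g w1 * f (C w1)) * (h w1 * f (C w1))" using C 5 g h by simp
      also have "\<dots> = g w1 * h w1 * (f (C w1) * f (C w1))" by (simp add: mult_ac)
      finally show ?thesis by (rule cancel_eq[OF _ ffC]) (use f in simp)
    qed
  qed
  have "E v w1"
  proof (rule same_orbit_pairs_triples[OF X(1) A_equiv_X[OF w1(1)]])
    fix i f assume f: "f \<in> W i 0 0"
    show "f v = f w1"
    proof (cases "3 dvd i")
      case True
      then show ?thesis by (intro agree_prod1[OF ag1 _ f]) simp_all
    next
      case False
      then show ?thesis using abA f zs1 by metis
    qed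
  next
    fix a b j k g h assume g: "g \<in> W a j k" and h: "h \<in> W b j k" and jk: "j < 2" "k < 2" "j \<noteq> 0 \<or> k \<noteq> 0"
    consider "j = 1" "k = 0" | "j = 1" "k = 1" | "j = 0" "k = 1" using jk by linarith
    then show "g v * h v = g w1 * h w1"
    proof cases
      case 1
      then show ?thesis using p[of g a] p[of h b] g h by simp
    next
      case 2
      then show ?thesis using q[of g a h b] g h by simp
    next
      case 3
      have "g v = 0 \<or> h v = 0 \<or> 3 dvd a \<and> 3 dvd b"
        using abR[of a g] abR[of b h] g h 3 by auto
      then consider "g v = 0" | "h v = 0" | "3 dvd a" "3 dvd b" by blast
      then show ?thesis
      proof cases
        case 1 then show ?thesis using zs1[OF g] by simp
      next
        case 2 then show ?thesis using zs1[OF h] by simp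
      next
        case 3 then show ?thesis by (intro agree_prod2[OF ag1 _ g h]) simp_all
      qed
    qed
  next
    fix g1 g2 g3 a1 a2 a3 assume g: "g1 \<in> W a1 1 0" "g2 \<in> W a2 1 1" "g3 \<in> W a3 0 1"
    have "g2 v * g3 v = g2 w1 * g3 w1"
    proof (cases "3 dvd a3")
      case False
      then show ?thesis using abR[OF False g(3)] zs1[OF g(3)] by simp
    next
      case a3: True
      show ?thesis
      proof (cases rule: mod3_cases[OF f(1), of a2])
        case 1
        then show ?thesis using abP[OF 1 g(2)] zs1[OF g(2)] by simp
      next
        case 2
        have "g2 v * f v * g3 v = g2 w1 * f w1 * g3 w1"
          by (rule agree_prod3[OF ag1 _ g(2) f(2) g(3)]) (use 2 a3 in presburger)+
        then show ?thesis using w1 f by simp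
      next
        case 3
        have "g2 v * f (C v) = g2 w1 * f (C w1)"
          by (rule agree_prod2[OF ag1 _ g(2) fC]) (use 3 in presburger)+
        moreover have "f v * f (C v) * g3 v = f w1 * f (C w1) * g3 w1"
          by (rule agree_prod3[OF ag1 _ f(2) fC g(3)]) (use a3 in presburger)+
        then have "f (C v) * g3 v = f (C w1) * g3 w1" using w1 f by simp
        ultimately have "(g2 v * f (C v)) * (f (C v) * g3 v) = (g2 w1 * f (C w1)) * (f (C w1) * g3 w1)"
          by simp
        then have "g2 v * g3 v * (f (C v) * f (C v)) = g2 w1 * g3 w1 * (f (C w1) * f (C w1))"
          by (simp add: mult_ac)
        then show ?thesis by (rule cancel_eq[OF _ ffC]) (use f in simp)
      qed
    qed
    then show "g1 v * g2 v * g3 v = g1 w1 * g2 w1 * g3 w1" using p[OF g(1)] by (simp add: mult.assoc)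
  qed
  then show ?thesis by (rule A_equiv_E[OF w1(1)])
qed

section \<open>Points that low degree does not tell from their image under \<open>C\<close>\<close>

text \<open>The combination of \<open>f\<close> and \<open>g\<close> chosen to vanish at
  \<open>C v\<close> must vanish at \<open>v\<close> too; this is where closure of the weight spaces
  under linear combinations enters.\<close>

lemma C_nonvanishing_proportional:
  assumes "C_nonvanishing v" "order6 i j k" "f \<in> W i j k" "g \<in> W i j k"
  shows "f v * g (C v) = g v * f (C v)"
proof -
  let ?h = "\<lambda>x. f (C v) * g x - g (C v) * f x"
  have "?h \<in> W i j k" by (rule W_lin[OF assms(4,3)])
  moreover have "?h (C v) = 0" by simp
  ultimately have "?h v = 0" using assms(1,2) unfolding C_nonvanishing_def by blast
  then show ?thesis by (simp add: mult_ac)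
qed

text \<open>For order 6 the monomial \<open>f^2 (f o C)^2\<close> takes equal values at a point and
  its image under \<open>C\<close>, so its sum determines it. For the other orders
  \<open>f^2\<close> or \<open>f^3\<close> has weight zero.\<close>

lemma zero_transfer:
  assumes X: "v \<in> X" "w \<in> X" and H: "sums_agree v w" and Fc: "C_nonvanishing w" and ag: "agree 3 v w"
    and f: "f \<in> W i j k" "f v = 0"
  shows "f w = 0"
proof (cases "order6 i j k")
  case True
  have "Z 4 (\<lambda>x. f x * f x * f (C x) * f (C x))"
    by (rule zero_sum_prod4[OF _ f(1) f(1) W_C[OF f(1)] W_C[OF f(1)]]) presburger+
  from sums_agreeD[OF H this] have "2 * (f w * f w * f (C w) * f (C w)) = 0"
    using f by (simp add: CC X mult_ac)
  then have "f w = 0 \<or> f (C w) = 0" using two by auto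
  then show ?thesis using Fc True f(1) unfolding C_nonvanishing_def by blast
next
  case False
  then consider "3 dvd i" | "2 dvd j" "2 dvd k" unfolding order6_def by blast
  then show ?thesis
  proof cases
    case 1
    have "f v * f v = f w * f w" by (rule agree_prod2[OF ag _ f(1) f(1)]) (use 1 in presburger)+
    then show ?thesis using f by simp
  next
    case 2
    have "f v * f v * f v = f w * f w * f w"
      by (rule agree_prod3[OF ag _ f(1) f(1) f(1)]) (use 2 in presburger)+
    then show ?thesis using f by simp
  qed
qed

text \<open>Order 6 is covered by \<open>C_nonvanishing\<close>; for every other order
  \<open>f^2\<close> or \<open>f^3\<close> is a monomial to which the symmetry in degree 3
  applies.\<close>

lemma nonzero_C:
  assumes Fc: "C_nonvanishing v" and nd: "C_symmetric 3 v" and f: "f \<in> W i j k" "f v \<noteq> 0"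
  shows "f (C v) \<noteq> 0"
proof (cases "order6 i j k")
  case True
  then show ?thesis using Fc f unfolding C_nonvanishing_def by blast
next
  case False
  then consider "3 dvd i" | "2 dvd j" "2 dvd k" unfolding order6_def by blast
  then show ?thesis
  proof cases
    case 1
    have "f v * f v = f (C v) * f (C v)" by (rule C_symmetricD[OF nd zero_sum_prod2[OF _ f(1) f(1)]]) (use 1 in presburger)+
    then show ?thesis using f by auto
  next
    case 2
    have "f v * f v * f v = f (C v) * f (C v) * f (C v)"
      by (rule C_symmetricD[OF nd zero_sum_prod3[OF _ f(1) f(1) f(1)]]) (use 2 in presburger)+
    then show ?thesis using f by auto
  qed
qed

lemma swap_cases:
  assumes H: "sums_agree v w" and m: "Z D m" "D \<le> 9" and p: "m v * m (C v) = m w * m (C w)"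
  shows "m v = m w \<or> m v = m (C w)"
  using same_pair_prod[OF sums_agreeD[OF H m] p] .

text \<open>In each configuration of non-vanishing weights, agreement in low degree together with one further
  monomial \<open>m\<close> suffices. Where \<open>m\<close> is not covered by the agreement, \<open>m * (m \<circ> C)\<close> still is, so \<open>m\<close>
  agrees at \<open>v\<close> and at one of \<open>w\<close>, \<open>C w\<close>.\<close>

lemma same_orbit_C_symmetric:
  assumes X: "v \<in> X" "w \<in> X" and H: "sums_agree v w" and Fc: "C_nonvanishing v" "C_nonvanishing w" and nd: "C_symmetric 3 v" "C_symmetric 3 w"
    and alt: "agree 5 v w \<or> C_symmetric 4 v \<and> C_symmetric 4 w"
  shows "E v w"
proof -
  have Cw: "C w \<in> X" "sums_agree v (C w)" "C_nonvanishing (C w)" "C_symmetric 3 (C w)"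
    using X H Fc nd by (simp_all add: closed sums_agree_C C_nonvanishing_C C_symmetric_C)
  have ag3: "agree 3 v w" "agree 3 v (C w)"
    using C_symmetric_agree[OF H nd] C_symmetric_agree[OF Cw(2) nd(1) Cw(4)] by simp_all
  have ag2: "agree 2 v w" "agree 2 v (C w)" by (rule agree_mono[OF ag3(1)], simp) (rule agree_mono[OF ag3(2)], simp)
  have ag4: "agree 4 v w" using alt C_symmetric_agree[OF H, of 4] agree_mono[of 5 v w 4] by auto
  have zs: "\<forall>i j k f. f \<in> W i j k \<longrightarrow> f v = 0 \<longrightarrow> f w = 0"
    "\<forall>i j k f. f \<in> W i j k \<longrightarrow> f v = 0 \<longrightarrow> f (C w) = 0"
    using zero_transfer[OF X H Fc(2) ag3(1)] zero_transfer[OF X(1) Cw(1,2,3) ag3(2)] by blast+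
  have pC: "f (C v) \<noteq> 0" if "f \<in> W i j k" "f v \<noteq> 0" for f i j k
    using nonzero_C[OF Fc(1) nd(1) that] .
  have toP: "\<exists>f. f \<in> W (2 * i) 1 0 \<and> f v \<noteq> 0" if "f \<in> W i 1 1" "f v \<noteq> 0" for f i
    using W_C'[OF that(1)] pC[OF that] by auto
  have E_swap: "E v (C w) \<Longrightarrow> E v w" by (rule E_C[OF X(2)])
  \<comment> \<open>The split is by the sign attached to a visible weight that is nontrivial modulo
    3: no such weight, trivial sign, the sign fixed by \<open>C\<close>, or one of the two signs
    that \<open>C\<close> exchanges.\<close>
  consider (Z) "\<forall>i j k. \<forall>f \<in> W i j k. \<not> 3 dvd i \<longrightarrow> f v = 0"
    | (A) i f where "\<not> 3 dvd i" "f \<in> W i 0 0" "f v \<noteq> 0"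
    | (R) i k where "\<forall>i. \<forall>f \<in> W i 0 0. \<not> 3 dvd i \<longrightarrow> f v = 0" "\<not> 3 dvd i" "k \<in> W i 0 1" "k v \<noteq> 0"
    | (P) i j k f where "\<forall>i. \<forall>f \<in> W i 0 0. \<not> 3 dvd i \<longrightarrow> f v = 0" "\<forall>i. \<forall>f \<in> W i 0 1. \<not> 3 dvd i \<longrightarrow> f v = 0"
      "\<not> 3 dvd i" "f \<in> W i j k" "f v \<noteq> 0"
    by blast
  then show ?thesis
  proof cases
    case Z
    show ?thesis by (rule same_orbit_trivial_cube_part[OF X ag3(1) zs(1)]) (use Z in blast)+
  next
    case A
    then show ?thesis using same_orbit_cubic_weight[OF X ag4] pC by blast
  next
    case R
    have abA: "\<forall>i f. \<not> 3 dvd i \<longrightarrow> f \<in> W i 0 0 \<longrightarrow> f v = 0" using R(1) by blast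
    have kC: "(\<lambda>x. k (C x)) \<in> W (2 * i) 0 1" using W_C'[OF R(3)] by simp
    have kCv: "k (C v) \<noteq> 0" using pC R by blast
    have kk: "k v * k (C v) = k w * k (C w)"
      by (rule agree_prod2[OF ag2(1) _ R(3) kC]) presburger+
    show ?thesis
    proof (cases "\<exists>i f. f \<in> W i 1 0 \<and> f v \<noteq> 0")
      case True
      then obtain i1 f where f: "f \<in> W i1 1 0" "f v \<noteq> 0" by blast
      have fC: "(\<lambda>x. f (C x)) \<in> W (2 * i1) 1 1" using W_C'[OF f(1)] by simp
      have fCv: "f (C v) \<noteq> 0" using pC f by blast
      have Z: "Z 5 (\<lambda>x. f x * f (C x) * k x * k x * k x)"
        by (rule zero_sum_prod5[OF _ f(1) fC R(3) R(3) R(3)]) presburger+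
      note K = same_orbit_mixed_weights[OF X(1) _ _ _ abA R(2,3,4) kCv f fCv]
      show ?thesis
      proof (cases "agree 5 v w")
        case True
        show ?thesis by (rule K[OF X(2) ag4 zs(1) agreeD[OF True Z]])
      next
        case False
        then have nd4: "C_symmetric 4 v" "C_symmetric 4 w" using alt by auto
        have ag4': "agree 4 v (C w)" using C_symmetric_agree[OF Cw(2) nd4(1) C_symmetric_C[OF X(2) nd4(2)]] by simp
        have ff: "f v * f v * f (C v) * f (C v) = f w * f w * f (C w) * f (C w)"
          by (rule agree_prod4[OF ag4 _ f(1) f(1) fC fC]) presburger+
        \<comment> \<open>The quintic times its image under \<open>C\<close> is built from
          \<open>ff\<close> and \<open>kk\<close>, which agree. With equal sums this leaves only the
          choice between \<open>w\<close> and \<open>C w\<close>.\<close>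
        have id: "(f x * f (C x) * k x * k x * k x) * (f (C x) * f x * k (C x) * k (C x) * k (C x)) =
          (f x * f x * f (C x) * f (C x)) * (k x * k (C x)) ^ 3" for x
          by (simp add: power3_eq_cube mult_ac)
        from swap_cases[OF H Z] have "f v * f (C v) * k v * k v * k v = f w * f (C w) * k w * k w * k w \<or>
            f v * f (C v) * k v * k v * k v = f (C w) * f w * k (C w) * k (C w) * k (C w)"
          unfolding CC[OF X(1)] CC[OF X(2)] id ff kk by simp
        then show ?thesis
        proof
          assume "f v * f (C v) * k v * k v * k v = f w * f (C w) * k w * k w * k w"
          then show ?thesis by (rule K[OF X(2) ag4 zs(1)])
        next
          assume "f v * f (C v) * k v * k v * k v = f (C w) * f w * k (C w) * k (C w) * k (C w)"
          then show ?thesis by (intro E_swap K[OF Cw(1) ag4' zs(2)]) (simp_all add: CC X)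
        qed
      qed
    next
      case False
      have abP0: "f v = 0" if "f \<in> W i 1 k" for i k f
      proof -
        have "f \<in> W i 1 0 \<or> f \<in> W i 1 1"
          using W_mod[OF that, of i 1 0] W_mod[OF that, of i 1 1] by (metis mod2_eq_if mod_mod_trivial one_mod_two_eq_one mod_0)
        then show ?thesis using False toP by blast
      qed
      then have abP: "\<forall>i k f. f \<in> W i 1 k \<longrightarrow> f v = 0" by blast
      show ?thesis
      proof (cases "\<exists>i u. 3 dvd i \<and> u \<in> W i 0 1 \<and> u v \<noteq> 0")
        case True
        then show ?thesis using same_orbit_C_fixed_sign[OF X ag4 zs(1) abA abP R(2-4) kCv] by blast
      next
        case False
        then have abU: "\<forall>i f. 3 dvd i \<longrightarrow> f \<in> W i 0 1 \<longrightarrow> f v = 0" by blast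
        have "k v ^ 6 * k (C v) ^ 6 = k w ^ 6 * k (C w) ^ 6"
          unfolding power_mult_distrib[symmetric] kk ..
        from swap_cases[OF H zero_sum_sixth[OF _ R(3)], of 6] this have "k v ^ 6 = k w ^ 6 \<or> k v ^ 6 = k (C w) ^ 6" by simp
        then show ?thesis
          using same_orbit_C_fixed[OF X ag2(1) zs(1) abA abP abU R(2-4) kCv]
            same_orbit_C_fixed[OF X(1) Cw(1) ag2(2) zs(2) abA abP abU R(2-4) kCv] E_swap by blast
      qed
    qed
  next
    case P
    have abA: "\<forall>i f. \<not> 3 dvd i \<longrightarrow> f \<in> W i 0 0 \<longrightarrow> f v = 0" using P(1) by blast
    have abR: "\<forall>i f. \<not> 3 dvd i \<longrightarrow> f \<in> W i 0 1 \<longrightarrow> f v = 0" using P(2) by blast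
    have "f \<in> W i (j mod 2) (k mod 2)" by (rule W_mod[OF P(4)]) auto
    moreover have "j mod 2 = 0 \<or> j mod 2 = 1" "k mod 2 = 0 \<or> k mod 2 = 1" by auto
    ultimately have "f \<in> W i 1 0 \<or> f \<in> W i 1 1" using abA abR P by metis
    moreover have "\<not> 3 dvd 2 * i" using P(3) by presburger
    ultimately obtain i f where f: "\<not> 3 dvd i" "f \<in> W i 1 0" "f v \<noteq> 0" using toP P by blast
    have fCv: "f (C v) \<noteq> 0" using pC f by blast
    have fC: "(\<lambda>x. f (C x)) \<in> W (2 * i) 1 1" using W_C'[OF f(2)] by simp
    show ?thesis
    proof (cases "\<exists>i h. 3 dvd i \<and> h \<in> W i 1 0 \<and> h v \<noteq> 0")
      case True
      then show ?thesis using same_orbit_swapped_sign[OF X ag4 zs(1) abA f fCv] pC by blast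
    next
      case False
      have abP0: "h v = 0" if "3 dvd i" "h \<in> W i 1 k" for i k h
      proof -
        have "h \<in> W i 1 (k mod 2)" by (rule W_mod[OF that(2)]) auto
        moreover have "k mod 2 = 0 \<or> k mod 2 = 1" by auto
        ultimately have "h \<in> W i 1 0 \<or> h \<in> W i 1 1" by metis
        moreover have "3 dvd 2 * i" using that(1) by simp
        ultimately show ?thesis using False toP that(1) by blast
      qed
      then have abP: "\<forall>i k f. 3 dvd i \<longrightarrow> f \<in> W i 1 k \<longrightarrow> f v = 0" by blast
      have o: "order6 i 1 0" using f by (simp add: order6_def)
      \<comment> \<open>A monomial that \<open>C\<close> leaves unchanged at both points is half of
        its sum. No agreement in degree 4 is invoked, so the conclusion holds for \<open>C w\<close>
        as well as for \<open>w\<close>.\<close>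
      have key: "m v = m w \<and> m v = m (C w)" if m: "Z 4 m" and e: "m v = m (C v)" "m w = m (C w)" for m
      proof -
        have "2 * m v = 2 * m w" using sums_agreeD[OF H m] e by simp
        then show ?thesis using two e by simp
      qed
      have P1: "g v * f v * f (C v) * f (C v) = g w * f w * f (C w) * f (C w) \<and>
          g v * f v * f (C v) * f (C v) = g (C w) * f (C w) * f w * f w"
        if g: "g \<in> W a 1 0" "3 dvd a + 2 * i" for g a
      proof -
        have gi: "g \<in> W i 1 0" by (rule W_mod[OF g(1)]) (use g(2) in presburger)+
        have Z: "Z 4 (\<lambda>x. g x * f x * f (C x) * f (C x))"
          by (rule zero_sum_prod4[OF _ g(1) f(2) fC fC]) (use g(2) in presburger)+
        \<comment> \<open>Here \<open>g\<close> and \<open>f\<close> lie in one weight space of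
          order 6, so proportionality makes this quartic symmetric under \<open>C\<close>.\<close>
        have id: "g x * f x * f (C x) * f (C x) = g (C x) * f (C x) * f x * f x" if "C_nonvanishing x" for x
        proof -
          have "(g x * f (C x)) * (f x * f (C x)) = (f x * g (C x)) * (f x * f (C x))"
            unfolding C_nonvanishing_proportional[OF that o gi f(2)] ..
          then show ?thesis by (simp only: mult_ac)
        qed
        show ?thesis using key[OF Z, unfolded CC[OF X(1)] CC[OF X(2)], OF id[OF Fc(1)] id[OF Fc(2)]] .
      qed
      have P2: "g v * h v * f v * f v = g w * h w * f w * f w \<and>
          g v * h v * f v * f v = g (C w) * h (C w) * f (C w) * f (C w)"
        if g: "g \<in> W a 1 1" "h \<in> W b 1 1" "3 dvd a + i" "3 dvd b + i" for g h a b
      proof -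
        have Z: "Z 4 (\<lambda>x. g x * h x * f x * f x)"
          by (rule zero_sum_prod4[OF _ g(1,2) f(2) f(2)]) (use g(3,4) in presburger)+
        have gC: "(\<lambda>x. g (C x)) \<in> W i 1 0" "(\<lambda>x. h (C x)) \<in> W i 1 0"
          by (rule W_mod[OF W_C[OF g(1)]]; use g(3) in presburger)
            (rule W_mod[OF W_C[OF g(2)]]; use g(4) in presburger)
        \<comment> \<open>Composition with \<open>C\<close> moves \<open>g\<close> and
          \<open>h\<close> into the weight space of \<open>f\<close>, where proportionality
          exchanges \<open>x\<close> and \<open>C x\<close>.\<close>
        have id: "g x * h x * f x * f x = g (C x) * h (C x) * f (C x) * f (C x)" if x: "x \<in> X" "C_nonvanishing x" for x
        proof -
          have 1: "g (C x) * f (C x) = f x * g x" "h (C x) * f (C x) = f x * h x"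
            using C_nonvanishing_proportional[OF x(2) o gC(1) f(2)] C_nonvanishing_proportional[OF x(2) o gC(2) f(2)] by (simp_all add: CC x)
          have "g (C x) * h (C x) * f (C x) * f (C x) = (g (C x) * f (C x)) * (h (C x) * f (C x))"
            by (simp only: mult_ac)
          then show ?thesis unfolding 1 by (simp only: mult_ac)
        qed
        show ?thesis using key[OF Z] id[OF X(1) Fc(1)] id[OF X(2) Fc(2)] by simp
      qed
      have "3 dvd i + 2 * i" by presburger
      then have ff: "f v * f v * f (C v) * f (C v) = f w * f w * f (C w) * f (C w)"
        using P1[OF f(2)] by blast
      have id: "f x ^ 6 * f (C x) ^ 6 = (f x * f x * f (C x) * f (C x)) ^ 3" for x
        by (simp add: numeral_eq_Suc mult_ac)
      have "f v ^ 6 * f (C v) ^ 6 = f w ^ 6 * f (C w) ^ 6" unfolding id ff ..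
      from swap_cases[OF H zero_sum_sixth[OF _ f(2)], of 6] this
      consider "f v ^ 6 = f w ^ 6" | "f v ^ 6 = f (C w) ^ 6" by auto
      then show ?thesis
      proof cases
        case 1
        show ?thesis
          by (rule same_orbit_swapped[OF X ag3(1) zs(1) abA abP abR f fCv 1]; intro allI impI)
            (erule (1) P1[THEN conjunct1], erule (3) P2[THEN conjunct1])
      next
        case 2
        show ?thesis
        proof (rule E_swap, rule same_orbit_swapped[OF X(1) Cw(1) ag3(2) zs(2) abA abP abR f fCv 2]; intro allI impI)
          fix g a assume "g \<in> W a 1 0" "3 dvd a + 2 * i"
          from conjunct2[OF P1[OF this]]
          show "g v * f v * f (C v) * f (C v) = g (C w) * f (C w) * f (C (C w)) * f (C (C w))"
            unfolding CC[OF X(2)] .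
        next
          fix g h a b assume "g \<in> W a 1 1" "h \<in> W b 1 1" "3 dvd a + i" "3 dvd b + i"
          from conjunct2[OF P2[OF this]]
          show "g v * h v * f v * f v = g (C w) * h (C w) * f (C w) * f (C w)" .
        qed
      qed
    qed
  qed
qed

text \<open>Asymmetry in degree 3 leaves agreement up to degree 6, the exponent of the group
  generated by \<open>a\<close> and \<open>b\<close>. Asymmetry first seen in degree 4 leaves degree
  5, just enough for the quintic in \<open>same_orbit_mixed_weights\<close>.\<close>

lemma same_orbit:
  assumes X: "v \<in> X" "w \<in> X" and H: "sums_agree v w"
  shows "E v w"
proof -
  consider "\<not> C_nonvanishing v" | "\<not> C_nonvanishing w" | "C_nonvanishing v" "C_nonvanishing w" by blast
  then show ?thesis
  proof cases
    case 1
    then show ?thesis using same_orbit_vanishing[OF X H] unfolding C_nonvanishing_def by blast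
  next
    case 2
    then have "E w v" using same_orbit_vanishing[OF X(2,1) sums_agree_sym[OF H]] unfolding C_nonvanishing_def by blast
    then show ?thesis by (rule E_sym)
  next
    case Fc: 3
    show ?thesis
    proof (cases "C_symmetric 3 v \<and> C_symmetric 3 w")
      case False
      then have "agree 6 v w \<or> agree 6 v (C w)" by (intro agree_of_asymmetry'[OF X H False]) simp_all
      then show ?thesis
        using same_orbit_agree6[OF X Fc(1)] same_orbit_agree6[OF X(1) closed(4)[OF X(2)] Fc(1)] E_C[OF X(2)] by blast
    next
      case nd: True
      have "agree 5 v w \<or> agree 5 v (C w) \<or> C_symmetric 4 v \<and> C_symmetric 4 w"
        using agree_of_asymmetry'[OF X H, of 4 5] by auto
      then consider "agree 5 v w \<or> C_symmetric 4 v \<and> C_symmetric 4 w" | "agree 5 v (C w)" by blast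
      then show ?thesis
      proof cases
        case 1
        then show ?thesis using same_orbit_C_symmetric[OF X H Fc] nd by blast
      next
        case 2
        then have "E v (C w)"
          using same_orbit_C_symmetric[OF X(1) closed(4)[OF X(2)] sums_agree_C[OF X(2) H] Fc(1) C_nonvanishing_C[OF X(2) Fc(2)]]
            nd C_symmetric_C[OF X(2)] by blast
        then show ?thesis by (rule E_C[OF X(2)])
      qed
    qed
  qed
qed

end

section \<open>Formal polynomials and averaging\<close>

definition monom_val :: "(nat \<Rightarrow> 'r::comm_ring_1) \<Rightarrow> (nat \<Rightarrow>\<^sub>0 nat) \<Rightarrow> 'r" where
  "monom_val x m = (\<Prod>i\<in>Poly_Mapping.keys m. x i ^ Poly_Mapping.lookup m i)"

text \<open>Ring homomorphisms in predicate form. Evaluation (identity on coefficients) and linear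
  substitution (\<open>const_pol\<close>) are both instances, so one set of lemmas on
  \<open>pol_subst\<close> serves the two.\<close>

definition coeff_hom :: "('k::field \<Rightarrow> 'r::comm_ring_1) \<Rightarrow> bool" where
  "coeff_hom c \<longleftrightarrow> c 0 = 0 \<and> c 1 = 1 \<and> (\<forall>a b. c (a + b) = c a + c b) \<and> (\<forall>a b. c (a * b) = c a * c b)"

lemma monom_val_superset:
  "finite S \<Longrightarrow> Poly_Mapping.keys m \<subseteq> S \<Longrightarrow> monom_val x m = (\<Prod>i\<in>S. x i ^ Poly_Mapping.lookup m i)"
  unfolding monom_val_def by (intro prod.mono_neutral_left) (auto simp: in_keys_iff)

lemma monom_val_zero [simp]: "monom_val x 0 = 1"
  by (simp add: monom_val_def)

lemma monom_val_add: "monom_val x (m + m') = monom_val x m * monom_val x m'"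
proof -
  let ?S = "Poly_Mapping.keys m \<union> Poly_Mapping.keys m'"
  have "monom_val x (m + m') = (\<Prod>i\<in>?S. x i ^ Poly_Mapping.lookup (m + m') i)"
    by (rule monom_val_superset) (simp_all add: keys_add)
  also have "\<dots> = (\<Prod>i\<in>?S. x i ^ Poly_Mapping.lookup m i) * (\<Prod>i\<in>?S. x i ^ Poly_Mapping.lookup m' i)"
    by (simp add: lookup_add power_add prod.distrib)
  also have "\<dots> = monom_val x m * monom_val x m'"
    by (simp add: monom_val_superset[of ?S])
  finally show ?thesis .
qed

lemma pol_subst_monom_val:
  "pol_subst c x f = (\<Sum>m\<in>Poly_Mapping.keys f. c (Poly_Mapping.lookup f m) * monom_val x m)"
  by (simp add: pol_subst_def monom_val_def)

lemma pol_subst_superset: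
  assumes "c 0 = 0" "finite S" "Poly_Mapping.keys f \<subseteq> S"
  shows "pol_subst c x f = (\<Sum>m\<in>S. c (Poly_Mapping.lookup f m) * monom_val x m)"
  unfolding pol_subst_monom_val using assms
  by (intro sum.mono_neutral_left) (auto simp: in_keys_iff)

lemma pol_subst_zero: "pol_subst c x 0 = 0"
  by (simp add: pol_subst_def)

lemma pol_subst_single: "c 0 = 0 \<Longrightarrow> pol_subst c x (Poly_Mapping.single m a) = c a * monom_val x m"
  by (simp add: pol_subst_superset[of c "{m}"])

lemma pol_subst_add:
  assumes "coeff_hom c"
  shows "pol_subst c x (f + g) = pol_subst c x f + pol_subst c x g"
proof -
  let ?S = "Poly_Mapping.keys f \<union> Poly_Mapping.keys g"
  have c: "c 0 = 0" "\<And>a b. c (a + b) = c a + c b" using assms by (simp_all add: coeff_hom_def)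
  have "pol_subst c x h = (\<Sum>m\<in>?S. c (Poly_Mapping.lookup h m) * monom_val x m)"
    if "Poly_Mapping.keys h \<subseteq> ?S" for h
    using pol_subst_superset[of c ?S h x] c(1) that by simp
  from this[of f] this[of g] this[of "f + g"] keys_add[of f g] show ?thesis
    by (simp add: lookup_add c(2) distrib_right sum.distrib)
qed

lemma pol_subst_sum:
  assumes "coeff_hom c"
  shows "pol_subst c x (\<Sum>i\<in>I. f i) = (\<Sum>i\<in>I. pol_subst c x (f i))"
  by (induction I rule: infinite_finite_induct) (simp_all add: pol_subst_zero pol_subst_add[OF assms])

lemma poly_expand: "f = (\<Sum>m\<in>Poly_Mapping.keys f. Poly_Mapping.single m (Poly_Mapping.lookup f m))"
proof (rule poly_mapping_eqI)
  fix m
  show "Poly_Mapping.lookup f m = Poly_Mapping.lookup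
    (\<Sum>m\<in>Poly_Mapping.keys f. Poly_Mapping.single m (Poly_Mapping.lookup f m)) m"
    by (simp add: lookup_sum lookup_single when_def in_keys_iff)
qed

lemma pol_subst_mult:
  assumes "coeff_hom c"
  shows "pol_subst c x (f * g) = pol_subst c x f * pol_subst c x g"
proof -
  let ?l = Poly_Mapping.lookup and ?k = Poly_Mapping.keys and ?s = Poly_Mapping.single
  have c: "c 0 = 0" "\<And>a b. c (a * b) = c a * c b" using assms by (simp_all add: coeff_hom_def)
  have "f * g = (\<Sum>m\<in>?k f. ?s m (?l f m)) * (\<Sum>m'\<in>?k g. ?s m' (?l g m'))"
    using poly_expand[of f] poly_expand[of g] by simp
  also have "\<dots> = (\<Sum>m\<in>?k f. \<Sum>m'\<in>?k g. ?s (m + m') (?l f m * ?l g m'))"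
    by (simp add: sum_product mult_single)
  finally have "pol_subst c x (f * g) =
      (\<Sum>m\<in>?k f. \<Sum>m'\<in>?k g. (c (?l f m) * monom_val x m) * (c (?l g m') * monom_val x m'))"
    by (simp add: pol_subst_sum[OF assms] pol_subst_single c monom_val_add mult_ac)
  then show ?thesis by (simp add: pol_subst_monom_val sum_product)
qed

lemma pol_subst_one: "coeff_hom c \<Longrightarrow> pol_subst c x 1 = 1"
  unfolding single_one[symmetric] by (subst pol_subst_single) (simp_all add: coeff_hom_def)

lemma pol_subst_const: "coeff_hom c \<Longrightarrow> pol_subst c x (const_pol a) = c a"
  unfolding const_pol_def by (subst pol_subst_single) (simp_all add: coeff_hom_def)

lemma pol_subst_var: "coeff_hom c \<Longrightarrow> pol_subst c x (var_pol i) = x i"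
  unfolding var_pol_def by (subst pol_subst_single) (simp_all add: coeff_hom_def monom_val_def)

lemma coeff_hom_id: "coeff_hom (\<lambda>c. c)"
  by (simp add: coeff_hom_def)

lemma coeff_hom_const: "coeff_hom const_pol"
  by (simp add: coeff_hom_def const_pol_def single_add mult_single)

lemma const_pol_mult: "const_pol (a * b) = const_pol a * const_pol b"
  using coeff_hom_const unfolding coeff_hom_def by blast

lemma const_pol_sum: "(\<Sum>j\<in>I. const_pol (a j)) = const_pol (\<Sum>j\<in>I. a j)"
  by (induction I rule: infinite_finite_induct) (simp_all add: const_pol_def single_add)

lemma pol_subst_power: "coeff_hom c \<Longrightarrow> pol_subst c x (f ^ e) = pol_subst c x f ^ e"
  by (induction e) (simp_all add: pol_subst_one pol_subst_mult)

lemma pol_subst_prod: "coeff_hom c \<Longrightarrow> pol_subst c x (\<Prod>i\<in>I. f i) = (\<Prod>i\<in>I. pol_subst c x (f i))"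
  by (induction I rule: infinite_finite_induct) (simp_all add: pol_subst_one pol_subst_mult)

text \<open>Only variables that occur in \<open>f\<close> are constrained, because matrices and
  vectors say nothing about indices from \<open>n\<close> on.\<close>

lemma pol_subst_subst:
  assumes "coeff_hom c" "\<And>m i. m \<in> Poly_Mapping.keys f \<Longrightarrow> i \<in> Poly_Mapping.keys m \<Longrightarrow> pol_subst c x (y i) = z i"
  shows "pol_subst c x (pol_subst const_pol y f) = pol_subst c z f"
proof -
  have "pol_subst c x (monom_val y m) = monom_val z m" if "m \<in> Poly_Mapping.keys f" for m
    unfolding monom_val_def pol_subst_prod[OF assms(1)] pol_subst_power[OF assms(1)]
    using assms(2)[OF that] by simp
  then show ?thesis
    unfolding pol_subst_monom_val[of const_pol] pol_subst_monom_val[of c z] pol_subst_sum[OF assms(1)]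
      pol_subst_mult[OF assms(1)] pol_subst_const[OF assms(1)]
    by simp
qed

lemma pol_subst_lin:
  assumes "coeff_hom c"
  shows "pol_subst c x (\<Sum>j<n. const_pol (a j) * var_pol j) = (\<Sum>j<n. c (a j) * x j)"
  by (simp add: pol_subst_sum pol_subst_mult pol_subst_const pol_subst_var assms)

lemma pol_ring_keys: "f \<in> pol_ring n \<Longrightarrow> m \<in> Poly_Mapping.keys f \<Longrightarrow> i \<in> Poly_Mapping.keys m \<Longrightarrow> i < n"
  by (auto simp: pol_ring_def)

lemma pol_eval_lin_subst:
  assumes "f \<in> pol_ring n" "A \<in> carrier_mat n n" "v \<in> carrier_vec n"
  shows "pol_eval (lin_subst n A f) v = pol_eval f (A *\<^sub>v v)"
  unfolding pol_eval_def lin_subst_def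
proof (rule pol_subst_subst[OF coeff_hom_id])
  fix m i assume "m \<in> Poly_Mapping.keys f" "i \<in> Poly_Mapping.keys m"
  then have "i < n" using pol_ring_keys assms by blast
  then show "pol_subst (\<lambda>c. c) (($) v) (\<Sum>j<n. const_pol (A $$ (i, j)) * var_pol j) = (A *\<^sub>v v) $ i"
    unfolding pol_subst_lin[OF coeff_hom_id] using assms
    by (simp add: scalar_prod_def atLeast0LessThan)
qed

text \<open>Substitution reverses products, \<open>f(B(A x))\<close>; the inverse in
  \<open>pol_act\<close> turns this back into a left action.\<close>

lemma lin_subst_lin_subst:
  assumes f: "f \<in> pol_ring n" and A: "A \<in> carrier_mat n n" "B \<in> carrier_mat n n"
  shows "lin_subst n A (lin_subst n B f) = lin_subst n (B * A) f"
  unfolding lin_subst_def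
proof (rule pol_subst_subst[OF coeff_hom_const])
  fix m i assume "m \<in> Poly_Mapping.keys f" "i \<in> Poly_Mapping.keys m"
  then have i: "i < n" using pol_ring_keys f by blast
  have "pol_subst const_pol (\<lambda>i. \<Sum>j<n. const_pol (A $$ (i, j)) * var_pol j) (\<Sum>j<n. const_pol (B $$ (i, j)) * var_pol j)
      = (\<Sum>k<n. const_pol (B $$ (i, k)) * (\<Sum>j<n. const_pol (A $$ (k, j)) * var_pol j))"
    by (rule pol_subst_lin[OF coeff_hom_const])
  also have "\<dots> = (\<Sum>j<n. \<Sum>k<n. const_pol (B $$ (i, k) * A $$ (k, j)) * var_pol j)"
    unfolding sum_distrib_left mult.assoc[symmetric] const_pol_mult[symmetric] by (rule sum.swap)
  also have "\<dots> = (\<Sum>j<n. const_pol ((B * A) $$ (i, j)) * var_pol j)"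
  proof (rule sum.cong[OF HOL.refl])
    fix j assume "j \<in> {..<n}"
    then have "(\<Sum>k<n. B $$ (i, k) * A $$ (k, j)) = (B * A) $$ (i, j)"
      using A i by (auto simp: times_mat_def scalar_prod_def atLeast0LessThan)
    then show "(\<Sum>k<n. const_pol (B $$ (i, k) * A $$ (k, j)) * var_pol j) = const_pol ((B * A) $$ (i, j)) * var_pol j"
      unfolding sum_distrib_right[symmetric] const_pol_sum by simp
  qed
  finally show "pol_subst const_pol (\<lambda>i. \<Sum>j<n. const_pol (A $$ (i, j)) * var_pol j)
      (\<Sum>j<n. const_pol (B $$ (i, j)) * var_pol j) = (\<Sum>j<n. const_pol ((B * A) $$ (i, j)) * var_pol j)" .
qed

section \<open>Degree bounds and polynomial functions\<close>

definition mdeg :: "(nat \<Rightarrow>\<^sub>0 nat) \<Rightarrow> nat" where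
  "mdeg m = (\<Sum>i\<in>Poly_Mapping.keys m. Poly_Mapping.lookup m i)"

lemma mdeg_add: "mdeg (m + m') = mdeg m + mdeg m'"
proof -
  let ?S = "Poly_Mapping.keys m \<union> Poly_Mapping.keys m'"
  have "mdeg p = (\<Sum>i\<in>?S. Poly_Mapping.lookup p i)" if "Poly_Mapping.keys p \<subseteq> ?S" for p
    unfolding mdeg_def by (rule sum.mono_neutral_left) (use that in \<open>auto simp: in_keys_iff\<close>)
  from this[of m] this[of m'] this[of "m + m'"] keys_add[of m m'] show ?thesis
    by (simp add: lookup_add sum.distrib)
qed

definition pol_le :: "nat \<Rightarrow> nat \<Rightarrow> 'k::field mpol set" where
  "pol_le n d = {f \<in> pol_ring n. degree_le f d}"

lemma pol_le_iff:
  "f \<in> pol_le n d \<longleftrightarrow> (\<forall>m\<in>Poly_Mapping.keys f. Poly_Mapping.keys m \<subseteq> {..<n} \<and> mdeg m \<le> d)"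
  by (auto simp: pol_le_def pol_ring_def degree_le_def mdeg_def)

lemma pol_le_mono: "f \<in> pol_le n d \<Longrightarrow> d \<le> d' \<Longrightarrow> f \<in> pol_le n d'"
  by (auto simp: pol_le_iff)

lemma pol_le_zero: "0 \<in> pol_le n d"
  by (simp add: pol_le_iff)

lemma pol_le_add: "f \<in> pol_le n d \<Longrightarrow> g \<in> pol_le n d \<Longrightarrow> f + g \<in> pol_le n d"
  using keys_add[of f g] by (auto simp: pol_le_iff)

lemma pol_le_sum: "(\<And>i. i \<in> I \<Longrightarrow> f i \<in> pol_le n d) \<Longrightarrow> (\<Sum>i\<in>I. f i) \<in> pol_le n d"
  by (induction I rule: infinite_finite_induct) (auto intro: pol_le_zero pol_le_add)

lemma pol_le_mult:
  assumes "f \<in> pol_le n d" "g \<in> pol_le n d'"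
  shows "f * g \<in> pol_le n (d + d')"
  unfolding pol_le_iff
proof
  fix m assume "m \<in> Poly_Mapping.keys (f * g)"
  then obtain a b where ab: "a \<in> Poly_Mapping.keys f" "b \<in> Poly_Mapping.keys g" "m = a + b"
    using keys_mult[of f g] by blast
  then have "Poly_Mapping.keys a \<subseteq> {..<n}" "mdeg a \<le> d" "Poly_Mapping.keys b \<subseteq> {..<n}" "mdeg b \<le> d'"
    using assms by (auto simp: pol_le_iff)
  then show "Poly_Mapping.keys m \<subseteq> {..<n} \<and> mdeg m \<le> d + d'"
    using keys_add[of a b] ab by (auto simp: mdeg_add)
qed

lemma pol_le_const: "const_pol a \<in> pol_le n d"
  by (auto simp: pol_le_iff const_pol_def mdeg_def)

lemma pol_le_var: "i < n \<Longrightarrow> var_pol i \<in> pol_le n 1"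
  by (auto simp: pol_le_iff var_pol_def mdeg_def)

lemma pol_le_one: "1 \<in> pol_le n d"
  unfolding single_one[symmetric] using pol_le_const[of 1] by (simp add: const_pol_def)

lemma pol_le_power: "f \<in> pol_le n d \<Longrightarrow> f ^ e \<in> pol_le n (d * e)"
  by (induction e) (auto simp: pol_le_one dest: pol_le_mult)

lemma pol_le_prod: "finite I \<Longrightarrow> (\<And>i. i \<in> I \<Longrightarrow> f i \<in> pol_le n (d i)) \<Longrightarrow> (\<Prod>i\<in>I. f i) \<in> pol_le n (\<Sum>i\<in>I. d i)"
  by (induction I rule: finite_induct) (auto simp: pol_le_one intro: pol_le_mult)

lemma pol_le_linear: "(\<Sum>j<n. const_pol (a j) * var_pol j) \<in> pol_le n 1"
  using pol_le_mult[OF pol_le_const[of _ n 0] pol_le_var] by (intro pol_le_sum) auto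

lemma lin_subst_pol_le:
  assumes "f \<in> pol_le n d"
  shows "lin_subst n A f \<in> pol_le n d"
  unfolding lin_subst_def pol_subst_def
proof (rule pol_le_sum)
  fix m assume m: "m \<in> Poly_Mapping.keys f"
  let ?p = "\<Prod>i\<in>Poly_Mapping.keys m. (\<Sum>j<n. const_pol (A $$ (i, j)) * var_pol j) ^ Poly_Mapping.lookup m i"
  have "?p \<in> pol_le n (mdeg m)"
    unfolding mdeg_def using pol_le_power[OF pol_le_linear] by (intro pol_le_prod) auto
  then have "?p \<in> pol_le n d" by (rule pol_le_mono) (use assms m in \<open>auto simp: pol_le_iff\<close>)
  from pol_le_mult[OF pol_le_const[of _ n 0] this]
  show "const_pol (Poly_Mapping.lookup f m) * ?p \<in> pol_le n d" by simp
qed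

lemma lin_subst_sum: "lin_subst n A (\<Sum>i\<in>I. f i) = (\<Sum>i\<in>I. lin_subst n A (f i))"
  unfolding lin_subst_def by (rule pol_subst_sum[OF coeff_hom_const])

lemma pol_eval_sum: "pol_eval (\<Sum>i\<in>I. f i) v = (\<Sum>i\<in>I. pol_eval (f i) v)"
  unfolding pol_eval_def by (rule pol_subst_sum[OF coeff_hom_id])

lemma pol_eval_mult: "pol_eval (f * g) v = pol_eval f v * pol_eval g v"
  unfolding pol_eval_def by (rule pol_subst_mult[OF coeff_hom_id])

lemma pol_eval_add: "pol_eval (f + g) v = pol_eval f v + pol_eval g v"
  unfolding pol_eval_def by (rule pol_subst_add[OF coeff_hom_id])

lemma pol_eval_linear: "pol_eval (\<Sum>j<n. const_pol (a j) * var_pol j) v = (\<Sum>j<n. a j * v $ j)"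
  unfolding pol_eval_def by (rule pol_subst_lin[OF coeff_hom_id])

text \<open>The representing polynomial is only asserted to exist, as over a finite field it is not
  determined by the function.\<close>

definition pol_fun :: "nat \<Rightarrow> nat \<Rightarrow> ('k::field vec \<Rightarrow> 'k) \<Rightarrow> bool" where
  "pol_fun n d \<phi> \<longleftrightarrow> (\<exists>f\<in>pol_le n d. \<forall>v\<in>carrier_vec n. \<phi> v = pol_eval f v)"

lemma pol_fun_mult:
  assumes "pol_fun n d \<phi>" "pol_fun n d' \<psi>"
  shows "pol_fun n (d + d') (\<lambda>v. \<phi> v * \<psi> v)"
proof -
  obtain f g where f: "f \<in> pol_le n d" "\<forall>v\<in>carrier_vec n. \<phi> v = pol_eval f v"
    and g: "g \<in> pol_le n d'" "\<forall>v\<in>carrier_vec n. \<psi> v = pol_eval g v"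
    using assms unfolding pol_fun_def by blast
  show ?thesis unfolding pol_fun_def
    by (rule bexI[of _ "f * g"]) (use f g in \<open>simp_all add: pol_eval_mult pol_le_mult\<close>)
qed

lemma pol_fun_add:
  assumes "pol_fun n d \<phi>" "pol_fun n d \<psi>"
  shows "pol_fun n d (\<lambda>v. \<phi> v + \<psi> v)"
proof -
  obtain f g where f: "f \<in> pol_le n d" "\<forall>v\<in>carrier_vec n. \<phi> v = pol_eval f v"
    and g: "g \<in> pol_le n d" "\<forall>v\<in>carrier_vec n. \<psi> v = pol_eval g v"
    using assms unfolding pol_fun_def by blast
  show ?thesis unfolding pol_fun_def
    by (rule bexI[of _ "f + g"]) (use f g in \<open>simp_all add: pol_eval_add pol_le_add\<close>)
qed

lemma pol_fun_mono: "pol_fun n d \<phi> \<Longrightarrow> d \<le> d' \<Longrightarrow> pol_fun n d' \<phi>"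
  unfolding pol_fun_def using pol_le_mono by blast

lemma pol_fun_linear:
  assumes "y \<in> carrier_vec n" "\<And>v. v \<in> carrier_vec n \<Longrightarrow> \<phi> v = y \<bullet> v"
  shows "pol_fun n 1 \<phi>"
  unfolding pol_fun_def
proof (intro bexI ballI)
  show "(\<Sum>j<n. const_pol (y $ j) * var_pol j) \<in> pol_le n 1" by (rule pol_le_linear)
  show "\<phi> v = pol_eval (\<Sum>j<n. const_pol (y $ j) * var_pol j) v" if "v \<in> carrier_vec n" for v
    using assms that by (simp add: pol_eval_linear scalar_prod_def atLeast0LessThan)
qed

section \<open>Representations and sums over the group\<close>

lemma is_rep_D:
  fixes G (structure) and \<rho> :: "'g \<Rightarrow> 'k::field mat"
  assumes "group G" "is_rep G n \<rho>"
  shows "\<And>g. g \<in> carrier G \<Longrightarrow> \<rho> g \<in> carrier_mat n n"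
    and "\<And>g h. g \<in> carrier G \<Longrightarrow> h \<in> carrier G \<Longrightarrow> \<rho> (g \<otimes>\<^bsub>G\<^esub> h) = \<rho> g * \<rho> h"
    and "\<rho> \<one>\<^bsub>G\<^esub> = 1\<^sub>m n"
proof -
  have hom: "\<rho> \<in> hom G (GL n)" using assms by (simp add: is_rep_def)
  have car: "carrier (GL n) \<subseteq> carrier_mat n n"
    by (auto simp: GL_def units_of_def Units_def ring_mat_simps)
  have mul: "mult (GL n :: 'k mat monoid) = (*)" by (simp add: GL_def units_of_def ring_mat_simps)
  show 1: "\<rho> g \<in> carrier_mat n n" if "g \<in> carrier G" for g
    using hom that car by (auto simp: hom_def)
  show 2: "\<rho> (g \<otimes>\<^bsub>G\<^esub> h) = \<rho> g * \<rho> h" if "g \<in> carrier G" "h \<in> carrier G" for g h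
    using hom that mul by (auto simp: hom_def)
  interpret ring "ring_mat TYPE('k) n ()" by (rule ring_mat)
  have "group (GL n :: 'k mat monoid)" unfolding GL_def by (rule units_group)
  then have "\<rho> \<one>\<^bsub>G\<^esub> = \<one>\<^bsub>GL n\<^esub>"
    using hom assms(1) hom_one by blast
  then show "\<rho> \<one>\<^bsub>G\<^esub> = 1\<^sub>m n" by (simp add: GL_def units_of_def ring_mat_simps)
qed

text \<open>The Reynolds operator without its division by the group order. Invariance is that of a
  formal polynomial and comes from reindexing the sum by a left translation.\<close>

lemma average_invariant:
  fixes G (structure) and \<rho> :: "'g \<Rightarrow> 'k::field mat"
  assumes G: "group G" "finite (carrier G)" "is_rep G n \<rho>" and f: "f \<in> pol_le n d"
  defines "R \<equiv> (\<Sum>g\<in>carrier G. pol_act G n \<rho> g f)"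
  shows "R \<in> invariants G n \<rho>" "degree_le R d"
    "\<And>v. v \<in> carrier_vec n \<Longrightarrow> pol_eval R v = (\<Sum>g\<in>carrier G. pol_eval f (\<rho> g *\<^sub>v v))"
proof -
  interpret group G by fact
  note rep = is_rep_D[OF G(1,3)]
  have fr: "f \<in> pol_ring n" using f by (simp add: pol_le_def)
  have R: "R \<in> pol_le n d" unfolding R_def pol_act_def by (intro pol_le_sum lin_subst_pol_le f)
  then show "degree_le R d" by (simp add: pol_le_def)
  have "pol_act G n \<rho> h R = R" if h: "h \<in> carrier G" for h
  proof -
    have "pol_act G n \<rho> h R = (\<Sum>g\<in>carrier G. pol_act G n \<rho> (h \<otimes> g) f)"
      unfolding R_def pol_act_def lin_subst_sum
      by (intro sum.cong HOL.refl) (simp add: lin_subst_lin_subst fr rep h inv_mult_group)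
    also have "\<dots> = R" unfolding R_def
      by (rule sum.reindex_bij_witness[of _ "\<lambda>g. inv h \<otimes> g" "\<lambda>g. h \<otimes> g"])
        (use h in \<open>simp_all add: m_assoc[symmetric]\<close>)
    finally show ?thesis .
  qed
  then show "R \<in> invariants G n \<rho>" using R by (simp add: invariants_def pol_le_def)
  show "pol_eval R v = (\<Sum>g\<in>carrier G. pol_eval f (\<rho> g *\<^sub>v v))" if v: "v \<in> carrier_vec n" for v
  proof -
    have "pol_eval R v = (\<Sum>g\<in>carrier G. pol_eval f (\<rho> (inv g) *\<^sub>v v))"
      unfolding R_def pol_act_def pol_eval_sum
      by (intro sum.cong HOL.refl) (rule pol_eval_lin_subst[OF fr rep(1) v], simp)
    also have "\<dots> = (\<Sum>g\<in>carrier G. pol_eval f (\<rho> g *\<^sub>v v))"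
      by (rule sum.reindex_bij_witness[of _ "\<lambda>g. inv g" "\<lambda>g. inv g"]) simp_all
    finally show ?thesis .
  qed
qed

lemma invariant_eval:
  fixes G (structure) and \<rho> :: "'g \<Rightarrow> 'k::field mat"
  assumes G: "group G" "is_rep G n \<rho>" and f: "f \<in> invariants G n \<rho>"
    and g: "g \<in> carrier G" and v: "v \<in> carrier_vec n"
  shows "pol_eval f (\<rho> g *\<^sub>v v) = pol_eval f v"
proof -
  interpret group G by fact
  have "pol_act G n \<rho> (inv g) f = f" "f \<in> pol_ring n" using f g by (simp_all add: invariants_def)
  then show ?thesis using pol_eval_lin_subst[of f n "\<rho> g" v] is_rep_D(1)[OF G g] v g
    by (simp add: pol_act_def)
qed

section \<open>The upper bound\<close>

text \<open>The image of \<open>(0, 0, 0)\<close> is the normal form of a word, so identities in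
  \<open>G24\<close> become computations with triples.\<close>

lemma pres_class_eqI:
  assumes "word_act u (0, 0, 0) = word_act v (0, 0, 0)"
  shows "pres_class rels24 u = pres_class rels24 v"
proof -
  obtain i j k where v: "word_act v (0, 0, 0) = (i, j, k)" by (metis prod_cases3)
  show ?thesis
    unfolding pres_class_normal_form[OF v] pres_class_normal_form[OF assms[unfolded v]] by (rule HOL.refl)
qed

lemma carrier_G24: "g \<in> carrier G24 \<Longrightarrow> \<exists>u. g = pres_class rels24 u"
  by (auto simp: G24_def carrier_presented_group)

lemma finite_G24: "finite (carrier G24)"
  using order_G24 by (simp add: order_def card_ge_0_finite)

text \<open>\<open>z^6\<close> is a square root of 1 other than 1, which also excludes
  characteristic 2. In characteristic 3, \<open>(z^4 - 1)^3 = z^12 - 1 = 0\<close> would force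
  \<open>z^4 = 1\<close>.\<close>

lemma order12_D:
  fixes z :: "'k::field"
  assumes "z ^ 12 = 1" "\<forall>k. 0 < k \<and> k < 12 \<longrightarrow> z ^ k \<noteq> 1"
  shows "z ^ 6 = - 1" "(2::'k) \<noteq> 0" "(3::'k) \<noteq> 0" "(z ^ 4) ^ 3 = 1" "z ^ 4 \<noteq> 1"
proof -
  have "z ^ 6 \<noteq> 1" and 4: "z ^ 4 \<noteq> 1" using assms(2) by auto
  have "(z ^ 6 - 1) * (z ^ 6 + 1) = z ^ 12 - 1" by (simp add: algebra_simps flip: power_add)
  then have "(z ^ 6 - 1) * (z ^ 6 + 1) = 0" using assms(1) by simp
  then show 6: "z ^ 6 = - 1" using \<open>z ^ 6 \<noteq> 1\<close> by (simp add: eq_neg_iff_add_eq_0)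
  show "(2::'k) \<noteq> 0"
  proof
    assume "(2::'k) = 0"
    then have "(1::'k) = - 1" by (simp add: eq_neg_iff_add_eq_0)
    then show False using 6 \<open>z ^ 6 \<noteq> 1\<close> by simp
  qed
  show o: "(z ^ 4) ^ 3 = 1" using assms(1) by (simp flip: power_mult)
  show "z ^ 4 \<noteq> 1" by (rule 4)
  show "(3::'k) \<noteq> 0"
  proof
    assume *: "(3::'k) = 0"
    have "(z ^ 4 - 1) ^ 3 = (z ^ 4) ^ 3 - 1 - 3 * (z ^ 4 * z ^ 4 - z ^ 4)"
      by (simp add: power3_eq_cube algebra_simps)
    then have "(z ^ 4 - 1) ^ 3 = 0" unfolding * o by simp
    then show False using 4 by simp
  qed
qed

section \<open>Weight spaces of linear functionals\<close>

definition linear_fun :: "nat \<Rightarrow> ('k::field vec \<Rightarrow> 'k) \<Rightarrow> bool" where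
  "linear_fun n f \<longleftrightarrow> (\<exists>y\<in>carrier_vec n. \<forall>v\<in>carrier_vec n. f v = y \<bullet> v)"

lemma linear_fun_comb:
  assumes "linear_fun n f" "linear_fun n g"
  shows "linear_fun n (\<lambda>v. c * f v + d * g v)"
proof -
  obtain y y' where y: "y \<in> carrier_vec n" "\<forall>v\<in>carrier_vec n. f v = y \<bullet> v"
    "y' \<in> carrier_vec n" "\<forall>v\<in>carrier_vec n. g v = y' \<bullet> v"
    using assms unfolding linear_fun_def by blast
  show ?thesis unfolding linear_fun_def
    by (rule bexI[of _ "c \<cdot>\<^sub>v y + d \<cdot>\<^sub>v y'"])
      (use y in \<open>simp_all add: add_scalar_prod_distrib[of _ n]\<close>)
qed

lemma linear_fun_mat:
  assumes "linear_fun n f" "A \<in> carrier_mat n n"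
  shows "linear_fun n (\<lambda>v. f (A *\<^sub>v v))"
proof -
  obtain y where y: "y \<in> carrier_vec n" "\<forall>v\<in>carrier_vec n. f v = y \<bullet> v"
    using assms unfolding linear_fun_def by blast
  show ?thesis unfolding linear_fun_def
    by (rule bexI[of _ "A\<^sup>T *\<^sub>v y"])
      (use y assms(2) in \<open>simp_all add: transpose_vec_mult_scalar[of A n n]\<close>)
qed

lemma linear_fun_coord: "i < n \<Longrightarrow> linear_fun n (\<lambda>v. v $ i)"
  unfolding linear_fun_def by (rule bexI[of _ "unit_vec n i"]) simp_all

text \<open>Orthogonality of the characters of a group of order 3: the coefficients of
  \<open>b\<close> and \<open>c\<close> add up to \<open>1 + w + w^2 = 0\<close>.\<close>

lemma cube_root_sum:
  fixes w :: "'k::field"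
  assumes w: "w ^ 3 = 1" "w \<noteq> 1"
  shows "(a + w ^ (2 * 0) * b + w ^ 0 * c) + (a + w ^ (2 * 1) * b + w ^ 1 * c) +
    (a + w ^ (2 * 2) * b + w ^ 2 * c) = 3 * a"
proof -
  have "(w - 1) * (1 + w + w * w) = 0"
    using w(1) by (simp add: power3_eq_cube algebra_simps)
  then have s: "1 + w + w * w = 0" using w(2) by simp
  have "w ^ 4 = w ^ 3 * w" by (simp add: numeral_eq_Suc mult_ac)
  then have w4: "w ^ 4 = w" using w(1) by simp
  have "(a + w ^ (2 * 0) * b + w ^ 0 * c) + (a + w ^ (2 * 1) * b + w ^ 1 * c) +
    (a + w ^ (2 * 2) * b + w ^ 2 * c) = 3 * a + (1 + w + w * w) * (b + c)"
    by (simp add: w4 power2_eq_square) (simp add: algebra_simps)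
  then show ?thesis unfolding s by simp
qed

locale rep24 =
  fixes n :: nat and \<rho> :: "gen word set \<Rightarrow> 'k::field mat" and z :: 'k
  assumes rep: "is_rep G24 n \<rho>"
    and z: "z ^ 12 = 1" "\<forall>k. 0 < k \<and> k < 12 \<longrightarrow> z ^ k \<noteq> 1"
begin

definition act :: "gen word \<Rightarrow> 'k vec \<Rightarrow> 'k vec" where
  "act u v = \<rho> (pres_class rels24 u) *\<^sub>v v"

abbreviation "X \<equiv> carrier_vec n :: 'k vec set"
abbreviation "T \<equiv> act [(GenA, True), (GenA, True)]"
abbreviation "S \<equiv> act [(GenA, True), (GenA, True), (GenA, True)]"
abbreviation "B \<equiv> act wb"
abbreviation "C \<equiv> act wc"
abbreviation "om \<equiv> z ^ 4"

definition Wt :: "nat \<Rightarrow> nat \<Rightarrow> nat \<Rightarrow> ('k vec \<Rightarrow> 'k) set" where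
  "Wt i j k = {f. linear_fun n f \<and> (\<forall>v\<in>X. f (T v) = om ^ i * f v \<and>
    f (S v) = (- 1) ^ j * f v \<and> f (B v) = (- 1) ^ k * f v)}"

lemmas rep_facts = is_rep_D[OF group_G24 rep]

lemma act_closed [simp]: "v \<in> X \<Longrightarrow> act u v \<in> X"
  unfolding act_def using rep_facts(1)[of "pres_class rels24 u"] by simp

lemma act_append:
  assumes "v \<in> X"
  shows "act (u @ u') v = act u (act u' v)"
proof -
  let ?c = "pres_class rels24"
  have "\<rho> (?c (u @ u')) = \<rho> (?c u) * \<rho> (?c u')"
    using rep_facts(2)[of "?c u" "?c u'"] by (simp add: pres_class_mult24)
  then show ?thesis unfolding act_def
    using assoc_mult_mat_vec[OF rep_facts(1) rep_facts(1) assms] by simp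
qed

lemma act_Nil: "v \<in> X \<Longrightarrow> act [] v = v"
  by (simp add: act_def pres_class_Nil24 rep_facts(3))

lemma act_eq: "word_act u (0, 0, 0) = word_act u' (0, 0, 0) \<Longrightarrow> act u v = act u' v"
  unfolding act_def by (drule pres_class_eqI) simp

text \<open>A nested application such as \<open>T (T (T v))\<close> is a fold over blocks of
  letters, so an identity between operators reduces to one between concatenated words.\<close>

lemma foldr_act: "v \<in> X \<Longrightarrow> foldr act us v \<in> X \<and> foldr act us v = act (concat us) v"
  by (induction us) (auto simp: act_Nil act_append simp del: append.simps)

lemma foldr_act_eq:
  "v \<in> X \<Longrightarrow> word_act (concat us) (0, 0, 0) = word_act (concat us') (0, 0, 0) \<Longrightarrow>
    foldr act us v = foldr act us' v"
  using foldr_act act_eq by metis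

lemma act_relations:
  assumes "v \<in> X"
  shows "T (T (T v)) = v" "S (S v) = v" "B (B v) = v" "C (C v) = v"
    "T (S v) = S (T v)" "T (B v) = B (T v)" "S (B v) = B (S v)"
    "C (T v) = T (T (C v))" "C (S v) = S (C v)" "C (B v) = S (B (C v))"
    "act wa v = S (T (T v))" "act wa_inv v = S (T v)"
    "act [(GenB, False)] v = B v" "act [(GenC, False)] v = C v"
  using foldr_act_eq[OF assms, of "[wa @ wa, wa @ wa, wa @ wa]" "[]"]
    foldr_act_eq[OF assms, of "[wa @ wa @ wa, wa @ wa @ wa]" "[]"]
    foldr_act_eq[OF assms, of "[wb, wb]" "[]"]
    foldr_act_eq[OF assms, of "[wc, wc]" "[]"]
    foldr_act_eq[OF assms, of "[wa @ wa, wa @ wa @ wa]" "[wa @ wa @ wa, wa @ wa]"]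
    foldr_act_eq[OF assms, of "[wa @ wa, wb]" "[wb, wa @ wa]"]
    foldr_act_eq[OF assms, of "[wa @ wa @ wa, wb]" "[wb, wa @ wa @ wa]"]
    foldr_act_eq[OF assms, of "[wc, wa @ wa]" "[wa @ wa, wa @ wa, wc]"]
    foldr_act_eq[OF assms, of "[wc, wa @ wa @ wa]" "[wa @ wa @ wa, wc]"]
    foldr_act_eq[OF assms, of "[wc, wb]" "[wa @ wa @ wa, wb, wc]"]
    foldr_act_eq[OF assms, of "[wa]" "[wa @ wa @ wa, wa @ wa, wa @ wa]"]
    foldr_act_eq[OF assms, of "[wa_inv]" "[wa @ wa @ wa, wa @ wa]"]
    foldr_act_eq[OF assms, of "[[(GenB, False)]]" "[wb]"]
    foldr_act_eq[OF assms, of "[[(GenC, False)]]" "[wc]"]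
  by simp_all

lemma om_dvd: "3 dvd i \<Longrightarrow> om ^ i = 1"
  using order12_D(4)[OF z] by (auto elim!: dvdE simp: power_mult)

lemma om_mod: "i mod 3 = i' mod 3 \<Longrightarrow> om ^ i = om ^ i'"
proof -
  have "om ^ i = om ^ (i mod 3)" for i
  proof -
    have "om ^ i = om ^ (3 * (i div 3) + i mod 3)" by simp
    also have "\<dots> = om ^ (i mod 3)" unfolding power_add by (simp add: om_dvd)
    finally show ?thesis .
  qed
  then show "i mod 3 = i' mod 3 \<Longrightarrow> om ^ i = om ^ i'" by metis
qed

lemma sign_mod: "i mod 2 = i' mod 2 \<Longrightarrow> (- 1 :: 'k) ^ i = (- 1) ^ i'"
  by (metis even_iff_mod_2_eq_zero minus_one_power_iff)

lemma linear_fun_act: "linear_fun n f \<Longrightarrow> linear_fun n (\<lambda>v. f (act u v))"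
  unfolding act_def by (rule linear_fun_mat) (simp_all add: rep_facts)

lemma Wt_I: "linear_fun n f \<Longrightarrow> (\<And>v. v \<in> X \<Longrightarrow> f (T v) = om ^ i * f v) \<Longrightarrow>
    (\<And>v. v \<in> X \<Longrightarrow> f (S v) = (- 1) ^ j * f v) \<Longrightarrow>
    (\<And>v. v \<in> X \<Longrightarrow> f (B v) = (- 1) ^ k * f v) \<Longrightarrow> f \<in> Wt i j k"
  by (simp add: Wt_def)

lemma Wt_D:
  assumes "f \<in> Wt i j k" "v \<in> X"
  shows "f (T v) = om ^ i * f v" "f (S v) = (- 1) ^ j * f v" "f (B v) = (- 1) ^ k * f v"
  using assms by (simp_all add: Wt_def)

lemma Wt_C:
  assumes f: "f \<in> Wt i j k"
  shows "(\<lambda>v. f (C v)) \<in> Wt (2 * i) j (j + k)"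
proof (rule Wt_I)
  show "linear_fun n (\<lambda>v. f (C v))" using f by (intro linear_fun_act) (simp add: Wt_def)
  fix v assume v: "v \<in> X"
  show "f (C (T v)) = om ^ (2 * i) * f (C v)" "f (C (S v)) = (- 1) ^ j * f (C v)"
    "f (C (B v)) = (- 1) ^ (j + k) * f (C v)"
    unfolding act_relations(8-10)[OF v] using v Wt_D[OF f]
    by (simp_all add: power_add mult_2 mult.assoc)
qed

text \<open>Every functional is a combination of weight functionals because 2 and 3 are invertible
  and the cube roots of unity lie in \<open>K\<close>. The eigenspaces are split off for one of the
  commuting operators at a time: \<open>B\<close> innermost, then \<open>S\<close>, then
  \<open>T\<close>.\<close>

lemma Wt_sep:
  assumes x: "x \<in> X" "y \<in> X"
    and eq: "\<And>i j k f. i < 3 \<Longrightarrow> j < 2 \<Longrightarrow> k < 2 \<Longrightarrow> f \<in> Wt i j k \<Longrightarrow> f x = f y"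
  shows "x = y"
proof -
  have two: "(2::'k) \<noteq> 0" and three: "(3::'k) \<noteq> 0" using order12_D[OF z] by simp_all
  have half: "f x = f y" if "f x + a = f y + b" "f x - a = f y - b" for f :: "'k vec \<Rightarrow> 'k" and a b
  proof -
    have "2 * f x = (f x + a) + (f x - a)" by simp
    also have "\<dots> = (f y + b) + (f y - b)" unfolding that ..
    also have "\<dots> = 2 * f y" by simp
    finally show ?thesis using two by simp
  qed
  have 1: "f x = f y" if f: "linear_fun n f" "i < 3" "j < 2" "\<And>v. v \<in> X \<Longrightarrow> f (T v) = om ^ i * f v"
    "\<And>v. v \<in> X \<Longrightarrow> f (S v) = (- 1) ^ j * f v" for f i j
  proof -
    have *: "(\<lambda>v. 1 * f v + (- 1) ^ k * f (B v)) \<in> Wt i j k" if "k < 2" for k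
    proof (rule Wt_I)
      have k: "k = 0 \<or> k = 1" using that by auto
      show "linear_fun n (\<lambda>v. 1 * f v + (- 1) ^ k * f (B v))"
        by (intro linear_fun_comb linear_fun_act f)
      fix v assume v: "v \<in> X"
      show "1 * f (B v) + (- 1) ^ k * f (B (B v)) = (- 1) ^ k * (1 * f v + (- 1) ^ k * f (B v))"
        unfolding act_relations(3)[OF v] using k by (elim disjE) simp_all
      show "1 * f (T v) + (- 1) ^ k * f (B (T v)) = om ^ i * (1 * f v + (- 1) ^ k * f (B v))"
        unfolding act_relations(6)[OF v, symmetric] f(4)[OF v] f(4)[OF act_closed[OF v]]
        by (simp only: distrib_left mult_1 mult_ac)
      show "1 * f (S v) + (- 1) ^ k * f (B (S v)) = (- 1) ^ j * (1 * f v + (- 1) ^ k * f (B v))"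
        unfolding act_relations(7)[OF v, symmetric] f(5)[OF v] f(5)[OF act_closed[OF v]]
        by (simp only: distrib_left mult_1 mult_ac)
    qed
    show ?thesis
      using eq[OF f(2,3) _ *, of 0] eq[OF f(2,3) _ *, of 1] by (intro half[of f "f (B x)" "f (B y)"]) simp_all
  qed
  have 2: "f x = f y" if f: "linear_fun n f" "i < 3" "\<And>v. v \<in> X \<Longrightarrow> f (T v) = om ^ i * f v" for f i
  proof -
    have g: "1 * f x + (- 1) ^ j * f (S x) = 1 * f y + (- 1) ^ j * f (S y)" if "j < 2" for j
    proof (rule 1[OF _ f(2) that])
      have j: "j = 0 \<or> j = 1" using that by auto
      show "linear_fun n (\<lambda>v. 1 * f v + (- 1) ^ j * f (S v))"
        by (intro linear_fun_comb linear_fun_act f)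
      fix v assume v: "v \<in> X"
      show "1 * f (S v) + (- 1) ^ j * f (S (S v)) = (- 1) ^ j * (1 * f v + (- 1) ^ j * f (S v))"
        unfolding act_relations(2)[OF v] using j by (elim disjE) simp_all
      show "1 * f (T v) + (- 1) ^ j * f (S (T v)) = om ^ i * (1 * f v + (- 1) ^ j * f (S v))"
        unfolding act_relations(5)[OF v, symmetric] f(3)[OF v] f(3)[OF act_closed[OF v]]
        by (simp only: distrib_left mult_1 mult_ac)
    qed
    show ?thesis
      using g[of 0] g[of 1] by (intro half[of f "f (S x)" "f (S y)"]) simp_all
  qed
  have 3: "f x = f y" if f: "linear_fun n f" for f
  proof -
    \<comment> \<open>Unnormalised projection to the eigenvalue \<open>om ^ i\<close> of
      \<open>T\<close>: the coefficients are \<open>om ^ (- i)\<close> and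
      \<open>om ^ (- 2 i)\<close>, written with nonnegative exponents modulo 3.\<close>
    let ?g = "\<lambda>i v. 1 * (1 * f v + om ^ (2 * i) * f (T v)) + om ^ i * f (T (T v))"
    have g: "?g i x = ?g i y" if i: "i < 3" for i
    proof (rule 2[OF _ i])
      show "linear_fun n (?g i)" by (intro linear_fun_comb linear_fun_act[of "\<lambda>v. f (T v)"] linear_fun_act f)
      have o: "om ^ i * (om ^ (2 * i) * a) = a" for a
      proof -
        have "om ^ i * (om ^ (2 * i) * a) = om ^ (i + 2 * i) * a" by (simp only: power_add mult.assoc)
        then show ?thesis by (simp add: om_dvd)
      qed
      have o2: "om ^ (2 * i) = om ^ i * om ^ i" by (simp only: mult_2 power_add)
      fix v assume v: "v \<in> X"
      show "1 * (1 * f (T v) + om ^ (2 * i) * f (T (T v))) + om ^ i * f (T (T (T v))) = om ^ i * ?g i v"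
        unfolding act_relations(1)[OF v] distrib_left mult_1 o unfolding o2 by (simp only: add_ac mult.assoc)
    qed
    have "3 * f v = ?g 0 v + ?g 1 v + ?g 2 v" for v
      using cube_root_sum[OF order12_D(4,5)[OF z], of "f v" "f (T v)" "f (T (T v))"] by (simp only: mult_1)
    then have "3 * f x = 3 * f y" using g[of 0] g[of 1] g[of 2] by (simp only:)
    then show ?thesis using three by simp
  qed
  show ?thesis
    using x 3[OF linear_fun_coord] by (intro eq_vecI) auto
qed

section \<open>From invariant polynomials to sums of monomials\<close>

lemma orbit_act: "act u v = w \<Longrightarrow> v \<in> X \<Longrightarrow> orbit G24 \<rho> v = orbit G24 \<rho> w"
proof -
  interpret group G24 by (rule group_G24)
  assume w: "act u v = w" and v: "v \<in> X"
  have *: "orbit G24 \<rho> (\<rho> g *\<^sub>v v) \<subseteq> orbit G24 \<rho> v" if g: "g \<in> carrier G24" and v: "v \<in> X" for g v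
    unfolding orbit_def
  proof (intro image_subsetI)
    fix h assume h: "h \<in> carrier G24"
    have "\<rho> h *\<^sub>v (\<rho> g *\<^sub>v v) = \<rho> (h \<otimes>\<^bsub>G24\<^esub> g) *\<^sub>v v"
      using assoc_mult_mat_vec[OF rep_facts(1)[OF h] rep_facts(1)[OF g] v] rep_facts(2)[OF h g] by simp
    then show "\<rho> h *\<^sub>v (\<rho> g *\<^sub>v v) \<in> (\<lambda>g. \<rho> g *\<^sub>v v) ` carrier G24"
      using g h by auto
  qed
  let ?g = "pres_class rels24 u"
  have w': "w = \<rho> ?g *\<^sub>v v" using w by (simp add: act_def)
  have "\<rho> (inv\<^bsub>G24\<^esub> ?g) *\<^sub>v w = \<rho> (inv\<^bsub>G24\<^esub> ?g \<otimes>\<^bsub>G24\<^esub> ?g) *\<^sub>v v"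
    unfolding w' using assoc_mult_mat_vec[OF rep_facts(1) rep_facts(1) v, of "inv\<^bsub>G24\<^esub> ?g" ?g]
      rep_facts(2)[of "inv\<^bsub>G24\<^esub> ?g" ?g] by simp
  then have "\<rho> (inv\<^bsub>G24\<^esub> ?g) *\<^sub>v w = v" using v by (simp add: rep_facts(3))
  then show "orbit G24 \<rho> v = orbit G24 \<rho> w"
    using *[of ?g v] *[of "inv\<^bsub>G24\<^esub> ?g" w] v w act_closed[OF v, of u] unfolding w' by auto
qed

sublocale weight_system X T S B C Wt om "\<lambda>v w. orbit G24 \<rho> v = orbit G24 \<rho> w"
proof
  show "om ^ 3 = 1" "om \<noteq> 1" "(2::'k) \<noteq> 0" using order12_D[OF z] by simp_all
  show "x \<in> X \<Longrightarrow> T x \<in> X" "x \<in> X \<Longrightarrow> S x \<in> X" "x \<in> X \<Longrightarrow> B x \<in> X" "x \<in> X \<Longrightarrow> C x \<in> X" for x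
    by simp_all
  show "x \<in> X \<Longrightarrow> C (C x) = x" for x by (rule act_relations)
  show "f \<in> Wt i j k \<Longrightarrow> x \<in> X \<Longrightarrow> f (T x) = om ^ i * f x"
    "f \<in> Wt i j k \<Longrightarrow> x \<in> X \<Longrightarrow> f (S x) = (- 1) ^ j * f x"
    "f \<in> Wt i j k \<Longrightarrow> x \<in> X \<Longrightarrow> f (B x) = (- 1) ^ k * f x" for f i j k x
    by (fact Wt_D)+
  show "f \<in> Wt i j k \<Longrightarrow> (\<lambda>x. f (C x)) \<in> Wt (2 * i) j (j + k)" for f i j k
    by (rule Wt_C)
  show "f \<in> Wt i' j' k'" if "f \<in> Wt i j k" "i mod 3 = i' mod 3" "j mod 2 = j' mod 2" "k mod 2 = k' mod 2"
    for f i j k i' j' k'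
    using that(1) unfolding Wt_def om_mod[OF that(2)] sign_mod[OF that(3)] sign_mod[OF that(4)] .
  show "(\<lambda>x. c * f x - d * g x) \<in> Wt i j k" if "f \<in> Wt i j k" "g \<in> Wt i j k" for f g i j k c d
    using that linear_fun_comb[of n f g c "- d"] by (auto simp: Wt_def algebra_simps)
  show "x = y" if "x \<in> X" "y \<in> X" "\<And>i j k f. i < 3 \<Longrightarrow> j < 2 \<Longrightarrow> k < 2 \<Longrightarrow> f \<in> Wt i j k \<Longrightarrow> f x = f y" for x y
    using that by (rule Wt_sep)
qed (use orbit_act in simp_all)

lemma wt_prod_pol_fun: "wt_prod Wt d i j k m \<Longrightarrow> pol_fun n d m"
proof (induction rule: wt_prod.induct)
  case (wt_prod_single f i j k)
  then show ?case unfolding Wt_def linear_fun_def using pol_fun_linear by blast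
qed (rule pol_fun_mult)

text \<open>Each letter of the word either fixes both summands (\<open>a\<close>, \<open>b\<close>)
  or exchanges them (\<open>c\<close>).\<close>

lemma sym_invariant:
  assumes m: "Z D m" and v: "v \<in> X"
  shows "m (act u v) + m (C (act u v)) = m v + m (C v)"
proof (induction u)
  case Nil
  then show ?case using v by (simp add: act_Nil)
next
  case (Cons l u)
  let ?x = "act u v"
  have x: "?x \<in> X" using v by simp
  have "act (l # u) v = act [l] ?x" using act_append[OF v, of "[l]" u] by simp
  moreover have "m (act [l] ?x) + m (C (act [l] ?x)) = m ?x + m (C ?x)"
  proof -
    note Zs = zero_sum_T[OF m] zero_sum_S[OF m] zero_sum_B[OF m] zero_sum_T[OF zero_sum_C[OF m]] zero_sum_S[OF zero_sum_C[OF m]] zero_sum_B[OF zero_sum_C[OF m]]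
    obtain a e where l: "l = (a, e)" by (cases l)
    show ?thesis
    proof (cases a)
      case GenA
      then have "act [l] ?x = (if e then S (T (T ?x)) else S (T ?x))"
        using act_relations(11,12)[OF x] l by simp
      then show ?thesis using x by (simp add: Zs)
    next
      case GenB
      then have "act [l] ?x = B ?x"
        using act_relations(13)[OF x] l by (cases e) simp_all
      then show ?thesis using x by (simp add: Zs)
    next
      case GenC
      then have "act [l] ?x = C ?x"
        using act_relations(14)[OF x] l by (cases e) simp_all
      then show ?thesis using x by (simp add: CC add.commute)
    qed
  qed
  ultimately show ?case using Cons by simp
qed

text \<open>A polynomial representing \<open>m + m o C\<close> need not be formally invariant. Its
  sum over the group is, keeps the degree, and evaluates to 24 times the same function.\<close>

lemma sums_agree_of_invariants:
  assumes v: "v \<in> X" "w \<in> X"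
    and eq: "\<And>f. f \<in> invariants G24 n \<rho> \<Longrightarrow> degree_le f 9 \<Longrightarrow> pol_eval f v = pol_eval f w"
  shows "sums_agree v w"
  unfolding sums_agree_def
proof (intro allI impI)
  fix m assume m: "Z 9 m"
  let ?F = "\<lambda>x. m x + m (C x)"
  have pf: "pol_fun n 9 m" if m: "Z 9 m" for m
    using m wt_prod_pol_fun pol_fun_mono unfolding zero_sum_def by blast
  have "pol_fun n 9 ?F" by (rule pol_fun_add[OF pf[OF m] pf[OF zero_sum_C[OF m]]])
  then obtain f where f: "f \<in> pol_le n 9" "\<And>x. x \<in> X \<Longrightarrow> ?F x = pol_eval f x"
    unfolding pol_fun_def by blast
  let ?R = "\<Sum>g\<in>carrier G24. pol_act G24 n \<rho> g f"
  note R = average_invariant[OF group_G24 finite_G24 rep f(1)]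
  have "pol_eval ?R x = 24 * ?F x" if x: "x \<in> X" for x
  proof -
    have "pol_eval f (\<rho> g *\<^sub>v x) = ?F x" if g: "g \<in> carrier G24" for g
    proof -
      obtain u where u: "g = pres_class rels24 u" using carrier_G24[OF g] by blast
      show ?thesis using f(2)[OF act_closed[OF x, of u]] sym_invariant[OF m x, of u] unfolding u act_def by simp
    qed
    then have "pol_eval ?R x = of_nat (card (carrier G24)) * ?F x" unfolding R(3)[OF x] by simp
    then show ?thesis using order_G24 by (simp add: order_def)
  qed
  then have "24 * ?F v = 24 * ?F w" using eq[OF R(1,2)] v by metis
  moreover have "(24::'k) = 2 * 2 * 2 * 3" by simp
  then have "(24::'k) \<noteq> 0" using order12_D(2,3)[OF z] by (metis no_zero_divisors)
  ultimately show "?F v = ?F w" using mult_cancel_left by blast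
qed

lemma separating_9: "separating_set G24 n \<rho> {f \<in> invariants G24 n \<rho>. degree_le f 9}"
  unfolding separating_set_def
proof (intro conjI ballI impI)
  fix v w :: "'k vec" assume v: "v \<in> X" "w \<in> X" and ne: "orbit G24 \<rho> v \<noteq> orbit G24 \<rho> w"
  show "\<exists>f\<in>{f \<in> invariants G24 n \<rho>. degree_le f 9}. pol_eval f v \<noteq> pol_eval f w"
  proof (rule ccontr)
    assume "\<not> ?thesis"
    then have "sums_agree v w" by (intro sums_agree_of_invariants v) auto
    then show False using same_orbit[OF v] ne by blast
  qed
qed auto

lemma beta_sep_rep_le: "beta_sep_rep G24 n \<rho> \<le> 9"
proof -
  have "beta_sep_rep G24 n \<rho> \<le> enat 9"
    unfolding beta_sep_rep_def by (rule Inf_lower) (use separating_9 in auto)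
  then show ?thesis by (simp add: numeral_eq_enat)
qed

end

section \<open>A three-dimensional module attaining the bound\<close>

text \<open>The tuple \<open>(s, x, y, u)\<close> encodes \<open>diag(x, y, u)\<close>, with the first two columns swapped if \<open>s\<close> holds.\<close>

type_synonym 'k mono3 = "bool \<times> 'k \<times> 'k \<times> 'k"

fun mono3_mult :: "'k::field mono3 \<Rightarrow> 'k mono3 \<Rightarrow> 'k mono3" where
  "mono3_mult (s, x, y, u) (s', x', y', u') =
    (s \<noteq> s', x * (if s then y' else x'), y * (if s then x' else y'), u * u')"

fun mono3_mat :: "'k::field mono3 \<Rightarrow> 'k mat" where
  "mono3_mat (s, x, y, u) = mat 3 3 (\<lambda>(i, j).
    if i = 0 \<and> j = (if s then 1 else 0) then x
    else if i = 1 \<and> j = (if s then 0 else 1) then y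
    else if i = 2 \<and> j = 2 then u else 0)"

definition vec3 :: "'k \<Rightarrow> 'k \<Rightarrow> 'k \<Rightarrow> 'k vec" where
  "vec3 a b c = vec 3 (\<lambda>i. if i = 0 then a else if i = 1 then b else c)"

lemma less_3_cases: "(i::nat) < 3 \<longleftrightarrow> i = 0 \<or> i = 1 \<or> i = 2" by auto

lemma sum_3: "(\<Sum>i\<in>{0..<3::nat}. f i) = f 0 + f 1 + f 2"
  by (simp add: numeral_eq_Suc)

lemma mono3_mat_carrier [simp]: "mono3_mat t \<in> carrier_mat 3 3"
  by (cases t) simp

lemma mono3_mat_mult: "mono3_mat t * mono3_mat t' = mono3_mat (mono3_mult t t')"
proof (cases t; cases t')
  fix s x y u s' x' y' u' assume t: "t = (s, x, y, u)" "t' = (s', x', y', u')"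
  show ?thesis
  proof (rule eq_matI)
    fix i j assume "i < dim_row (mono3_mat (mono3_mult t t'))" "j < dim_col (mono3_mat (mono3_mult t t'))"
    then have "i = 0 \<or> i = 1 \<or> i = 2" "j = 0 \<or> j = 1 \<or> j = 2" using t by (auto simp: less_3_cases)
    then show "(mono3_mat t * mono3_mat t') $$ (i, j) = mono3_mat (mono3_mult t t') $$ (i, j)"
      unfolding t by (elim disjE; cases s; cases s') (simp_all add: scalar_prod_def sum_3)
  qed (use t in simp_all)
qed

lemma mono3_mat_one: "mono3_mat (False, 1, 1, 1) = 1\<^sub>m 3"
  by (rule eq_matI) (auto simp: less_3_cases)

lemma mono3_mat_vec: "mono3_mat (s, x, y, u) *\<^sub>v vec3 a b c =
    vec3 (x * (if s then b else a)) (y * (if s then a else b)) (u * c)"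
proof (rule eq_vecI)
  fix i assume "i < dim_vec (vec3 (x * (if s then b else a)) (y * (if s then a else b)) (u * c))"
  then have "i = 0 \<or> i = 1 \<or> i = 2" by (auto simp: vec3_def less_3_cases)
  then show "(mono3_mat (s, x, y, u) *\<^sub>v vec3 a b c) $ i =
      vec3 (x * (if s then b else a)) (y * (if s then a else b)) (u * c) $ i"
    by (elim disjE; cases s) (simp_all add: vec3_def scalar_prod_def sum_3)
qed (simp add: vec3_def)

lemma vec3_inject: "vec3 a b c = vec3 a' b' c' \<longleftrightarrow> a = a' \<and> b = b' \<and> c = c'"
proof
  assume e: "vec3 a b c = vec3 a' b' c'"
  have "vec3 a b c $ i = vec3 a' b' c' $ i" for i using e by simp
  from this[of 0] this[of 1] this[of 2] show "a = a' \<and> b = b' \<and> c = c'" by (simp add: vec3_def)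
qed simp

lemma vec3_carrier [simp]: "vec3 a b c \<in> carrier_vec 3"
  by (simp add: vec3_def)

lemma mono3_mult_assoc: "mono3_mult (mono3_mult t t') t'' = mono3_mult t (mono3_mult t' t'')"
  by (cases t; cases t'; cases t'') (auto simp: mult.assoc)

text \<open>\<open>z^10\<close> is the inverse of \<open>z^2\<close>; using it keeps all
  computations among powers of \<open>z\<close>.\<close>

fun letter3 :: "'k::field \<Rightarrow> gen \<times> bool \<Rightarrow> 'k mono3" where
  "letter3 z (GenA, e) = (False, if e then z ^ 2 else z ^ 10, if e then z ^ 10 else z ^ 2, 1)"
| "letter3 z (GenB, e) = (False, 1, - 1, - 1)"
| "letter3 z (GenC, e) = (True, 1, 1, - 1)"

definition word3 :: "'k::field \<Rightarrow> gen word \<Rightarrow> 'k mono3" where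
  "word3 z u = foldr (\<lambda>l. mono3_mult (letter3 z l)) u (False, 1, 1, 1)"

lemma mono3_mult_one: "mono3_mult (False, 1, 1, 1) t = t"
  by (cases t) simp

lemma word3_append: "word3 z (u @ v) = mono3_mult (word3 z u) (word3 z v)"
  by (induction u) (simp_all add: word3_def mono3_mult_one mono3_mult_assoc)

lemma word3_cong:
  assumes "pres_eq rels24 u v" and z: "(z::'k::field) ^ 12 = 1" "z ^ 6 = - 1"
  shows "word3 z u = word3 z v"
  using assms(1)
proof (induction rule: pres_eq.induct)
  case (rel u v)
  \<comment> \<open>The second diagonal entry of \<open>a\<close> is \<open>z^10\<close>, so
    \<open>a^6\<close> and \<open>a^3\<close> contribute these two powers.\<close>
  have "z ^ 60 = (z ^ 12) ^ 5" "z ^ 30 = (z ^ 12) ^ 2 * z ^ 6" by (simp_all flip: power_mult power_add)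
  then have "z ^ 60 = 1" "z ^ 30 = - 1" using z by simp_all
  then show ?case using rel by (auto simp: rels24_def word3_def z)
next
  case (cancel x e)
  have "z ^ 2 * z ^ 10 = 1" "z ^ 10 * z ^ 2 = 1" using z(1) by (simp_all flip: power_add)
  then show ?case by (cases x; cases e) (simp_all add: word3_def)
qed (simp_all add: word3_append)

definition rep3 :: "'k::field \<Rightarrow> gen word set \<Rightarrow> 'k mat" where
  "rep3 z U = mono3_mat (word3 z (SOME u. pres_class rels24 u = U))"

section \<open>Two points that degree 8 does not separate\<close>

locale primitive12 =
  fixes z :: "'k::field"
  assumes z: "z ^ 12 = 1" "\<forall>k. 0 < k \<and> k < 12 \<longrightarrow> z ^ k \<noteq> 1"
begin

lemma rep3_class: "rep3 z (pres_class rels24 u) = mono3_mat (word3 z u)"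
proof -
  let ?u = "SOME u'. pres_class rels24 u' = pres_class rels24 u"
  have "pres_class rels24 ?u = pres_class rels24 u" by (rule someI) (rule HOL.refl)
  then have "word3 z ?u = word3 z u"
    using word3_cong[OF _ z(1) order12_D(1)[OF z]] by (simp add: pres_class_eq_iff)
  then show ?thesis by (simp add: rep3_def)
qed

lemma is_rep3: "is_rep G24 3 (rep3 z)"
proof -
  interpret group G24 by (rule group_G24)
  have mult: "rep3 z (g \<otimes>\<^bsub>G24\<^esub> h) = rep3 z g * rep3 z h" if gh: "g \<in> carrier G24" "h \<in> carrier G24" for g h
  proof -
    obtain u v where uv: "g = pres_class rels24 u" "h = pres_class rels24 v"
      using carrier_G24[OF gh(1)] carrier_G24[OF gh(2)] by blast
    show ?thesis unfolding uv pres_class_mult24 rep3_class word3_append mono3_mat_mult by (rule HOL.refl)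
  qed
  have one: "rep3 z \<one>\<^bsub>G24\<^esub> = 1\<^sub>m 3"
    unfolding pres_class_Nil24[symmetric] rep3_class by (simp add: word3_def mono3_mat_one del: mono3_mat.simps)
  have car: "rep3 z g \<in> carrier_mat 3 3" for g by (simp add: rep3_def)
  have "rep3 z g \<in> Units (ring_mat TYPE('k) 3 ())" if g: "g \<in> carrier G24" for g
  proof -
    have "rep3 z g * rep3 z (inv\<^bsub>G24\<^esub> g) = 1\<^sub>m 3" "rep3 z (inv\<^bsub>G24\<^esub> g) * rep3 z g = 1\<^sub>m 3"
      using mult[OF g inv_closed[OF g]] mult[OF inv_closed[OF g] g] one r_inv[OF g] l_inv[OF g] by simp_all
    then show ?thesis unfolding Units_def ring_mat_simps using car by blast
  qed
  then show ?thesis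
    unfolding is_rep_def GL_def
    by (intro homI) (simp add: units_of_def, simp only: mult units_of_mult ring_mat_simps)
qed

text \<open>This is the invariant of degree 9. Under \<open>a\<close> the sixth powers and
  \<open>x y\<close> are fixed, under \<open>b\<close> the signs of \<open>y\<close> and
  \<open>u\<close> cancel, and under \<open>c\<close> both factors change sign.\<close>

lemma sep_function: "mono3_mat (word3 z u) *\<^sub>v vec3 a b c = vec3 a' b' c' \<Longrightarrow>
    (a' ^ 6 - b' ^ 6) * (a' * b' * c') = (a ^ 6 - b ^ 6) * (a * b * c)"
proof (induction u arbitrary: a' b' c')
  case Nil
  then show ?case by (simp add: word3_def mono3_mat_vec vec3_inject del: mono3_mat.simps)
next
  case (Cons l u)
  obtain s x y w where t: "word3 z u = (s, x, y, w)" by (cases "word3 z u")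
  obtain a1 b1 c1 where 1: "mono3_mat (word3 z u) *\<^sub>v vec3 a b c = vec3 a1 b1 c1"
    unfolding t mono3_mat_vec by blast
  have "word3 z (l # u) = mono3_mult (letter3 z l) (word3 z u)" by (simp add: word3_def)
  then have e: "mono3_mat (letter3 z l) *\<^sub>v vec3 a1 b1 c1 = vec3 a' b' c'"
    using Cons.prems 1 assoc_mult_mat_vec[of "mono3_mat (letter3 z l)" 3 3 "mono3_mat (word3 z u)" 3 "vec3 a b c"]
    by (simp add: mono3_mat_mult)
  obtain x e where l: "l = (x, e)" by (cases l)
  have z': "(z ^ 2 * t) ^ 6 = t ^ 6" "(z ^ 10 * t) ^ 6 = t ^ 6" "z ^ 2 * z ^ 10 = 1" for t
  proof -
    have "z ^ 60 = (z ^ 12) ^ 5" by (simp flip: power_mult)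
    then have "z ^ 60 = 1" using z by simp
    then show "(z ^ 2 * t) ^ 6 = t ^ 6" "(z ^ 10 * t) ^ 6 = t ^ 6" "z ^ 2 * z ^ 10 = 1"
      using z(1) by (simp_all add: power_mult_distrib flip: power_mult power_add)
  qed
  have z'': "z ^ 2 * p * (z ^ 10 * q) = p * q" "z ^ 10 * p * (z ^ 2 * q) = p * q" for p q
    using z'(3) by (metis mult.assoc mult.commute mult_1)+
  have "(a' ^ 6 - b' ^ 6) * (a' * b' * c') = (a1 ^ 6 - b1 ^ 6) * (a1 * b1 * c1)"
  proof (cases x)
    case GenA
    then have "a' = (if e then z ^ 2 else z ^ 10) * a1 \<and> b' = (if e then z ^ 10 else z ^ 2) * b1 \<and> c' = c1"
      using e l by (auto simp: mono3_mat_vec vec3_inject simp del: mono3_mat.simps)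
    then show ?thesis by (cases e) (simp_all add: z' z'')
  next
    case GenB
    then have "a' = a1 \<and> b' = - b1 \<and> c' = - c1"
      using e l by (auto simp: mono3_mat_vec vec3_inject simp del: mono3_mat.simps)
    then show ?thesis by simp
  next
    case GenC
    then have "a' = b1 \<and> b' = a1 \<and> c' = - c1"
      using e l by (auto simp: mono3_mat_vec vec3_inject simp del: mono3_mat.simps)
    then show ?thesis by (simp add: algebra_simps)
  qed
  then show ?case using Cons.IH[OF 1] by simp
qed

text \<open>With \<open>z^6 = -1\<close> the invariant of degree 9 takes the values
  \<open>2 z\<close> and \<open>- 2 z\<close>, distinct since \<open>4 z\<close> is nonzero.\<close>

lemma orbits_differ: "orbit G24 (rep3 z) (vec3 1 z 1) \<noteq> orbit G24 (rep3 z) (vec3 1 z (- 1))"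
proof
  interpret group G24 by (rule group_G24)
  assume eq: "orbit G24 (rep3 z) (vec3 1 z 1) = orbit G24 (rep3 z) (vec3 1 z (- 1))"
  have "rep3 z \<one>\<^bsub>G24\<^esub> *\<^sub>v vec3 1 z (- 1) = vec3 1 z (- 1)"
    by (simp add: is_rep_D(3)[OF group_G24 is_rep3])
  then have "vec3 1 z (- 1) \<in> orbit G24 (rep3 z) (vec3 1 z 1)"
    unfolding eq unfolding orbit_def by (intro image_eqI[of _ _ "\<one>\<^bsub>G24\<^esub>"] one_closed) simp
  then obtain g where g: "g \<in> carrier G24" "rep3 z g *\<^sub>v vec3 1 z 1 = vec3 1 z (- 1)"
    unfolding orbit_def by force
  then obtain u where u: "g = pres_class rels24 u" using carrier_G24[OF g(1)] by blast
  have "(1 ^ 6 - z ^ 6) * (1 * z * - 1) = (1 ^ 6 - z ^ 6) * (1 * z * 1)"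
    by (rule sep_function[of u]) (use g(2) in \<open>simp only: u rep3_class\<close>)
  then have "2 * (2 * z) = 0"
    unfolding order12_D(1)[OF z] by simp
  then have "z = 0" using order12_D(2)[OF z] by (metis mult_eq_0_iff)
  then show False using z(1) by simp
qed

lemma monom_val_vec3:
  assumes "Poly_Mapping.keys m \<subseteq> {..<3}"
  shows "monom_val (($) (vec3 a b c)) m =
    a ^ Poly_Mapping.lookup m 0 * b ^ Poly_Mapping.lookup m 1 * c ^ Poly_Mapping.lookup m 2"
proof -
  have "monom_val (($) (vec3 a b c)) m = (\<Prod>i\<in>{0..<3}. vec3 a b c $ i ^ Poly_Mapping.lookup m i)"
    by (rule monom_val_superset) (use assms in auto)
  then show ?thesis by (simp add: vec3_def numeral_eq_Suc mult.assoc)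
qed

lemma mdeg_3:
  assumes "Poly_Mapping.keys m \<subseteq> {..<3}"
  shows "mdeg m = Poly_Mapping.lookup m 0 + Poly_Mapping.lookup m 1 + Poly_Mapping.lookup m 2"
proof -
  have "mdeg m = (\<Sum>i\<in>{0..<3}. Poly_Mapping.lookup m i)"
    unfolding mdeg_def by (rule sum.mono_neutral_left) (use assms in \<open>auto simp: in_keys_iff\<close>)
  then show ?thesis by (simp add: sum_3)
qed

text \<open>The third coordinate is only scaled and never enters the other two. The quantifier over
  \<open>c\<close> is innermost, so one description covers both test points.\<close>

lemma rep3_vec3: "g \<in> carrier G24 \<Longrightarrow> \<exists>a' b' c'. \<forall>c. rep3 z g *\<^sub>v vec3 a b c = vec3 a' b' (c' * c)"
proof -
  assume "g \<in> carrier G24"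
  then obtain u where u: "g = pres_class rels24 u" using carrier_G24 by blast
  obtain s x y w where t: "word3 z u = (s, x, y, w)" by (cases "word3 z u")
  show ?thesis unfolding u rep3_class t mono3_mat_vec by blast
qed

text \<open>Translating the summation by \<open>h\<close> leaves the sum unchanged and also
  multiplies it by \<open>\<kappa>\<close>.\<close>

lemma sum_translate:
  assumes h: "h \<in> carrier G24" and x: "x \<in> carrier_vec 3"
    and \<phi>: "\<And>g. g \<in> carrier G24 \<Longrightarrow> \<phi> (rep3 z h *\<^sub>v (rep3 z g *\<^sub>v x)) = \<kappa> * \<phi> (rep3 z g *\<^sub>v x)"
    and \<kappa>: "\<kappa> \<noteq> 1"
  shows "(\<Sum>g\<in>carrier G24. \<phi> (rep3 z g *\<^sub>v x)) = (0::'k)"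
proof -
  interpret group G24 by (rule group_G24)
  note rep = is_rep_D[OF group_G24 is_rep3]
  let ?s = "\<Sum>g\<in>carrier G24. \<phi> (rep3 z g *\<^sub>v x)"
  have "?s = (\<Sum>g\<in>carrier G24. \<phi> (rep3 z (h \<otimes>\<^bsub>G24\<^esub> g) *\<^sub>v x))"
    by (rule sum.reindex_bij_witness[of _ "\<lambda>g. h \<otimes>\<^bsub>G24\<^esub> g" "\<lambda>g. inv\<^bsub>G24\<^esub> h \<otimes>\<^bsub>G24\<^esub> g"])
      (use h in \<open>simp_all add: m_assoc[symmetric]\<close>)
  also have "\<dots> = \<kappa> * ?s"
    unfolding sum_distrib_left
  proof (rule sum.cong[OF HOL.refl])
    fix g assume g: "g \<in> carrier G24"
    show "\<phi> (rep3 z (h \<otimes>\<^bsub>G24\<^esub> g) *\<^sub>v x) = \<kappa> * \<phi> (rep3 z g *\<^sub>v x)"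
      unfolding rep(2)[OF h g] assoc_mult_mat_vec[OF rep(1)[OF h] rep(1)[OF g] x] by (rule \<phi>[OF g])
  qed
  finally have "(1 - \<kappa>) * ?s = 0" by (simp add: left_diff_distrib)
  then show ?thesis using \<kappa> by simp
qed

lemma order12_dvd:
  assumes "z ^ e = 1"
  shows "12 dvd e"
proof -
  have "z ^ (12 * (e div 12) + e mod 12) = 1" using assms by simp
  then have "z ^ (e mod 12) = 1" unfolding power_add by (simp add: power_mult z(1))
  then have "e mod 12 = 0" using z(2)[rule_format, of "e mod 12"] by auto
  then show ?thesis by (rule mod_0_imp_dvd)
qed

text \<open>For even \<open>k\<close> the sign of the third coordinate is invisible. For odd
  \<open>k\<close> both sums vanish, because some generator multiplies the monomial by a factor
  other than 1.\<close>

lemma monomial_sums_agree: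
  assumes keys: "Poly_Mapping.keys m \<subseteq> {..<3}" and deg: "mdeg m \<le> 8"
  shows "(\<Sum>g\<in>carrier G24. monom_val (($) (rep3 z g *\<^sub>v vec3 1 z 1)) m) =
    (\<Sum>g\<in>carrier G24. monom_val (($) (rep3 z g *\<^sub>v vec3 1 z (- 1))) m)"
proof -
  define i j k where ijk: "i = Poly_Mapping.lookup m 0" "j = Poly_Mapping.lookup m 1" "k = Poly_Mapping.lookup m 2"
  have mv: "monom_val (($) (vec3 a b c)) m = a ^ i * b ^ j * c ^ k" for a b c :: 'k
    using monom_val_vec3[OF keys] by (simp add: ijk)
  have d: "i + j + k \<le> 8" using mdeg_3[OF keys] deg by (simp add: ijk)
  show ?thesis
  proof (cases "even k")
    case True
    have "monom_val (($) (rep3 z g *\<^sub>v vec3 1 z 1)) m = monom_val (($) (rep3 z g *\<^sub>v vec3 1 z (- 1))) m"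
      if g: "g \<in> carrier G24" for g
    proof -
      obtain a b c where "\<And>t. rep3 z g *\<^sub>v vec3 1 z t = vec3 a b (c * t)" using rep3_vec3[OF g] by blast
      then show ?thesis using True by (simp add: mv power_mult_distrib)
    qed
    then show ?thesis by (intro sum.cong HOL.refl)
  next
    case False
    have "(\<Sum>g\<in>carrier G24. monom_val (($) (rep3 z g *\<^sub>v vec3 1 z t)) m) = 0" for t
    proof -
      have gen: "rep3 z (gen24 x) = mono3_mat (letter3 z (x, True))" for x
        unfolding rep3_class word3_def by (cases x) simp_all
      have zero: ?thesis if \<kappa>: "\<kappa> \<noteq> 1" and eq: "\<And>a b c. monom_val (($) (rep3 z (gen24 x) *\<^sub>v vec3 a b c)) m =
          \<kappa> * monom_val (($) (vec3 a b c)) m" for x \<kappa>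
      proof (rule sum_translate[of "gen24 x" _ "\<lambda>v. monom_val (($) v) m" \<kappa>])
        fix g assume g: "g \<in> carrier G24"
        obtain a b c where "\<And>t. rep3 z g *\<^sub>v vec3 1 z t = vec3 a b (c * t)" using rep3_vec3[OF g] by blast
        then show "monom_val (($) (rep3 z (gen24 x) *\<^sub>v (rep3 z g *\<^sub>v vec3 1 z t))) m =
          \<kappa> * monom_val (($) (rep3 z g *\<^sub>v vec3 1 z t)) m" using eq by simp
      qed (use \<kappa> in simp_all)
      have tw: "(z ^ 2 * a) ^ i * (z ^ 10 * b) ^ j * c = z ^ (2 * i + 10 * j) * (a ^ i * b ^ j * c)" for a b c
      proof -
        have "z ^ (2 * i + 10 * j) = (z ^ 2) ^ i * (z ^ 10) ^ j" by (simp only: power_add power_mult)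
        then show ?thesis by (simp only: power_mult_distrib mult_ac)
      qed
      have one_ne: "(- 1 :: 'k) \<noteq> 1"
        using order12_D(2)[OF z] by (metis add.right_inverse one_add_one)
      \<comment> \<open>Both exponents are odd and congruent modulo 6. If they differed, their sum
        would be at least 1 + 7, and with \<open>k >= 1\<close> the degree would reach 9.\<close>
      have "i = j" if j: "odd j" and six: "6 dvd i + 5 * j"
      proof -
        obtain q where q: "i + 5 * j = 6 * q" using six by (elim dvdE)
        have "even (i + 5 * j)" unfolding q by simp
        then have "odd i" using j by simp
        then have "1 \<le> i" "1 \<le> j" "1 \<le> k" using j False by (auto intro: odd_pos Suc_leI)
        moreover have "q = j \<or> q + 1 \<le> j \<or> j + 1 \<le> q" by linarith
        ultimately show "i = j" using q d by linarith
      qed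
      then consider "even j" | "\<not> 6 dvd i + 5 * j" | "i = j" by blast
      then show ?thesis
      proof cases
        case 1
        show ?thesis
          by (rule zero[of "- 1" GenB])
            (use 1 False one_ne in \<open>simp_all add: gen mono3_mat_vec mv del: mono3_mat.simps\<close>)
      next
        case 2
        have "\<not> 12 dvd 2 * i + 10 * j" using 2 by presburger
        then have "z ^ (2 * i + 10 * j) \<noteq> 1" using order12_dvd by blast
        then show ?thesis
          by (rule zero[of "z ^ (2 * i + 10 * j)" GenA])
            (simp add: gen mono3_mat_vec mv tw del: mono3_mat.simps)
      next
        \<comment> \<open>For equal exponents the exchange of the first two coordinates is
          invisible, and \<open>c\<close> contributes only the sign of the odd power of the
          third.\<close>
        case 3
        show ?thesis
          by (rule zero[of "- 1" GenC])
            (use 3 False one_ne in \<open>simp_all add: gen mono3_mat_vec mv del: mono3_mat.simps\<close>)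
      qed
    qed
    then show ?thesis by simp
  qed
qed

text \<open>By invariance, 24 times the value of \<open>f\<close> is the combination of its
  monomials summed over the group, so the comparison can be made monomial by monomial.\<close>

lemma low_degree_agree:
  assumes f: "f \<in> invariants G24 3 (rep3 z)" "degree_le f 8"
  shows "pol_eval f (vec3 1 z 1) = pol_eval f (vec3 1 z (- 1))"
proof -
  have fl: "f \<in> pol_le 3 8" using f by (simp add: pol_le_def invariants_def)
  have 24: "24 * pol_eval f x = (\<Sum>m\<in>Poly_Mapping.keys f. Poly_Mapping.lookup f m *
      (\<Sum>g\<in>carrier G24. monom_val (($) (rep3 z g *\<^sub>v x)) m))" if x: "x \<in> carrier_vec 3" for x
  proof -
    have "24 * pol_eval f x = (\<Sum>g\<in>carrier G24. pol_eval f x)"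
      using order_G24 by (simp add: order_def)
    also have "\<dots> = (\<Sum>g\<in>carrier G24. pol_eval f (rep3 z g *\<^sub>v x))"
      by (intro sum.cong HOL.refl) (simp add: invariant_eval[OF group_G24 is_rep3 f(1) _ x])
    also have "\<dots> = (\<Sum>m\<in>Poly_Mapping.keys f. Poly_Mapping.lookup f m *
      (\<Sum>g\<in>carrier G24. monom_val (($) (rep3 z g *\<^sub>v x)) m))"
      unfolding pol_eval_def pol_subst_monom_val sum_distrib_left by (rule sum.swap)
    finally show ?thesis .
  qed
  have "24 * pol_eval f (vec3 1 z 1) = 24 * pol_eval f (vec3 1 z (- 1))"
    unfolding 24[OF vec3_carrier]
  proof (rule sum.cong[OF HOL.refl])
    fix m assume "m \<in> Poly_Mapping.keys f"
    then have "Poly_Mapping.keys m \<subseteq> {..<3}" "mdeg m \<le> 8" using fl by (auto simp: pol_le_iff)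
    from monomial_sums_agree[OF this]
    show "Poly_Mapping.lookup f m * (\<Sum>g\<in>carrier G24. monom_val (($) (rep3 z g *\<^sub>v vec3 1 z 1)) m) =
      Poly_Mapping.lookup f m * (\<Sum>g\<in>carrier G24. monom_val (($) (rep3 z g *\<^sub>v vec3 1 z (- 1))) m)" by simp
  qed
  moreover have "(24::'k) = 2 * 2 * 2 * 3" by simp
  then have "(24::'k) \<noteq> 0" using order12_D(2,3)[OF z] by (metis no_zero_divisors)
  ultimately show ?thesis using mult_cancel_left by blast
qed

lemma beta_sep_rep_ge: "9 \<le> beta_sep_rep G24 3 (rep3 z)"
  unfolding beta_sep_rep_def
proof (rule Inf_greatest)
  fix e assume "e \<in> {enat d | d. 0 < d \<and>
    separating_set G24 3 (rep3 z) {f \<in> invariants G24 3 (rep3 z). degree_le f d}}"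
  then obtain d where e: "e = enat d"
    and sep: "separating_set G24 3 (rep3 z) {f \<in> invariants G24 3 (rep3 z). degree_le f d}" by blast
  have "\<not> d \<le> 8"
  proof
    assume d: "d \<le> 8"
    let ?S = "{f \<in> invariants G24 3 (rep3 z). degree_le f d}"
    have "\<forall>v\<in>carrier_vec 3. \<forall>w\<in>carrier_vec 3. orbit G24 (rep3 z) v \<noteq> orbit G24 (rep3 z) w \<longrightarrow>
        (\<exists>f\<in>?S. pol_eval f v \<noteq> pol_eval f w)"
      using sep unfolding separating_set_def by (rule conjunct2)
    from this[rule_format, OF vec3_carrier vec3_carrier orbits_differ]
    obtain f where f: "f \<in> invariants G24 3 (rep3 z)" "degree_le f d"
      "pol_eval f (vec3 1 z 1) \<noteq> pol_eval f (vec3 1 z (- 1))" by blast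
    have "degree_le f 8" using f(2) d unfolding degree_le_def by (meson order_trans)
    with f(1,3) show False using low_degree_agree by blast
  qed
  then show "9 \<le> e" unfolding e by (simp add: numeral_eq_enat)
qed

end

theorem theorem3p7:
  fixes z :: "'k::field"
  assumes "z ^ 12 = 1" and "\<forall>k. 0 < k \<and> k < 12 \<longrightarrow> z ^ k \<noteq> 1"
  shows "beta_sep TYPE('k) G24 = 9"
proof (rule antisym)
  show "beta_sep TYPE('k) G24 \<le> 9"
    unfolding beta_sep_def
  proof (rule Sup_least)
    fix e assume "e \<in> {beta_sep_rep G24 n \<rho> | n (\<rho> :: gen word set \<Rightarrow> 'k mat). is_rep G24 n \<rho>}"
    then obtain n and \<rho> :: "gen word set \<Rightarrow> 'k mat" where e: "e = beta_sep_rep G24 n \<rho>" "is_rep G24 n \<rho>"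
      by blast
    interpret rep24 n \<rho> z by (unfold_locales) (fact e(2) assms)+
    show "e \<le> 9" unfolding e(1) by (rule beta_sep_rep_le)
  qed
  interpret primitive12 z by unfold_locales (fact assms)+
  show "9 \<le> beta_sep TYPE('k) G24"
    unfolding beta_sep_def
    by (rule order_trans[OF beta_sep_rep_ge], rule Sup_upper) (use is_rep3 in blast)
qed

end
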